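(* Let $F_{\mathcal H}$ be a $C^1$ Anosov diffeomorphism of $\mathbb T^2$ admitting a physical measure $\nu$ such that the basin of $\nu$ has full Lebesgue measure, $\nu$ is supported on a horseshoe $\mathcal H$ of zero Lebesgue measure, and $\omega(x)=\mathcal H$ for Lebesgue-a.e. $x\in\mathbb T^2$. Then for any $C^1$-diffeomorphism of $\mathbb T^2$ that is sufficiently close to $F_{\mathcal H}$ (in the $C^1$ topology), the Milnor attractor is not topologically invariant in $C^1$.
   Context: For a diffeomorphism $F$ preserving a probability measure $\nu$, the basin of $\nu$ is the set of all $x$ such that $\frac1n\sum_{k=0}^{n-1}\delta_{F^k(x)}\to\nu$ weakly-$*$; $\nu$ is physical if its basin has positive Lebesgue measure. A horseshoe is a locally maximal hyperbolic invariant Cantor set on which the map is topologically conjugate to a full two-sided shift on finitely many symbols. For a diffeomorphism $F:N\to N$ of a compact Riemannian manifold, the Milnor attractor $A_M(F)$ is the minimal by inclusion closed subset of $N$ that contains $\omega(x)$ for Lebesgue-a.e. $x\in N$ (it always exists). The Milnor attractor of a $C^1$-diffeomorphism $F$ is called topologically invariant in $C^1$ if for any $C^1$-diffeomorphism $G$ and any homeomorphism $H$ with $G=H\circ F\circ H^{-1}$ one has $A_M(G)=H(A_M(F))$. *)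

theory Defs
  imports "HOL-Probability.Probability"
begin

section \<open>The flat two-torus\<close>

definition int_lattice :: "(real^2) set" where
  "int_lattice = {n. \<forall>i. n $ i \<in> \<int>}"

lemma int_lattice_0 [simp]: "0 \<in> int_lattice"
  by (simp add: int_lattice_def)

lemma int_lattice_add: "m \<in> int_lattice \<Longrightarrow> n \<in> int_lattice \<Longrightarrow> m + n \<in> int_lattice"
  by (simp add: int_lattice_def)

lemma int_lattice_diff: "m \<in> int_lattice \<Longrightarrow> n \<in> int_lattice \<Longrightarrow> m - n \<in> int_lattice"
  by (simp add: int_lattice_def)

lemma int_lattice_uminus: "n \<in> int_lattice \<Longrightarrow> - n \<in> int_lattice"
  by (simp add: int_lattice_def)

quotient_type torus = "real^2" / "\<lambda>x y. x - y \<in> int_lattice"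
  morphisms rep_torus proj
proof (rule equivpI)
  show "reflp (\<lambda>x y. x - y \<in> int_lattice)"
    by (simp add: reflp_def)
  show "symp (\<lambda>x y. x - y \<in> int_lattice)"
    using int_lattice_uminus by (fastforce intro: sympI)
  show "transp (\<lambda>x y. x - y \<in> int_lattice)"
    by (rule transpI) (drule (1) int_lattice_add, simp)
qed

lemma proj_eq_iff: "proj x = proj y \<longleftrightarrow> x - y \<in> int_lattice"
  by (rule torus.abs_eq_iff)

lemma surj_proj: "\<exists>x. proj x = p"
  by (metis Quotient3_abs_rep Quotient3_torus)

lemma proj_add_lattice: "n \<in> int_lattice \<Longrightarrow> proj (x + n) = proj x"
  by (simp add: proj_eq_iff)

lemma closed_fibre: "closed (proj -` {p})"
proof -
  obtain x where x: "p = proj x"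
    using surj_proj by metis
  have "proj -` {p} = (\<Inter>i. (\<lambda>y. (y - x) $ i) -` \<int>)"
    by (auto simp: x proj_eq_iff int_lattice_def)
  also have "closed \<dots>"
    by (intro closed_INT ballI closed_vimage continuous_intros) auto
  finally show ?thesis .
qed

text \<open>The quotient metric, i.e. the distance of the flat Riemannian metric.\<close>

instantiation torus :: metric_space
begin

definition dist_torus :: "torus \<Rightarrow> torus \<Rightarrow> real" where
  "dist_torus p q = setdist (proj -` {p}) (proj -` {q})"

definition uniformity_torus :: "(torus \<times> torus) filter" where
  "uniformity_torus = (INF e\<in>{0 <..}. principal {(x, y). dist x y < e})"

definition open_torus :: "torus set \<Rightarrow> bool" where
  "open_torus U \<longleftrightarrow> (\<forall>x\<in>U. eventually (\<lambda>(x', y). x' = x \<longrightarrow> y \<in> U) uniformity)"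

lemma dist_proj_le: "dist (proj x) (proj y) \<le> dist x y"
  unfolding dist_torus_def by (rule setdist_le_dist) auto

lemma dist_proj_attained:
  obtains y where "proj y = q" "dist (proj x) q = dist x y"
proof -
  have ne: "proj -` {q} \<noteq> {}"
    using surj_proj by auto
  obtain y where y: "y \<in> proj -` {q}" "dist x y = setdist {x} (proj -` {q})"
    using setdist_compact_closed[of "{x}" "proj -` {q}"] closed_fibre ne by auto
  have "setdist {x} (proj -` {q}) \<le> setdist (proj -` {proj x}) (proj -` {q})"
  proof (rule le_setdistI)
    fix a b assume a: "a \<in> proj -` {proj x}" and b: "b \<in> proj -` {q}"
    have "b + (x - a) \<in> proj -` {q}"
      using a b by (metis proj_add_lattice proj_eq_iff vimage_singleton_eq)
    then have "setdist {x} (proj -` {q}) \<le> dist x (b + (x - a))"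
      by (intro setdist_le_dist) auto
    also have "\<dots> = dist a b"
      by (simp add: dist_norm algebra_simps)
    finally show "setdist {x} (proj -` {q}) \<le> dist a b" .
  qed (use ne in auto)
  moreover have "setdist (proj -` {proj x}) (proj -` {q}) \<le> dist x y"
    using y by (intro setdist_le_dist) auto
  ultimately have "dist (proj x) q = dist x y"
    using y unfolding dist_torus_def by simp
  with y that show ?thesis by auto
qed

instance
proof
  fix p q r :: torus
  show "dist p q = 0 \<longleftrightarrow> p = q"
  proof
    assume d: "dist p q = 0"
    obtain x where x: "p = proj x"
      using surj_proj by metis
    obtain y where "proj y = q" "dist (proj x) q = dist x y"
      by (rule dist_proj_attained)
    with d x show "p = q" by simp
  next
    assume "p = q"
    then show "dist p q = 0"
      by (simp add: dist_torus_def setdist_refl)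
  qed
  show "dist p q \<le> dist p r + dist q r"
  proof -
    obtain z where z: "r = proj z"
      using surj_proj by metis
    obtain x where x: "proj x = p" "dist (proj z) p = dist z x"
      by (rule dist_proj_attained)
    obtain y where y: "proj y = q" "dist (proj z) q = dist z y"
      by (rule dist_proj_attained)
    have sym: "dist a b = dist b a" for a b :: torus
      by (simp add: dist_torus_def setdist_sym)
    have "dist p q \<le> dist x y"
      using dist_proj_le x y by metis
    also have "\<dots> \<le> dist x z + dist y z"
      by (rule dist_triangle2)
    finally show ?thesis
      using x y z sym by (metis dist_commute)
  qed
qed (simp_all add: uniformity_torus_def open_torus_def)

end

lemma continuous_on_proj: "continuous_on S proj"
  unfolding continuous_on_iff using dist_proj_le le_less_trans by blast

text \<open>The metric topology is the quotient topology.\<close>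

lemma open_torus_iff: "open U \<longleftrightarrow> open (proj -` U)"
proof
  assume "open U"
  then show "open (proj -` U)"
    by (rule open_vimage) (rule continuous_on_proj)
next
  assume o: "open (proj -` U)"
  show "open U"
    unfolding open_dist
  proof
    fix p assume p: "p \<in> U"
    obtain x where x: "p = proj x"
      using surj_proj by metis
    with p o obtain e where e: "e > 0" "\<And>y. dist y x < e \<Longrightarrow> proj y \<in> U"
      unfolding open_dist by auto
    have "q \<in> U" if "dist q p < e" for q
    proof -
      obtain y where "proj y = q" "dist (proj x) q = dist x y"
        by (rule dist_proj_attained)
      with that e x show ?thesis
        by (metis dist_commute)
    qed
    with e show "\<exists>e>0. \<forall>y. dist y p < e \<longrightarrow> y \<in> U"
      by blast
  qed
qed

instance torus :: second_countable_topology
proof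
  obtain B :: "(real^2) set set" where B: "countable B" "topological_basis B"
    using ex_countable_basis by blast
  have img: "open (proj ` V)" if "open V" for V
  proof -
    have "proj -` (proj ` V) = (\<Union>n\<in>int_lattice. (\<lambda>x. x + n) -` V)"
    proof (intro set_eqI iffI)
      fix x assume "x \<in> proj -` (proj ` V)"
      then obtain y where "y \<in> V" "proj y = proj x" by auto
      then show "x \<in> (\<Union>n\<in>int_lattice. (\<lambda>x. x + n) -` V)"
        by (intro UN_I[of "y - x"]) (simp_all add: proj_eq_iff)
    next
      fix x assume "x \<in> (\<Union>n\<in>int_lattice. (\<lambda>x. x + n) -` V)"
      then obtain n where "n \<in> int_lattice" "x + n \<in> V" by blast
      then show "x \<in> proj -` (proj ` V)"
        using proj_add_lattice[of n x] by (simp add: image_iff) metis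
    qed
    moreover have "open \<dots>"
      by (intro open_UN ballI open_vimage that continuous_intros)
    ultimately show ?thesis
      by (simp add: open_torus_iff)
  qed
  have "topological_basis ((`) proj ` B)"
  proof (rule topological_basisI)
    fix S assume "S \<in> (`) proj ` B"
    then show "open S"
      using img topological_basis_open[OF B(2)] by blast
  next
    fix S and p :: torus assume S: "open S" "p \<in> S"
    obtain x where x: "p = proj x"
      using surj_proj by metis
    obtain V where "V \<in> B" "x \<in> V" "V \<subseteq> proj -` S"
      using topological_basisE[OF B(2), of "proj -` S" x] S x by (auto simp: open_torus_iff)
    then show "\<exists>B'\<in>(`) proj ` B. p \<in> B' \<and> B' \<subseteq> S"
      using x by (intro bexI[of _ "proj ` V"]) auto
  qed
  then show "\<exists>B::torus set set. countable B \<and> open = generate_topology B"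
    using B(1) topological_basis_imp_subbasis by blast
qed

lemma proj_measurable [measurable]: "proj \<in> borel_measurable borel"
  by (intro borel_measurable_continuous_onI continuous_on_proj)

definition torus_lebesgue :: "torus measure" where
  "torus_lebesgue = distr (restrict_space lborel {x. \<forall>i. 0 \<le> x $ i \<and> x $ i < 1}) borel proj"

lemma prob_space_torus_lebesgue: "prob_space torus_lebesgue"
proof -
  define Q where "Q = {x::real^2. \<forall>i. 0 \<le> x $ i \<and> x $ i < 1}"
  have "Q = (\<Inter>i. {x. 0 \<le> x $ i} \<inter> {x. x $ i < 1})"
    by (auto simp: Q_def)
  also have "\<dots> \<in> sets borel"
    by (intro sets.countable_INT' sets.Int borel_closed borel_open closed_Collect_le open_Collect_less
          continuous_intros) auto
  finally have Q: "Q \<in> sets lborel" by simp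
  have "box 0 1 \<subseteq> Q" "Q \<subseteq> cbox 0 1"
    by (auto simp: Q_def mem_box_cart less_imp_le)
  then have "emeasure lborel (box 0 (1::real^2)) \<le> emeasure lborel Q"
      "emeasure lborel Q \<le> emeasure lborel (cbox 0 (1::real^2))"
    using Q by (auto intro!: emeasure_mono)
  moreover have "\<forall>b\<in>Basis. (1::real^2) \<bullet> b = 1"
    by (auto simp: Basis_vec_def inner_axis)
  ultimately have "emeasure lborel Q = 1"
    by (simp add: emeasure_lborel_box_eq emeasure_lborel_cbox_eq)
  then have "prob_space (restrict_space lborel Q)"
    using Q by (intro prob_spaceI) (simp add: space_restrict_space emeasure_restrict_space)
  then show ?thesis
    unfolding torus_lebesgue_def Q_def[symmetric]
    by (rule prob_space.prob_space_distr) (simp add: measurable_restrict_space1)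
qed



section \<open>Differentiability on the torus\<close>

text \<open>
  Local inverses of \<^const>\<open>proj\<close> are the charts of the torus; they identify every tangent
  space with \<^typ>\<open>real^2\<close>. The derivative at a point is that of any local lift there.
\<close>

definition has_torus_derivative :: "(torus \<Rightarrow> torus) \<Rightarrow> ((real^2) \<Rightarrow>\<^sub>L (real^2)) \<Rightarrow> torus \<Rightarrow> bool" where
  "has_torus_derivative F D p \<longleftrightarrow>
     (\<exists>f x. proj x = p \<and> (\<forall>\<^sub>F y in nhds x. proj (f y) = F (proj y)) \<and>
            (f has_derivative blinfun_apply D) (at x))"

lemma has_torus_derivative_unique:
  assumes "has_torus_derivative F D p" "has_torus_derivative F E p"
  shows "D = E"
proof -
  obtain f x where f: "proj x = p" "\<forall>\<^sub>F y in nhds x. proj (f y) = F (proj y)"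
      "(f has_derivative blinfun_apply D) (at x)"
    using assms(1) unfolding has_torus_derivative_def by blast
  obtain g z where g: "proj z = p" "\<forall>\<^sub>F y in nhds z. proj (g y) = F (proj y)"
      "(g has_derivative blinfun_apply E) (at z)"
    using assms(2) unfolding has_torus_derivative_def by blast
  define n where "n = z - x"
  have n: "n \<in> int_lattice"
    using f g by (simp add: n_def flip: proj_eq_iff)
  have lim: "filterlim (\<lambda>y. y + n) (nhds z) (nhds x)"
  proof -
    have "((\<lambda>y. y + n) \<longlongrightarrow> x + n) (nhds x)"
      by (intro tendsto_intros filterlim_ident)
    then show ?thesis by (simp add: n_def)
  qed
  have g': "\<forall>\<^sub>F y in nhds x. proj (g (y + n)) = F (proj (y + n))"
    using lim g(2) unfolding filterlim_iff by blast
  have ev: "\<forall>\<^sub>F y in nhds x. g (y + n) - f y \<in> int_lattice"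
    using f(2) g' by eventually_elim (simp add: proj_add_lattice[OF n] flip: proj_eq_iff)
  have dg: "((\<lambda>y. g (y + n)) has_derivative blinfun_apply E) (at x)"
  proof -
    have "((\<lambda>y. y + n) has_derivative (\<lambda>h. h)) (at x)"
      by (auto intro!: derivative_eq_intros)
    moreover have "(g has_derivative blinfun_apply E) (at (x + n))"
      using g(3) by (simp add: n_def)
    ultimately show ?thesis
      by (rule has_derivative_compose)
  qed
  define h where "h = (\<lambda>y. g (y + n) - f y)"
  have dh: "(h has_derivative (\<lambda>v. E v - D v)) (at x)"
    unfolding h_def by (intro has_derivative_diff dg f(3))
  then have "isCont h x"
    by (rule has_derivative_continuous)
  then have "(h \<longlongrightarrow> h x) (nhds x)"
    by (simp add: isCont_def tendsto_at_iff_tendsto_nhds)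
  then have near: "\<forall>\<^sub>F y in nhds x. dist (h y) (h x) < 1"
    by (rule tendstoD) simp
  have hx: "h x \<in> int_lattice"
    using ev eventually_nhds_x_imp_x unfolding h_def by blast
  from near ev have "\<forall>\<^sub>F y in nhds x. h y = h x"
  proof eventually_elim
    case (elim y)
    have hl: "h y - h x \<in> int_lattice"
      using elim(2) hx by (intro int_lattice_diff) (simp_all add: h_def)
    have "(h y - h x) $ i = 0" for i
    proof -
      have "\<bar>(h y - h x) $ i\<bar> < 1"
        using elim(1) component_le_norm_cart[of "h y - h x" i] by (simp add: dist_norm)
      moreover have "(h y - h x) $ i \<in> \<int>"
        using hl unfolding int_lattice_def by blast
      ultimately show ?thesis
        using Ints_nonzero_abs_less1 by blast
    qed
    then show ?case
      by (simp add: vec_eq_iff)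
  qed
  then have "(h has_derivative (\<lambda>v. 0)) (at x)"
    by (intro has_derivative_transform_eventually[OF has_derivative_const])
       (auto simp: eventually_at_filter elim!: eventually_mono)
  then have "(\<lambda>v. E v - D v) = (\<lambda>v. 0)"
    by (rule has_derivative_unique[OF dh])
  then show ?thesis
    by (intro blinfun_eqI) (simp add: fun_eq_iff)
qed

definition torus_deriv :: "(torus \<Rightarrow> torus) \<Rightarrow> torus \<Rightarrow> ((real^2) \<Rightarrow>\<^sub>L (real^2))" where
  "torus_deriv F p = (THE D. has_torus_derivative F D p)"

definition C1_map :: "(torus \<Rightarrow> torus) \<Rightarrow> bool" where
  "C1_map F \<longleftrightarrow> (\<forall>p. \<exists>D. has_torus_derivative F D p) \<and> continuous_on UNIV (torus_deriv F)"

definition C1_diffeo :: "(torus \<Rightarrow> torus) \<Rightarrow> bool" where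
  "C1_diffeo F \<longleftrightarrow> bij F \<and> C1_map F \<and> C1_map (inv F)"

definition C1_close :: "real \<Rightarrow> (torus \<Rightarrow> torus) \<Rightarrow> (torus \<Rightarrow> torus) \<Rightarrow> bool" where
  "C1_close \<epsilon> F G \<longleftrightarrow>
     (\<forall>p. dist (F p) (G p) < \<epsilon> \<and> norm (torus_deriv F p - torus_deriv G p) < \<epsilon>)"


section \<open>Hyperbolicity and horseshoes\<close>

text \<open>
  \<^term>\<open>Es\<close> and \<^term>\<open>Eu\<close> are the stable and unstable subbundles over \<open>K\<close>, with norms taken in the
  flat metric. Their continuity is a consequence of the estimates.
\<close>

definition hyperbolic_set :: "(torus \<Rightarrow> torus) \<Rightarrow> torus set \<Rightarrow> bool" where
  "hyperbolic_set F K \<longleftrightarrow> compact K \<and> F ` K = K \<and>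
     (\<exists>(Es :: torus \<Rightarrow> (real^2) set) (Eu :: torus \<Rightarrow> (real^2) set) C \<theta>.
        C > 0 \<and> 0 < \<theta> \<and> \<theta> < 1 \<and>
        (\<forall>p\<in>K. subspace (Es p) \<and> subspace (Eu p) \<and>
           Es p \<inter> Eu p = {0} \<and> {u + v | u v. u \<in> Es p \<and> v \<in> Eu p} = UNIV \<and>
           torus_deriv F p ` Es p = Es (F p) \<and> torus_deriv F p ` Eu p = Eu (F p) \<and>
           (\<forall>v\<in>Es p. \<forall>n. norm (torus_deriv (F ^^ n) p v) \<le> C * \<theta> ^ n * norm v) \<and>
           (\<forall>v\<in>Eu p. \<forall>n. norm (torus_deriv (inv F ^^ n) p v) \<le> C * \<theta> ^ n * norm v)))"

definition anosov :: "(torus \<Rightarrow> torus) \<Rightarrow> bool" where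
  "anosov F \<longleftrightarrow> C1_diffeo F \<and> hyperbolic_set F UNIV"

definition locally_maximal :: "(torus \<Rightarrow> torus) \<Rightarrow> torus set \<Rightarrow> bool" where
  "locally_maximal F K \<longleftrightarrow>
     (\<exists>U. open U \<and> K \<subseteq> U \<and> K = (\<Inter>n. (F ^^ n) ` U \<inter> (inv F ^^ n) ` U))"

definition cantor_set :: "'a::metric_space set \<Rightarrow> bool" where
  "cantor_set K \<longleftrightarrow> K \<noteq> {} \<and> compact K \<and> (\<forall>x\<in>K. x islimpt K) \<and>
     (\<forall>C. C \<subseteq> K \<longrightarrow> connected C \<longrightarrow> (\<exists>x. C \<subseteq> {x}))"

text \<open>Sequences carry the product topology of the discrete topology on the symbols.\<close>

definition full_shift :: "nat \<Rightarrow> (int \<Rightarrow> nat) set" where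
  "full_shift m = {s. \<forall>i. s i < m}"

definition shift :: "(int \<Rightarrow> nat) \<Rightarrow> (int \<Rightarrow> nat)" where
  "shift s = (\<lambda>i. s (i + 1))"

definition horseshoe :: "(torus \<Rightarrow> torus) \<Rightarrow> torus set \<Rightarrow> bool" where
  "horseshoe F K \<longleftrightarrow> hyperbolic_set F K \<and> locally_maximal F K \<and> cantor_set K \<and>
     (\<exists>m h k. homeomorphism K (full_shift m) h k \<and> (\<forall>x\<in>K. h (F x) = shift (h x)))"


section \<open>Physical measures and attractors\<close>

text \<open>Weak-* convergence of the empirical measures (averages of Dirac masses), tested against continuous functions.\<close>

definition basin :: "(torus \<Rightarrow> torus) \<Rightarrow> torus measure \<Rightarrow> torus set" where
  "basin F \<nu> = {x. \<forall>\<phi> :: torus \<Rightarrow> real. continuous_on UNIV \<phi> \<longrightarrow>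
     (\<lambda>n. (1 / real n) * (\<Sum>k<n. \<phi> ((F ^^ k) x))) \<longlonglongrightarrow> (\<integral>y. \<phi> y \<partial>\<nu>)}"

definition invariant_prob :: "(torus \<Rightarrow> torus) \<Rightarrow> torus measure \<Rightarrow> bool" where
  "invariant_prob F \<nu> \<longleftrightarrow> prob_space \<nu> \<and> sets \<nu> = sets borel \<and> distr \<nu> borel F = \<nu>"

definition physical_measure :: "(torus \<Rightarrow> torus) \<Rightarrow> torus measure \<Rightarrow> bool" where
  "physical_measure F \<nu> \<longleftrightarrow> invariant_prob F \<nu> \<and> emeasure torus_lebesgue (basin F \<nu>) > 0"

definition omega_limit :: "(torus \<Rightarrow> torus) \<Rightarrow> torus \<Rightarrow> torus set" where
  "omega_limit F x = {y. \<exists>r. strict_mono r \<and> (\<lambda>k. (F ^^ r k) x) \<longlonglongrightarrow> y}"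

definition attracts_ae :: "(torus \<Rightarrow> torus) \<Rightarrow> torus set \<Rightarrow> bool" where
  "attracts_ae F A \<longleftrightarrow> closed A \<and> (AE x in torus_lebesgue. omega_limit F x \<subseteq> A)"

definition is_milnor_attractor :: "(torus \<Rightarrow> torus) \<Rightarrow> torus set \<Rightarrow> bool" where
  "is_milnor_attractor F A \<longleftrightarrow> attracts_ae F A \<and> (\<forall>B. attracts_ae F B \<and> B \<subseteq> A \<longrightarrow> B = A)"

definition milnor_attractor :: "(torus \<Rightarrow> torus) \<Rightarrow> torus set" where
  "milnor_attractor F = (THE A. is_milnor_attractor F A)"

lemma milnor_attractor_exists: "\<exists>!A. is_milnor_attractor F A"
proof -
  define M where "M = \<Inter>(Collect (attracts_ae F))"
  obtain \<U> where \<U>: "\<U> \<subseteq> uminus ` Collect (attracts_ae F)" "countable \<U>"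
      "\<Union>\<U> = \<Union>(uminus ` Collect (attracts_ae F))"
  proof (rule Lindelof[of "uminus ` Collect (attracts_ae F)"])
    show "open S" if "S \<in> uminus ` Collect (attracts_ae F)" for S
      using that by (auto simp: attracts_ae_def)
  qed
  have "AE x in torus_lebesgue. \<forall>U\<in>\<U>. omega_limit F x \<subseteq> - U"
    using \<U> by (subst AE_ball_countable) (auto simp: attracts_ae_def)
  then have "AE x in torus_lebesgue. omega_limit F x \<subseteq> M"
  proof (rule eventually_mono)
    fix x assume "\<forall>U\<in>\<U>. omega_limit F x \<subseteq> - U"
    then have "omega_limit F x \<subseteq> - \<Union>\<U>" by auto
    also have "- \<Union>\<U> = M"
      unfolding \<U>(3) M_def by auto
    finally show "omega_limit F x \<subseteq> M" .
  qed
  then have M: "attracts_ae F M"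
    by (auto simp: attracts_ae_def M_def)
  have le: "M \<subseteq> B" if "attracts_ae F B" for B
    using that by (auto simp: M_def)
  show ?thesis
    using M le unfolding is_milnor_attractor_def by (intro ex1I[of _ M]) blast+
qed

definition milnor_topologically_invariant :: "(torus \<Rightarrow> torus) \<Rightarrow> bool" where
  "milnor_topologically_invariant F \<longleftrightarrow>
     (\<forall>G H H'. C1_diffeo G \<and> homeomorphism UNIV UNIV H H' \<and> G = H \<circ> F \<circ> H' \<longrightarrow>
        milnor_attractor G = H ` milnor_attractor F)"

end

theory Submission
  imports Defs
begin

text \<open>
  By structural stability, \<open>F\<close> is conjugate to every \<open>G\<close> that is \<open>C\<^sup>1\<close>-close to it, and also to a
  \<open>C\<^sup>1\<close>-close diffeomorphism \<open>G\<^sub>2\<close> with Lipschitz derivative. If the Milnor attractor of \<open>G\<close> were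
  topologically invariant, the conjugacy \<open>H\<^sub>2\<close> from \<open>F\<close> to \<open>G\<^sub>2\<close> would send the attractor \<open>K\<close> of \<open>F\<close> onto
  that of \<open>G\<^sub>2\<close>. But for \<open>G\<^sub>2\<close> bounded distortion is available, and a totally disconnected compact set
  such as \<open>H\<^sub>2 ` K\<close> attracts only a null set of points: on a short segment in the unstable cone
  take the points whose orbit stays in a small neighbourhood of \<open>H\<^sub>2 ` K\<close>. If they had positive
  measure, they would nearly fill a piece of the segment that a high iterate stretches, with
  bounded distortion, to a curve of definite size. This curve would be a connected subset of a
  small neighbourhood of a totally disconnected set, which is absurd. Fubini's theorem finishes
  the argument.
\<close>

section \<open>Topology of the torus and lifts of its maps\<close>

text \<open>The detour through a second map is forced by regularity. For maps that are only C^1,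
  such as F and G, distortion need not be bounded, and F itself shows that a horseshoe can then
  attract almost every point. So thinness is proved for \<open>G\<^sub>2\<close>, while G takes part
  only through its conjugacies with F and with \<open>G\<^sub>2\<close>; its admissible radius is
  the radius of structural stability.

  Distortion is controlled without an unstable foliation for \<open>G\<^sub>2\<close>. The cone
  field is read off from the splitting of F, the curves start as straight segments, and angles and
  length ratios of two tangent vectors are carried along by induction: errors double at each step,
  exactly like the allowed distance between base points, so the usual geometric series is hidden in
  the induction hypothesis.

  The conjugacy is the identity plus a small displacement, found as a fixed point. The linear
  equation behind it is solved over an arbitrary base, so that the same solver, run over the
  integers along a single orbit, also yields injectivity.\<close>

lemma continuous_on_torus_iff:
  fixes \<phi> :: "torus \<Rightarrow> 'a::topological_space"
  shows "continuous_on UNIV \<phi> \<longleftrightarrow> continuous_on UNIV (\<lambda>x. \<phi> (proj x))"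
proof
  assume "continuous_on UNIV \<phi>"
  then show "continuous_on UNIV (\<lambda>x. \<phi> (proj x))"
    by (intro continuous_on_compose2[OF _ continuous_on_proj]) auto
next
  assume c: "continuous_on UNIV (\<lambda>x. \<phi> (proj x))"
  show "continuous_on UNIV \<phi>"
    unfolding continuous_on_open_vimage[OF open_UNIV]
  proof (intro allI impI)
    fix U :: "'a set" assume "open U"
    then have "open ((\<lambda>x. \<phi> (proj x)) -` U)"
      using c by (simp add: continuous_on_open_vimage)
    then show "open (\<phi> -` U \<inter> UNIV)"
      by (simp add: open_torus_iff vimage_def)
  qed
qed

lemma proj_rep_torus [simp]: "proj (rep_torus p) = p"
  by (rule Quotient3_abs_rep[OF Quotient3_torus])

lemma torus_cases: obtains x where "p = proj x"
  using surj_proj by metis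

lemma range_proj: "range proj = UNIV"
  using surj_proj by (metis surj_def)

text \<open>Discreteness of the lattice; it turns closeness of two lifts into equality.\<close>

lemma lattice_small_eq_0:
  assumes "n \<in> int_lattice" "norm n < 1"
  shows "n = 0"
proof -
  have "n $ i = 0" for i
  proof -
    have "\<bar>n $ i\<bar> < 1"
      using assms(2) component_le_norm_cart[of n i] by simp
    then show ?thesis
      using assms(1) Ints_nonzero_abs_less1 unfolding int_lattice_def by blast
  qed
  then show ?thesis by (simp add: vec_eq_iff)
qed

lemma connected_torus: "connected (UNIV :: torus set)"
  using connected_continuous_image[OF continuous_on_proj[of UNIV] connected_UNIV] range_proj by simp

lemma unit_square_representative:
  obtains y where "y \<in> cbox 0 (1::real^2)" "\<forall>i. y $ i < 1" "proj y = proj x"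
proof -
  define y :: "real^2" where "y = (\<chi> i. frac (x $ i))"
  have "y \<in> cbox 0 1" "\<forall>i. y $ i < 1"
    by (auto simp: y_def mem_box_cart frac_lt_1 less_imp_le)
  moreover have "proj y = proj x"
    by (auto simp: y_def proj_eq_iff int_lattice_def frac_def)
  ultimately show ?thesis using that by blast
qed

lemma compact_torus: "compact (UNIV :: torus set)"
proof -
  have "proj ` cbox 0 1 = UNIV"
    using unit_square_representative torus_cases by (metis UNIV_eq_I image_eqI)
  moreover have "compact (proj ` cbox 0 1)"
    by (intro compact_continuous_image continuous_on_proj compact_cbox)
  ultimately show ?thesis by simp
qed

lemma torus_continuous_bounded:
  fixes \<phi> :: "torus \<Rightarrow> 'a::real_normed_vector"
  assumes "continuous_on UNIV \<phi>"
  obtains B where "B > 0" "\<And>p. norm (\<phi> p) \<le> B"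
  using compact_imp_bounded[OF compact_continuous_image[OF assms compact_torus]]
  unfolding bounded_pos by auto

lemma torus_continuous_uniform:
  fixes \<phi> :: "torus \<Rightarrow> 'a::metric_space"
  assumes "continuous_on UNIV \<phi>" "e > 0"
  obtains d where "d > 0" "\<And>p q. dist p q < d \<Longrightarrow> dist (\<phi> p) (\<phi> q) < e"
  using compact_uniformly_continuous[OF assms(1) compact_torus] assms(2)
  unfolding uniformly_continuous_on_def by (metis UNIV_I dist_commute)

text \<open>The plane is connected and the lattice discrete. This is the uniqueness half of lifting
  theory: two lifts of one map differ by a constant lattice vector.\<close>

lemma continuous_lattice_valued_constant:
  fixes h :: "real^2 \<Rightarrow> real^2"
  assumes "continuous_on UNIV h" "\<And>x. h x \<in> int_lattice"
  obtains c where "c \<in> int_lattice" "\<And>x. h x = c"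
proof -
  have "(\<lambda>x. h x $ i) constant_on UNIV" for i
  proof (rule continuous_discrete_range_constant)
    show "continuous_on UNIV (\<lambda>x. h x $ i)"
      by (intro continuous_intros assms)
    fix x
    have "1 \<le> norm (h y $ i - h x $ i)" if "h y $ i \<noteq> h x $ i" for y
    proof (rule ccontr)
      assume "\<not> ?thesis"
      moreover have "h y $ i - h x $ i \<in> \<int>"
        using assms(2) by (auto simp: int_lattice_def)
      ultimately show False
        using that Ints_nonzero_abs_less1 by fastforce
    qed
    then show "\<exists>e>0. \<forall>y. y \<in> UNIV \<and> h y $ i \<noteq> h x $ i \<longrightarrow> e \<le> norm (h y $ i - h x $ i)"
      by (intro exI[of _ 1]) auto
  qed auto
  then have "h x $ i = h 0 $ i" for x i
    unfolding constant_on_def by (metis UNIV_I)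
  then have "h x = h 0" for x
    by (simp add: vec_eq_iff)
  then show ?thesis
    using that assms(2) by blast
qed

section \<open>Global lifts of torus maps to the plane\<close>

definition torus_lift :: "(torus \<Rightarrow> torus) \<Rightarrow> ((real^2) \<Rightarrow> (real^2)) \<Rightarrow> bool" where
  "torus_lift F f \<longleftrightarrow> continuous_on UNIV f \<and> (\<forall>x. proj (f x) = F (proj x))"

lemma torus_lift_continuous: "torus_lift F f \<Longrightarrow> continuous_on UNIV f"
  and torus_lift_proj: "torus_lift F f \<Longrightarrow> proj (f x) = F (proj x)"
  by (simp_all add: torus_lift_def)

lemma exp_lattice_eq:
  assumes "exp (2 * pi * \<i> * of_real a) = exp (2 * pi * \<i> * of_real b)"
  shows "a - b \<in> \<int>"
proof -
  have "\<exists>n::int. 2 * pi * \<i> * of_real a = 2 * pi * \<i> * of_real b + (of_int (2 * n) * pi) * \<i>"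
    using assms exp_eq by blast
  then obtain n :: int where "2 * pi * \<i> * of_real a = 2 * pi * \<i> * of_real b + (of_int (2 * n) * pi) * \<i>"
    by blast
  then have "Im (2 * pi * \<i> * of_real a) = Im (2 * pi * \<i> * of_real b + (of_int (2 * n) * pi) * \<i>)"
    by (rule arg_cong)
  then have "pi * (a - b) = pi * of_int n"
    by (simp add: algebra_simps)
  then have "a - b = of_int n" by simp
  then show ?thesis by simp
qed

text \<open>The two coordinate characters of the torus, composed with F and \<open>proj\<close>, are
  continuous nowhere vanishing functions on the contractible plane. They have continuous logarithms,
  whose imaginary parts divided by 2 pi are the coordinates of a lift.\<close>

lemma torus_lift_exists:
  assumes "continuous_on UNIV F"
  obtains f where "torus_lift F f"
proof -
  \<comment> \<open>The i-th character of the torus; the chosen representative does not matter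
    because exp has period 2 pi i.\<close>
  define \<chi>c where "\<chi>c = (\<lambda>i p. exp (2 * pi * \<i> * of_real (rep_torus p $ i)))"
  have chi: "\<chi>c i (proj x) = exp (2 * pi * \<i> * of_real (x $ i))" for i x
  proof -
    have "proj (rep_torus (proj x)) = proj x" by simp
    then have "rep_torus (proj x) $ i - x $ i \<in> \<int>"
      unfolding proj_eq_iff int_lattice_def by simp
    then obtain n where "rep_torus (proj x) $ i - x $ i = of_int n"
      by (auto elim: Ints_cases)
    then have n: "rep_torus (proj x) $ i = x $ i + of_int n" by simp
    have "exp (2 * pi * \<i> * of_real (x $ i + of_int n)) =
        exp (2 * pi * \<i> * of_real (x $ i)) * exp ((2 * of_int n * pi) * \<i>)"
      unfolding exp_add[symmetric] by (simp add: algebra_simps)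
    also have "exp ((2 * of_int n * pi) * \<i>) = 1"
      by (rule exp_integer_2pi) simp
    finally show ?thesis
      unfolding \<chi>c_def n by simp
  qed
  have "continuous_on UNIV (\<chi>c i)" for i
    unfolding continuous_on_torus_iff chi by (intro continuous_intros)
  then have c: "continuous_on UNIV (\<lambda>x. \<chi>c i (F (proj x)))" for i
    by (intro continuous_on_compose2[OF _ continuous_on_compose2[OF assms continuous_on_proj]]) auto
  have "\<exists>g. continuous_on UNIV g \<and> (\<forall>x. \<chi>c i (F (proj x)) = exp (g x))" for i
    using continuous_logarithm_on_contractible[OF c[of i] convex_imp_contractible[OF convex_UNIV]]
    by (metis UNIV_I \<chi>c_def exp_not_eq_zero)
  then obtain g where g: "\<And>i. continuous_on UNIV (g i)" "\<And>i x. \<chi>c i (F (proj x)) = exp (g i x)"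
    by metis
  define f :: "real^2 \<Rightarrow> real^2" where "f x = (\<chi> i. Im (g i x) / (2 * pi))" for x
  have "proj (f x) = F (proj x)" for x
  proof -
    obtain y where y: "F (proj x) = proj y" by (rule torus_cases)
    have "f x $ i - y $ i \<in> \<int>" for i
    proof (rule exp_lattice_eq)
      have e: "exp (g i x) = exp (2 * pi * \<i> * of_real (y $ i))"
        using g(2)[of i x] chi y by simp
      then have "norm (exp (g i x)) = norm (exp (2 * pi * \<i> * of_real (y $ i)))"
        by simp
      \<comment> \<open>Characters take values on the unit circle, so the logarithm is purely
        imaginary.\<close>
      then have "Re (g i x) = 0"
        by (simp add: norm_exp_eq_Re)
      then have "g i x = 2 * pi * \<i> * of_real (f x $ i)"
        by (simp add: f_def complex_eq_iff)
      with e show "exp (2 * pi * \<i> * of_real (f x $ i)) = exp (2 * pi * \<i> * of_real (y $ i))"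
        by simp
    qed
    then show ?thesis
      by (simp add: y proj_eq_iff int_lattice_def)
  qed
  moreover have "continuous_on UNIV f"
    unfolding f_def by (intro continuous_intros g)  auto
  ultimately show ?thesis
    using that by (auto simp: torus_lift_def)
qed

lemma torus_lift_compose:
  assumes "torus_lift F f" "torus_lift G g"
  shows "torus_lift (G \<circ> F) (g \<circ> f)"
  using assms continuous_on_compose[of UNIV f g]
  by (auto simp: torus_lift_def intro: continuous_on_subset)

lemma torus_lift_funpow: "torus_lift F f \<Longrightarrow> torus_lift (F ^^ n) (f ^^ n)"
proof (induction n)
  case 0
  then show ?case by (simp add: torus_lift_def)
next
  case (Suc n)
  then show ?case using torus_lift_compose[of "F ^^ n" "f ^^ n" F f] by (simp add: o_def)
qed

lemma torus_lift_translate: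
  assumes "torus_lift F f" "n \<in> int_lattice"
  obtains m where "m \<in> int_lattice" "\<And>x. f (x + n) = f x + m"
proof -
  have "continuous_on UNIV (\<lambda>x. f (x + n) - f x)"
    using torus_lift_continuous[OF assms(1)]
    by (intro continuous_intros continuous_on_compose2[of UNIV f UNIV "\<lambda>x. x + n"]) auto
  moreover have "f (x + n) - f x \<in> int_lattice" for x
    using assms torus_lift_proj[OF assms(1)] proj_add_lattice by (metis proj_eq_iff)
  ultimately obtain c where "c \<in> int_lattice" "\<And>x. f (x + n) - f x = c"
    using continuous_lattice_valued_constant[of "\<lambda>x. f (x + n) - f x"] by blast
  then show ?thesis
    using that by (metis add.commute diff_add_cancel)
qed

lemma torus_lift_add_lattice:
  assumes "torus_lift F f" "c \<in> int_lattice"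
  shows "torus_lift F (\<lambda>x. f x + c)"
  using assms by (auto simp: torus_lift_def proj_add_lattice intro!: continuous_intros)

text \<open>A lift of the inverse inverts f up to a constant lattice vector; subtracting that
  constant gives a left inverse, which is then also a right inverse.\<close>

lemma torus_lift_inverse:
  assumes "bij F" "torus_lift F f" "continuous_on UNIV (inv F)"
  obtains f' where "torus_lift (inv F) f'" "\<And>x. f' (f x) = x" "\<And>x. f (f' x) = x"
proof -
  obtain g where g: "torus_lift (inv F) g"
    using torus_lift_exists[OF assms(3)] .
  have inv: "inv F (F p) = p" "F (inv F p) = p" for p
    using assms(1) by (auto simp: bij_is_inj bij_is_surj surj_f_inv_f)
  have comp: "continuous_on UNIV (\<lambda>x. h (k x) - x)" if "continuous_on UNIV h" "continuous_on UNIV k"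
    for h k :: "real^2 \<Rightarrow> real^2"
    using continuous_on_compose2[OF that] by (intro continuous_intros) auto
  have "g (f x) - x \<in> int_lattice" for x
    using torus_lift_proj[OF g] torus_lift_proj[OF assms(2)] inv by (simp flip: proj_eq_iff)
  then obtain c where c: "c \<in> int_lattice" "\<And>x. g (f x) - x = c"
    using continuous_lattice_valued_constant[OF comp[OF torus_lift_continuous[OF g] torus_lift_continuous[OF assms(2)]]]
    by blast
  define f' where "f' = (\<lambda>x. g x + - c)"
  have f': "torus_lift (inv F) f'"
    unfolding f'_def by (rule torus_lift_add_lattice[OF g int_lattice_uminus[OF c(1)]])
  have 1: "f' (f x) = x" for x
    using c(2)[of x] by (simp add: f'_def algebra_simps)
  have "f (f' x) - x \<in> int_lattice" for x
    using torus_lift_proj[OF f'] torus_lift_proj[OF assms(2)] inv by (simp flip: proj_eq_iff)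
  then obtain d where d: "d \<in> int_lattice" "\<And>x. f (f' x) - x = d"
    using continuous_lattice_valued_constant[OF comp[OF torus_lift_continuous[OF assms(2)] torus_lift_continuous[OF f']]]
    by blast
  \<comment> \<open>The constant d can be read off at the point \<open>f 0\<close>, where the left
    inverse property already applies.\<close>
  have "d = 0"
    using d(2)[of "f 0"] by (simp add: 1)
  with d have "f (f' x) = x" for x by simp
  with f' 1 show ?thesis using that by blast
qed

text \<open>Correct an arbitrary lift of G, point by point, by the lattice vector that brings it
  closest to f. The bound 1/2 makes the correction locally constant, hence constant.\<close>

lemma torus_lift_close:
  assumes "torus_lift F f" "continuous_on UNIV G" "\<And>p. dist (F p) (G p) < \<epsilon>" "\<epsilon> \<le> 1/2"
  obtains g where "torus_lift G g" "\<And>x. norm (g x - f x) < \<epsilon>"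
proof -
  obtain g0 where g0: "torus_lift G g0"
    using torus_lift_exists[OF assms(2)] .
  have "\<exists>z. z \<in> int_lattice \<and> norm (g0 x + z - f x) < \<epsilon>" for x
  proof -
    obtain y where y: "proj y = G (proj x)" "dist (proj (f x)) (G (proj x)) = dist (f x) y"
      by (rule dist_proj_attained)
    have "proj y = proj (g0 x)"
      using y torus_lift_proj[OF g0] by simp
    then have "y - g0 x \<in> int_lattice"
      by (simp add: proj_eq_iff)
    moreover have "dist (f x) y < \<epsilon>"
      using y(2) assms(3)[of "proj x"] torus_lift_proj[OF assms(1), of x] by simp
    ultimately show ?thesis
      by (intro exI[of _ "y - g0 x"]) (simp add: dist_norm norm_minus_commute)
  qed
  then obtain z where z: "\<And>x. z x \<in> int_lattice" "\<And>x. norm (g0 x + z x - f x) < \<epsilon>"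
    by metis
  have cont: "continuous_on UNIV (\<lambda>x. g0 x - f x)"
    using g0 assms(1) by (intro continuous_intros) (auto simp: torus_lift_def)
  have "continuous_on UNIV z"
    unfolding continuous_on_iff
  proof (intro ballI allI impI)
    fix x and e :: real assume "e > 0"
    \<comment> \<open>The slack in the strict bound at x: two corrections at nearby points then
      differ by less than 2 \<epsilon>, hence by less than 1.\<close>
    define s where "s = \<epsilon> - norm (g0 x + z x - f x)"
    have "s > 0" using z(2)[of x] by (simp add: s_def)
    then obtain d where d: "d > 0" "\<And>y. dist y x < d \<Longrightarrow> dist (g0 y - f y) (g0 x - f x) < s"
      using cont unfolding continuous_on_iff by (metis UNIV_I)
    have "z y = z x" if "dist y x < d" for y
    proof -
      have "z y - z x = (g0 y + z y - f y) - (g0 x + z x - f x) - ((g0 y - f y) - (g0 x - f x))"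
        by (simp add: algebra_simps)
      also have "norm \<dots> \<le> norm (g0 y + z y - f y) + norm (g0 x + z x - f x) + norm ((g0 y - f y) - (g0 x - f x))"
        by (meson norm_triangle_ineq4 norm_triangle_mono add_mono order_trans order_refl)
      also have "\<dots> < \<epsilon> + (norm (g0 x + z x - f x) + s)"
        using z(2)[of y] d(2)[OF that] by (simp add: dist_norm)
      also have "\<dots> \<le> 1"
        using assms(4) by (simp add: s_def)
      finally have "z y - z x = 0"
        by (intro lattice_small_eq_0 int_lattice_diff z(1))
      then show ?thesis by simp
    qed
    then show "\<exists>d>0. \<forall>x'\<in>UNIV. dist x' x < d \<longrightarrow> dist (z x') (z x) < e"
      using d(1) \<open>e > 0\<close> by (metis dist_self)
  qed
  then obtain c where c: "c \<in> int_lattice" "\<And>x. z x = c"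
    using continuous_lattice_valued_constant z(1) by blast
  show ?thesis
    by (rule that[OF torus_lift_add_lattice[OF g0 c(1)]]) (use z(2) c(2) in simp)
qed

section \<open>Continuously differentiable torus maps and their lifts\<close>

lemma has_torus_derivative_proj:
  assumes "\<And>y. proj (f y) = F (proj y)" "(f has_derivative blinfun_apply D) (at x)"
  shows "has_torus_derivative F D (proj x)"
  unfolding has_torus_derivative_def using assms by (intro exI[of _ f] exI[of _ x]) auto

lemma torus_deriv_eqI: "has_torus_derivative F D p \<Longrightarrow> torus_deriv F p = D"
  unfolding torus_deriv_def using has_torus_derivative_unique by blast

lemma C1_map_has_derivative: "C1_map F \<Longrightarrow> has_torus_derivative F (torus_deriv F p) p"
  unfolding C1_map_def using torus_deriv_eqI by metis

lemma C1_map_continuous: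
  assumes "C1_map F"
  shows "continuous_on UNIV F"
proof -
  have "isCont (\<lambda>y. F (proj y)) x" for x
  proof -
    obtain f z where f: "proj z = proj x" "\<forall>\<^sub>F y in nhds z. proj (f y) = F (proj y)"
        "(f has_derivative blinfun_apply (torus_deriv F (proj x))) (at z)"
      using C1_map_has_derivative[OF assms, of "proj x"] unfolding has_torus_derivative_def by blast
    have "isCont f z"
      using f(3) has_derivative_continuous by blast
    then have "isCont (\<lambda>y. proj (f y)) z"
      using isCont_o2[where f=f and a=z and g=proj] continuous_on_proj[of UNIV] by (simp add: continuous_on_eq_continuous_at)
    then have c: "isCont (\<lambda>y. F (proj y)) z"
      using isCont_cong[OF f(2)] by simp
    \<comment> \<open>The local lift may live at another representative of the same point, so it is
      moved back by a lattice vector.\<close>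
    have l: "z - x \<in> int_lattice" using f(1) by (simp add: proj_eq_iff)
    have "isCont (\<lambda>y. F (proj (y + (z - x)))) x"
      using isCont_o2[where f="\<lambda>y. y + (z - x)" and a=x and g="\<lambda>y. F (proj y)"] c by simp
    then show ?thesis
      by (simp only: proj_add_lattice[OF l])
  qed
  then show ?thesis
    by (simp add: continuous_on_torus_iff continuous_on_eq_continuous_at)
qed

text \<open>The definition of the derivative only offers some local lift. Near x it differs from the
  global lift by a continuous lattice-valued function, that is, by a constant.\<close>

lemma torus_lift_has_derivative:
  assumes "C1_map F" "torus_lift F f"
  shows "(f has_derivative blinfun_apply (torus_deriv F (proj x))) (at x)"
proof -
  obtain g z where g: "proj z = proj x" "\<forall>\<^sub>F y in nhds z. proj (g y) = F (proj y)"
      "(g has_derivative blinfun_apply (torus_deriv F (proj x))) (at z)"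
    using C1_map_has_derivative[OF assms(1), of "proj x"] unfolding has_torus_derivative_def by blast
  have l: "z - x \<in> int_lattice" using g(1) by (simp add: proj_eq_iff)
  define h where "h = (\<lambda>y. g (y + (z - x)))"
  have lim: "filterlim (\<lambda>y. y + (z - x)) (nhds z) (nhds x)"
  proof -
    have "((\<lambda>y. y + (z - x)) \<longlongrightarrow> x + (z - x)) (nhds x)"
      by (intro tendsto_intros filterlim_ident)
    then show ?thesis by simp
  qed
  have ev: "\<forall>\<^sub>F y in nhds x. proj (h y) = F (proj y)"
  proof -
    have "\<forall>\<^sub>F y in nhds x. proj (g (y + (z - x))) = F (proj (y + (z - x)))"
      using lim g(2) unfolding filterlim_iff by blast
    then show ?thesis by (simp add: h_def proj_add_lattice[OF l])
  qed
  have dh: "(h has_derivative blinfun_apply (torus_deriv F (proj x))) (at x)"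
  proof -
    have "((\<lambda>y. y + (z - x)) has_derivative (\<lambda>h. h)) (at x)"
      by (auto intro!: derivative_eq_intros)
    moreover have "(g has_derivative blinfun_apply (torus_deriv F (proj x))) (at (x + (z - x)))"
      using g(3) by simp
    ultimately show ?thesis
      unfolding h_def by (rule has_derivative_compose)
  qed
  define c where "c = f x - h x"
  have cont: "((\<lambda>y. f y - h y) \<longlongrightarrow> c) (nhds x)"
  proof -
    have "isCont f x"
      using torus_lift_continuous[OF assms(2)] by (simp add: continuous_on_eq_continuous_at)
    moreover have "isCont h x"
      using dh has_derivative_continuous by blast
    ultimately have "isCont (\<lambda>y. f y - h y) x"
      by (intro continuous_intros)
    then show ?thesis
      using tendsto_at_iff_tendsto_nhds[of "\<lambda>y. f y - h y" x] by (simp add: isCont_def c_def)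
  qed
  have near: "\<forall>\<^sub>F y in nhds x. dist (f y - h y) c < 1"
    using tendstoD[OF cont, of 1] by simp
  have hx: "proj (h x) = F (proj x)"
    using ev eventually_nhds_x_imp_x by blast
  have eq: "\<forall>\<^sub>F y in nhds x. h y + c = f y"
    using near ev
  proof eventually_elim
    case (elim y)
    have "f y - h y \<in> int_lattice" "f x - h x \<in> int_lattice"
      using elim(2) hx torus_lift_proj[OF assms(2)] by (simp_all flip: proj_eq_iff)
    then have "f y - h y - c \<in> int_lattice"
      unfolding c_def by (rule int_lattice_diff)
    then have "f y - h y - c = 0"
      using elim(1) by (intro lattice_small_eq_0) (auto simp: dist_norm)
    then show ?case by (simp add: algebra_simps)
  qed
  have "((\<lambda>y. h y + c) has_derivative blinfun_apply (torus_deriv F (proj x))) (at x)"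
    using has_derivative_add_const[OF dh] .
  then show ?thesis
    by (rule has_derivative_transform_eventually)
      (use eq in \<open>auto simp: eventually_at_filter c_def elim: eventually_mono\<close>)
qed

lemma C1_mapI_lift:
  assumes lift: "torus_lift F f"
    and deriv: "\<And>x. (f has_derivative blinfun_apply (D x)) (at x)"
    and cont: "continuous_on UNIV D"
  shows "C1_map F" "torus_deriv F (proj x) = D x"
proof -
  have h: "has_torus_derivative F (D x) (proj x)" for x
    by (rule has_torus_derivative_proj[OF torus_lift_proj[OF lift] deriv])
  then show eq: "torus_deriv F (proj x) = D x" for x
    by (rule torus_deriv_eqI)
  have "continuous_on UNIV (torus_deriv F)"
    unfolding continuous_on_torus_iff eq by (rule cont)
  moreover have "\<exists>D. has_torus_derivative F D p" for p
    by (rule torus_cases[of p]) (use h in auto)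
  ultimately show "C1_map F"
    by (auto simp: C1_map_def)
qed

lemma C1_map_deriv_continuous: "C1_map F \<Longrightarrow> continuous_on UNIV (torus_deriv F)"
  by (simp add: C1_map_def)

lemma
  assumes F: "C1_map F" and G: "C1_map G"
  shows C1_map_compose: "C1_map (G \<circ> F)"
    and torus_deriv_compose: "torus_deriv (G \<circ> F) p = torus_deriv G (F p) o\<^sub>L torus_deriv F p"
proof -
  obtain f where f: "torus_lift F f"
    using torus_lift_exists[OF C1_map_continuous[OF F]] .
  obtain g where g: "torus_lift G g"
    using torus_lift_exists[OF C1_map_continuous[OF G]] .
  let ?D = "\<lambda>x. torus_deriv G (F (proj x)) o\<^sub>L torus_deriv F (proj x)"
  have d: "(g \<circ> f has_derivative blinfun_apply (?D x)) (at x)" for x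
  proof -
    have "(g has_derivative blinfun_apply (torus_deriv G (F (proj x)))) (at (f x))"
      using torus_lift_has_derivative[OF G g, of "f x"] by (simp add: torus_lift_proj[OF f])
    then show ?thesis
      using has_derivative_compose[OF torus_lift_has_derivative[OF F f, of x]]
      by (simp add: o_def blinfun_compose.rep_eq)
  qed
  have "continuous_on UNIV (\<lambda>p. torus_deriv G (F p) o\<^sub>L torus_deriv F p)"
    using C1_map_deriv_continuous[OF F] C1_map_deriv_continuous[OF G] C1_map_continuous[OF F]
    by (intro continuous_intros) (auto intro: continuous_on_compose2)
  then have c: "continuous_on UNIV ?D"
    by (simp add: continuous_on_torus_iff)
  show "C1_map (G \<circ> F)"
    using C1_mapI_lift(1)[OF torus_lift_compose[OF f g] d c] .
  show "torus_deriv (G \<circ> F) p = torus_deriv G (F p) o\<^sub>L torus_deriv F p"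
    by (rule torus_cases[of p]) (use C1_mapI_lift(2)[OF torus_lift_compose[OF f g] d c] in auto)
qed

lemma
  shows C1_map_id: "C1_map id" and torus_deriv_id: "torus_deriv id p = id_blinfun"
proof -
  have l: "torus_lift id id" by (simp add: torus_lift_def)
  have d: "(id has_derivative blinfun_apply id_blinfun) (at x)" for x :: "real^2"
    by (simp add: id_blinfun.rep_eq id_def)
  show "C1_map id"
    using C1_mapI_lift(1)[OF l d] by simp
  show "torus_deriv id p = id_blinfun"
    by (rule torus_cases[of p]) (use C1_mapI_lift(2)[OF l d] in auto)
qed

lemma
  assumes "C1_map F"
  shows C1_map_funpow: "C1_map (F ^^ n)"
    and torus_deriv_funpow_Suc:
      "torus_deriv (F ^^ Suc n) p = torus_deriv F ((F ^^ n) p) o\<^sub>L torus_deriv (F ^^ n) p"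
proof -
  have "C1_map (F ^^ n)" for n
  proof (induction n)
    case 0
    show ?case using C1_map_id by (simp add: id_def)
  next
    case (Suc n)
    then show ?case using C1_map_compose[OF Suc assms] by (simp add: o_def)
  qed
  then show "C1_map (F ^^ n)"
      "torus_deriv (F ^^ Suc n) p = torus_deriv F ((F ^^ n) p) o\<^sub>L torus_deriv (F ^^ n) p"
    using torus_deriv_compose assms by auto
qed

lemma torus_deriv_ident [simp]: "torus_deriv (\<lambda>a. a) p = id_blinfun"
  using torus_deriv_id by (simp add: id_def)

lemma C1_diffeoD:
  assumes "C1_diffeo F"
  shows "bij F" "C1_map F" "C1_map (inv F)" "inv F (F p) = p" "F (inv F p) = p"
    "torus_deriv (inv F) (F p) (torus_deriv F p v) = v"
    "torus_deriv F p (torus_deriv (inv F) (F p) v) = v"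
proof -
  show b: "bij F" "C1_map F" "C1_map (inv F)" and i: "inv F (F p) = p" "F (inv F p) = p" for p
    using assms by (auto simp: C1_diffeo_def bij_is_inj bij_is_surj surj_f_inv_f)
  have "inv F \<circ> F = id" "F \<circ> inv F = id"
    using i by auto
  then have "torus_deriv (inv F) (F p) o\<^sub>L torus_deriv F p = id_blinfun"
      "torus_deriv F (inv F (F p)) o\<^sub>L torus_deriv (inv F) (F p) = id_blinfun"
    using torus_deriv_compose[OF b(2,3), of p] torus_deriv_compose[OF b(3,2), of "F p"]
    by (simp_all add: torus_deriv_id)
  then show "torus_deriv (inv F) (F p) (torus_deriv F p v) = v"
      "torus_deriv F p (torus_deriv (inv F) (F p) v) = v"
    by (metis blinfun_apply_blinfun_compose blinfun_apply_id_blinfun id_apply i(1))+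
qed

section \<open>The hyperbolic splitting\<close>

lemma C1_diffeo_inv: "C1_diffeo F \<Longrightarrow> C1_diffeo (inv F)"
  by (simp add: C1_diffeo_def bij_imp_bij_inv inv_inv_eq)

lemma C1_diffeo_funpow:
  assumes "C1_diffeo F"
  shows "C1_diffeo (F ^^ n)" "inv (F ^^ n) = inv F ^^ n"
  using assms C1_map_funpow by (auto simp: C1_diffeo_def inv_fn)

text \<open>Compactness provides a pair of points realising the diameter; their preimages would be
  twice as far apart. This excludes Anosov splittings with a trivial factor.\<close>

lemma no_torus_contraction:
  assumes G: "C1_map G" "surj G" and c: "\<And>p v. norm (torus_deriv G p v) \<le> norm v / 2"
  shows False
proof -
  obtain g where g: "torus_lift G g"
    using torus_lift_exists[OF C1_map_continuous[OF G(1)]] .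
  have lip: "norm (g x - g y) \<le> 1/2 * norm (x - y)" for x y
  proof (rule differentiable_bound[of UNIV g "\<lambda>x. blinfun_apply (torus_deriv G (proj x))"])
    show "onorm (blinfun_apply (torus_deriv G (proj x))) \<le> 1/2" for x
      by (rule onorm_bound) (use c[of "proj x"] in auto)
  qed (use torus_lift_has_derivative[OF G(1) g] in auto)
  have "\<exists>z\<in>UNIV. \<forall>w\<in>UNIV. dist (fst w :: torus) (snd w :: torus) \<le> dist (fst z :: torus) (snd z :: torus)"
  proof (rule continuous_attains_sup)
    show "compact (UNIV :: (torus \<times> torus) set)"
      using compact_Times[OF compact_torus compact_torus] by simp
  qed (auto intro!: continuous_intros)
  then obtain z :: "torus \<times> torus" where z: "\<And>w :: torus \<times> torus. dist (fst w) (snd w) \<le> dist (fst z) (snd z)"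
    by blast
  obtain a b where ab: "fst z = G a" "snd z = G b"
    using G(2) by (metis surj_def)
  obtain x where x: "a = proj x" by (rule torus_cases)
  obtain y where y: "proj y = b" "dist (proj x) b = dist x y"
    by (rule dist_proj_attained)
  have "dist (fst z) (snd z) \<le> dist (g x) (g y)"
    using ab x y dist_proj_le[of "g x" "g y"] by (simp add: torus_lift_proj[OF g])
  also have "\<dots> \<le> 1/2 * dist x y"
    using lip by (simp add: dist_norm)
  finally have "dist (fst z) (snd z) \<le> 1/2 * dist a b"
    using x y by simp
  moreover have "dist a b \<le> dist (fst z) (snd z)"
    using z[of "(a, b)"] by simp
  ultimately have "dist (fst z) (snd z) \<le> 0" by linarith
  then have "dist p q \<le> 0" for p q :: torus
    using z[of "(p, q)"] by simp
  then have "proj 0 = proj (\<chi> i. 1/2)"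
    by simp
  then have "(0::real^2) - (\<chi> i. 1/2) \<in> int_lattice"
    by (simp only: proj_eq_iff)
  then have "(0::real) - 1/2 \<in> \<int>"
    by (simp add: int_lattice_def)
  then show False
    using Ints_nonzero_abs_less1[of "(0::real) - 1/2"] by simp
qed

text \<open>A locale, so that it can be interpreted again for the inverse map with the two bundles
  exchanged; every fact about stable vectors then has an unstable counterpart.\<close>

locale hyperbolic_splitting =
  fixes F :: "torus \<Rightarrow> torus" and Es Eu :: "torus \<Rightarrow> (real^2) set" and C \<theta> :: real
  assumes diffeo: "C1_diffeo F"
    and C_pos: "0 < C" and theta: "0 < \<theta>" "\<theta> < 1"
    and sub_s: "subspace (Es p)" and sub_u: "subspace (Eu p)"
    and inter: "Es p \<inter> Eu p = {0}"
    and span: "{u + v | u v. u \<in> Es p \<and> v \<in> Eu p} = UNIV"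
    and inv_s: "torus_deriv F p ` Es p = Es (F p)"
    and inv_u: "torus_deriv F p ` Eu p = Eu (F p)"
    and est_s: "v \<in> Es p \<Longrightarrow> norm (torus_deriv (F ^^ n) p v) \<le> C * \<theta> ^ n * norm v"
    and est_u: "v \<in> Eu p \<Longrightarrow> norm (torus_deriv (inv F ^^ n) p v) \<le> C * \<theta> ^ n * norm v"
begin

lemma splitting_inverse: "hyperbolic_splitting (inv F) Eu Es C \<theta>"
proof
  note D = C1_diffeoD[OF diffeo]
  have *: "torus_deriv (inv F) p ` E p = E (inv F p)"
    if "\<And>p. torus_deriv F p ` E p = E (F p)" for E p
  proof -
    have "E p = torus_deriv F (inv F p) ` E (inv F p)"
      using that[of "inv F p"] D(5) by simp
    moreover have "torus_deriv (inv F) p (torus_deriv F (inv F p) v) = v" for v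
      using D(6)[of "inv F p" v] D(5) by simp
    ultimately show ?thesis by (simp add: image_image)
  qed
  show "torus_deriv (inv F) p ` Eu p = Eu (inv F p)" "torus_deriv (inv F) p ` Es p = Es (inv F p)" for p
    using * inv_u inv_s by blast+
  show "Eu p \<inter> Es p = {0}" for p
    using inter by blast
  show "{u + v |u v. u \<in> Eu p \<and> v \<in> Es p} = UNIV" for p
  proof -
    have "w \<in> {u + v |u v. u \<in> Eu p \<and> v \<in> Es p}" for w
    proof -
      have "w \<in> {u + v | u v. u \<in> Es p \<and> v \<in> Eu p}" using span by simp
      then obtain u v where "w = v + u" "u \<in> Es p" "v \<in> Eu p"
        by (auto simp: add.commute)
      then show ?thesis by blast
    qed
    then show ?thesis by blast
  qed
  show "norm (torus_deriv (inv (inv F) ^^ n) p v) \<le> C * \<theta> ^ n * norm v" if "v \<in> Es p" for p v n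
    using est_s[OF that] D(1) by (simp add: inv_inv_eq)
qed (use C1_diffeo_inv diffeo C_pos theta sub_u sub_s est_u in auto)

lemma funpow_inverse: "(inv F ^^ n) ((F ^^ n) p) = p" "(F ^^ n) ((inv F ^^ n) p) = p"
  using C1_diffeoD(4,5)[OF C1_diffeo_funpow(1)[OF diffeo]] C1_diffeo_funpow(2)[OF diffeo] by metis+

lemma deriv_funpow_inverse:
  "torus_deriv (inv F ^^ n) ((F ^^ n) p) (torus_deriv (F ^^ n) p v) = v"
  using C1_diffeoD(6)[OF C1_diffeo_funpow(1)[OF diffeo]] C1_diffeo_funpow(2)[OF diffeo] by metis

lemma deriv_funpow_mem:
  shows "v \<in> Es p \<Longrightarrow> torus_deriv (F ^^ n) p v \<in> Es ((F ^^ n) p)"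
    and "v \<in> Eu p \<Longrightarrow> torus_deriv (F ^^ n) p v \<in> Eu ((F ^^ n) p)"
proof -
  have *: "torus_deriv (F ^^ n) p v \<in> E ((F ^^ n) p)"
    if "\<And>p. torus_deriv F p ` E p = E (F p)" "v \<in> E p" for E
  proof (induction n)
    case 0
    then show ?case using that by simp
  next
    case (Suc n)
    then show ?case
      unfolding torus_deriv_funpow_Suc[OF C1_diffeoD(2)[OF diffeo]]
      using that(1)[of "(F ^^ n) p"] by auto
  qed
  show "v \<in> Es p \<Longrightarrow> torus_deriv (F ^^ n) p v \<in> Es ((F ^^ n) p)"
      "v \<in> Eu p \<Longrightarrow> torus_deriv (F ^^ n) p v \<in> Eu ((F ^^ n) p)"
    using * inv_s inv_u by blast+
qed

lemma unstable_growth: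
  assumes "u \<in> Eu p"
  shows "norm u \<le> C * \<theta> ^ n * norm (torus_deriv (F ^^ n) p u)"
  using est_u[OF deriv_funpow_mem(2)[OF assms, of n], of n] by (simp add: deriv_funpow_inverse)

section \<open>The projection onto the stable bundle along the unstable one\<close>

definition stable_part :: "torus \<Rightarrow> real^2 \<Rightarrow> real^2" where
  "stable_part p v = (THE s. s \<in> Es p \<and> v - s \<in> Eu p)"

lemma stable_part_eqI:
  assumes "s \<in> Es p" "v - s \<in> Eu p"
  shows "stable_part p v = s"
  unfolding stable_part_def
proof (rule the_equality)
  fix t assume t: "t \<in> Es p \<and> v - t \<in> Eu p"
  have "t - s \<in> Es p"
    using t assms sub_s by (simp add: subspace_diff)
  moreover have "(v - s) - (v - t) \<in> Eu p"
    using t assms subspace_diff[OF sub_u] by blast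
  then have "t - s \<in> Eu p" by simp
  ultimately have "t - s \<in> Es p \<inter> Eu p" by simp
  then show "t = s" using inter by simp
qed (use assms in auto)

lemma stable_part_mem: "stable_part p v \<in> Es p" "v - stable_part p v \<in> Eu p"
proof -
  have "v \<in> {u + v | u v. u \<in> Es p \<and> v \<in> Eu p}"
    using span by simp
  then obtain s u where "s \<in> Es p" "u \<in> Eu p" "v = s + u"
    by blast
  then show "stable_part p v \<in> Es p" "v - stable_part p v \<in> Eu p"
    using stable_part_eqI[of s p v] by simp_all
qed

lemma linear_stable_part: "linear (stable_part p)"
proof (rule linearI)
  fix v w
  have "v + w - (stable_part p v + stable_part p w) = (v - stable_part p v) + (w - stable_part p w)"
    by simp
  also have "\<dots> \<in> Eu p"
    using stable_part_mem sub_u by (intro subspace_add) auto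
  finally show "stable_part p (v + w) = stable_part p v + stable_part p w"
    by (intro stable_part_eqI subspace_add[OF sub_s] stable_part_mem)
next
  fix c v
  have "c *\<^sub>R v - c *\<^sub>R stable_part p v = c *\<^sub>R (v - stable_part p v)"
    by (simp add: algebra_simps)
  also have "\<dots> \<in> Eu p"
    using stable_part_mem sub_u by (intro subspace_scale) auto
  finally show "stable_part p (c *\<^sub>R v) = c *\<^sub>R stable_part p v"
    by (intro stable_part_eqI subspace_scale[OF sub_s] stable_part_mem)
qed

lemma stable_part_equivariant:
  "stable_part (F p) (torus_deriv F p v) = torus_deriv F p (stable_part p v)"
proof (rule stable_part_eqI)
  show "torus_deriv F p (stable_part p v) \<in> Es (F p)"
    using inv_s stable_part_mem by blast
  have "torus_deriv F p v - torus_deriv F p (stable_part p v) = torus_deriv F p (v - stable_part p v)"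
    by (simp add: blinfun.diff_right)
  then show "torus_deriv F p v - torus_deriv F p (stable_part p v) \<in> Eu (F p)"
    using inv_u stable_part_mem by blast
qed

lemma power_theta_small:
  assumes "e > 0"
  obtains n where "\<theta> ^ n < e"
  using real_arch_pow_inv[OF assms theta(2)] by blast

text \<open>The angle between the bundles must be bounded below before anything is known about their
  continuity. A large stable part would have to be nearly cancelled by an unstable part; but a fixed
  iterate shrinks the former and stretches the latter, so no cancellation would be left in the
  image.\<close>

lemma stable_part_bounded:
  obtains M where "M > 0" "\<And>p v. norm (stable_part p v) \<le> M * norm v"
proof -
  \<comment> \<open>Makes (C \<theta>^n)^2 at most 1/2, so that the stable part reappearing on the
    right can be absorbed.\<close>
  obtain n where n: "\<theta> ^ n < min 1 (1 / (2 * C ^ 2))"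
    using power_theta_small[of "min 1 (1 / (2 * C ^ 2))"] C_pos by auto
  have t: "C * \<theta> ^ n * (C * \<theta> ^ n) \<le> 1/2"
  proof -
    have "C * \<theta> ^ n * (C * \<theta> ^ n) = C ^ 2 * (\<theta> ^ n * \<theta> ^ n)"
      by (simp add: power2_eq_square)
    also have "\<dots> \<le> C ^ 2 * (1 / (2 * C ^ 2) * 1)"
      using n theta by (intro mult_left_mono mult_mono) auto
    also have "\<dots> = 1/2" using C_pos by simp
    finally show ?thesis .
  qed
  obtain L where L: "L > 0" "\<And>p. norm (torus_deriv (F ^^ n) p) \<le> L"
    using torus_continuous_bounded[OF C1_map_deriv_continuous[OF C1_map_funpow[OF C1_diffeoD(2)[OF diffeo]]]] by blast
  have "norm (stable_part p v) \<le> 2 * (1 + C * \<theta> ^ n * L) * norm v" for p v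
  proof -
    let ?D = "torus_deriv (F ^^ n) p" and ?s = "stable_part p v"
    let ?c = "C * \<theta> ^ n"
    have c: "?c > 0" using C_pos theta by simp
    have "norm (?D (v - ?s)) \<le> norm (?D v) + norm (?D ?s)"
      by (simp add: blinfun.diff_right norm_triangle_ineq4)
    moreover have "norm (?D v) \<le> L * norm v"
      using norm_blinfun[of ?D v] L(2)[of p] by (meson mult_right_mono norm_ge_zero order_trans)
    moreover have "norm (?D ?s) \<le> ?c * norm ?s"
      by (rule est_s[OF stable_part_mem(1)])
    ultimately have D: "norm (?D (v - ?s)) \<le> L * norm v + ?c * norm ?s"
      by linarith
    have "norm (v - ?s) \<le> ?c * norm (?D (v - ?s))"
      by (rule unstable_growth[OF stable_part_mem(2)])
    also have "\<dots> \<le> ?c * (L * norm v + ?c * norm ?s)"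
      using c by (intro mult_left_mono D) auto
    also have "\<dots> = ?c * L * norm v + (?c * ?c) * norm ?s"
      by (simp add: algebra_simps)
    also have "(?c * ?c) * norm ?s \<le> 1/2 * norm ?s"
      using t by (intro mult_right_mono) auto
    finally have "norm (v - ?s) \<le> ?c * L * norm v + 1/2 * norm ?s" by simp
    moreover have "norm ?s \<le> norm v + norm (v - ?s)"
      by (metis norm_minus_commute norm_triangle_sub)
    ultimately show ?thesis by (simp add: algebra_simps)
  qed
  moreover have "2 * (1 + C * \<theta> ^ n * L) > 0"
    using C_pos theta L(1) by (simp add: add_pos_nonneg)
  ultimately show ?thesis using that by blast
qed

text \<open>The unstable component of v is the difference of two vectors that decay forwards, yet it
  has to grow unless it vanishes. The stable space is thus described by inequalities, which survive
  limits.\<close>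

lemma stable_memI:
  assumes "\<And>n. norm (torus_deriv (F ^^ n) p v) \<le> C * \<theta> ^ n * norm v"
  shows "v \<in> Es p"
proof -
  let ?s = "stable_part p v"
  have b: "norm (v - ?s) \<le> \<theta> ^ n * (C * (C * norm v + C * norm ?s))" for n
  proof -
    let ?D = "torus_deriv (F ^^ n) p"
    have t: "\<theta> ^ n \<le> 1" using theta by (simp add: power_le_one)
    have "norm (v - ?s) \<le> C * \<theta> ^ n * norm (?D (v - ?s))"
      by (rule unstable_growth[OF stable_part_mem(2)])
    also have "norm (?D (v - ?s)) \<le> norm (?D v) + norm (?D ?s)"
      by (simp add: blinfun.diff_right norm_triangle_ineq4)
    also have "\<dots> \<le> C * \<theta> ^ n * norm v + C * \<theta> ^ n * norm ?s"
      by (intro add_mono assms est_s[OF stable_part_mem(1)])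
    also have "\<dots> \<le> C * 1 * norm v + C * 1 * norm ?s"
      using t C_pos by (intro add_mono mult_right_mono mult_left_mono) auto
    finally show ?thesis
      using C_pos theta by (simp add: mult_ac)
  qed
  have "(\<lambda>n. \<theta> ^ n * (C * (C * norm v + C * norm ?s))) \<longlonglongrightarrow> 0 * (C * (C * norm v + C * norm ?s))"
    by (intro tendsto_intros LIMSEQ_power_zero) (use theta in auto)
  then have "norm (v - ?s) \<le> 0"
    using b by (intro tendsto_lowerbound[of _ _ sequentially]) auto
  then have "v = ?s" by simp
  then show ?thesis using stable_part_mem(1)[of p v] by simp
qed

lemma stable_closed:
  assumes "P \<longlonglongrightarrow> p" "V \<longlonglongrightarrow> v" "\<And>j. V j \<in> Es (P j)"
  shows "v \<in> Es p"
proof (rule stable_memI)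
  fix n
  have "isCont (torus_deriv (F ^^ n)) p"
    using C1_map_deriv_continuous[OF C1_map_funpow[OF C1_diffeoD(2)[OF diffeo]]]
    by (simp add: continuous_on_eq_continuous_at)
  then have "(\<lambda>j. torus_deriv (F ^^ n) (P j)) \<longlonglongrightarrow> torus_deriv (F ^^ n) p"
    by (rule isCont_tendsto_compose[OF _ assms(1)])
  then have "(\<lambda>j. norm (torus_deriv (F ^^ n) (P j) (V j))) \<longlonglongrightarrow> norm (torus_deriv (F ^^ n) p v)"
    by (intro tendsto_intros assms)
  moreover have "(\<lambda>j. C * \<theta> ^ n * norm (V j)) \<longlonglongrightarrow> C * \<theta> ^ n * norm v"
    by (intro tendsto_intros assms)
  ultimately show "norm (torus_deriv (F ^^ n) p v) \<le> C * \<theta> ^ n * norm v"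
    by (rule LIMSEQ_le) (use est_s assms(3) in blast)
qed

lemma unstable_closed:
  assumes "P \<longlonglongrightarrow> p" "V \<longlonglongrightarrow> v" "\<And>j. V j \<in> Eu (P j)"
  shows "v \<in> Eu p"
proof -
  interpret i: hyperbolic_splitting "inv F" Eu Es C \<theta> by (rule splitting_inverse)
  show ?thesis using i.stable_closed assms by blast
qed

text \<open>The bundles are closed, so the graph of the projection is closed; its values stay in a
  compact ball, and the closed graph criterion applies.\<close>

lemma stable_part_continuous: "continuous_on UNIV (\<lambda>p. stable_part p v)"
proof -
  obtain M where M: "M > 0" "\<And>p v. norm (stable_part p v) \<le> M * norm v"
    using stable_part_bounded by blast
  show ?thesis
    unfolding continuous_on_torus_iff
  proof (rule continuous_from_closed_graph[of "cball 0 (M * norm v)"])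
    show "(\<lambda>x. stable_part (proj x) v) \<in> UNIV \<rightarrow> cball 0 (M * norm v)"
      using M(2) by auto
    show "closed ((\<lambda>x. (x, stable_part (proj x) v)) ` UNIV)"
      unfolding closed_sequential_limits
    proof (intro allI impI, elim conjE)
      fix x l
      assume x: "\<forall>n. x n \<in> range (\<lambda>x. (x, stable_part (proj x) v))" and lim: "x \<longlonglongrightarrow> l"
      have eq: "snd (x n) = stable_part (proj (fst (x n))) v" for n
        using x by (metis (no_types, lifting) fst_conv imageE snd_conv)
      have "isCont proj (fst l)"
        using continuous_on_proj[of UNIV] by (simp add: continuous_on_eq_continuous_at)
      then have 1: "(\<lambda>n. proj (fst (x n))) \<longlonglongrightarrow> proj (fst l)"
        by (rule isCont_tendsto_compose) (intro tendsto_intros lim)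
      have 2: "(\<lambda>n. snd (x n)) \<longlonglongrightarrow> snd l"
        by (intro tendsto_intros lim)
      have "snd l \<in> Es (proj (fst l))"
        by (rule stable_closed[OF 1 2]) (simp add: eq stable_part_mem)
      moreover have "v - snd l \<in> Eu (proj (fst l))"
      proof (rule unstable_closed[OF 1])
        show "(\<lambda>n. v - snd (x n)) \<longlonglongrightarrow> v - snd l"
          by (intro tendsto_intros 2)
      qed (simp add: eq stable_part_mem)
      ultimately have "snd l = stable_part (proj (fst l)) v"
        using stable_part_eqI by metis
      then show "l \<in> range (\<lambda>x. (x, stable_part (proj x) v))"
        by (intro image_eqI[of _ _ "fst l"]) (simp_all add: prod_eq_iff)
    qed
  qed auto
qed

text \<open>Hyperbolicity as defined allows a zero unstable space at a point. The set where it is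
  nonzero is closed by compactness of the unit sphere, its complement is closed by continuity of the
  projection, and the torus is connected. Were it zero everywhere, some iterate of F would be a
  contraction.\<close>

lemma unstable_nontrivial: "\<exists>u\<in>Eu p. u \<noteq> 0"
proof -
  define Z where "Z = {p. \<exists>u\<in>Eu p. norm u = 1}"
  have Zc: "closed Z"
    unfolding closed_sequential_limits
  proof (intro allI impI, elim conjE)
    fix x l assume x: "\<forall>n. x n \<in> Z" and lim: "x \<longlonglongrightarrow> l"
    then have "\<forall>n. \<exists>u. u \<in> Eu (x n) \<and> norm u = 1"
      by (auto simp: Z_def)
    then obtain u where u: "\<And>n. u n \<in> Eu (x n)" "\<And>n. norm (u n) = 1"
      by metis
    have "compact (sphere (0::real^2) 1)" by simp
    moreover have "\<forall>n. u n \<in> sphere 0 1" using u by simp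
    ultimately obtain w r where w: "w \<in> sphere 0 1" "strict_mono r" "(u \<circ> r) \<longlonglongrightarrow> w"
      unfolding compact_def by blast
    have "w \<in> Eu l"
      by (rule unstable_closed[OF LIMSEQ_subseq_LIMSEQ[OF lim w(2)] w(3)]) (use u in auto)
    then show "l \<in> Z" using w(1) by (auto simp: Z_def)
  qed
  \<comment> \<open>A trivial unstable space means that the projection is the identity, which is
    visibly a closed condition on p.\<close>
  have cZ: "- Z = {p. \<forall>v. stable_part p v = v}"
  proof (intro set_eqI iffI)
    fix p assume "p \<in> - Z"
    have zero: "u = 0" if "u \<in> Eu p" for u
    proof (rule ccontr)
      assume "u \<noteq> 0"
      then have "(1 / norm u) *\<^sub>R u \<in> Eu p" "norm ((1 / norm u) *\<^sub>R u) = 1"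
        using that sub_u by (auto intro: subspace_scale)
      then show False using \<open>p \<in> - Z\<close> by (auto simp: Z_def)
    qed
    show "p \<in> {p. \<forall>v. stable_part p v = v}"
      using zero[OF stable_part_mem(2)] by simp
  next
    fix p assume p: "p \<in> {p. \<forall>v. stable_part p v = v}"
    have zero: "u = 0" if "u \<in> Eu p" for u
    proof -
      have "stable_part p u = 0"
        using that sub_s by (intro stable_part_eqI) (auto simp: subspace_0)
      then show ?thesis using p by simp
    qed
    then show "p \<in> - Z" by (auto simp: Z_def dest: zero)
  qed
  have "{p. \<forall>v. stable_part p v = v} = (\<Inter>v. {p. stable_part p v = v})" by auto
  moreover have "closed \<dots>"
    by (intro closed_INT ballI closed_Collect_eq stable_part_continuous continuous_intros)
  ultimately have "closed (- Z)" using cZ by simp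
  then have "Z = {} \<or> Z = UNIV"
    using Zc connected_torus unfolding connected_clopen by (simp add: open_closed)
  moreover have "Z \<noteq> {}"
  proof
    assume "Z = {}"
    then have all: "stable_part p v = v" for p v
      using cZ by auto
    obtain n where n: "\<theta> ^ n < 1 / (2 * C)"
      using power_theta_small[of "1 / (2 * C)"] C_pos by auto
    have "norm (torus_deriv (F ^^ n) p v) \<le> norm v / 2" for p v
    proof -
      have "norm (torus_deriv (F ^^ n) p v) \<le> C * \<theta> ^ n * norm v"
        using est_s stable_part_mem(1)[of p v] all by simp
      also have "\<dots> \<le> C * (1 / (2 * C)) * norm v"
        using n C_pos by (intro mult_right_mono mult_left_mono) auto
      finally show ?thesis using C_pos by simp
    qed
    moreover have "surj (F ^^ n)"
      using C1_diffeoD(1)[OF C1_diffeo_funpow(1)[OF diffeo]] bij_is_surj by blast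
    ultimately show False
      using no_torus_contraction[OF C1_map_funpow[OF C1_diffeoD(2)[OF diffeo]]] by blast
  qed
  ultimately have "p \<in> Z" by auto
  then obtain u where "u \<in> Eu p" "norm u = 1" by (auto simp: Z_def)
  then show ?thesis by (intro bexI[of _ u]) auto
qed

lemma stable_nontrivial: "\<exists>s\<in>Es p. s \<noteq> 0"
proof -
  interpret i: hyperbolic_splitting "inv F" Eu Es C \<theta> by (rule splitting_inverse)
  show ?thesis by (rule i.unstable_nontrivial)
qed

end

text \<open>From here on the splitting is represented by a continuous field of projections, with
  estimates valid for every vector v; the constant absorbs the norm of the projection.\<close>

lemma anosov_projection:
  assumes "anosov F"
  obtains P :: "torus \<Rightarrow> (real^2) \<Rightarrow>\<^sub>L (real^2)" and B \<theta> :: real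
  where "continuous_on UNIV P" "B > 0" "0 < \<theta>" "\<theta> < 1"
    "\<And>p v. P (F p) (torus_deriv F p v) = torus_deriv F p (P p v)"
    "\<And>p v n. norm (torus_deriv (F ^^ n) p (P p v)) \<le> B * \<theta> ^ n * norm v"
    "\<And>p v n. norm (torus_deriv (inv F ^^ n) p (v - P p v)) \<le> B * \<theta> ^ n * norm v"
    "\<And>p. \<exists>s. s \<noteq> 0 \<and> P p s = s" "\<And>p. \<exists>u. u \<noteq> 0 \<and> P p u = 0"
    "\<And>p v. P p (P p v) = P p v"
proof -
  let ?H = "\<lambda>Es Eu C \<theta>. C > 0 \<and> 0 < \<theta> \<and> \<theta> < 1 \<and>
        (\<forall>p\<in>UNIV. subspace (Es p) \<and> subspace (Eu p) \<and>
           Es p \<inter> Eu p = {0} \<and> {u + v | u v. u \<in> Es p \<and> v \<in> Eu p} = UNIV \<and>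
           torus_deriv F p ` Es p = Es (F p) \<and> torus_deriv F p ` Eu p = Eu (F p) \<and>
           (\<forall>v\<in>Es p. \<forall>n. norm (torus_deriv (F ^^ n) p v) \<le> C * \<theta> ^ n * norm v) \<and>
           (\<forall>v\<in>Eu p. \<forall>n. norm (torus_deriv (inv F ^^ n) p v) \<le> C * \<theta> ^ n * norm v))"
  have F: "C1_diffeo F" "hyperbolic_set F UNIV" using assms by (simp_all add: anosov_def)
  have "\<exists>Es Eu C \<theta>. ?H Es Eu C \<theta>"
    by (rule F(2)[unfolded hyperbolic_set_def, THEN conjunct2, THEN conjunct2])
  then obtain Es Eu C \<theta> where H: "?H Es Eu C \<theta>"
    by (elim exE)
  have c: "C > 0" "0 < \<theta>" "\<theta> < 1" by (rule H[THEN conjunct1] H[THEN conjunct2, THEN conjunct1]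
      H[THEN conjunct2, THEN conjunct2, THEN conjunct1])+
  note s = H[THEN conjunct2, THEN conjunct2, THEN conjunct2, THEN bspec, OF UNIV_I]
  note s1 = s[THEN conjunct1] and s2 = s[THEN conjunct2]
  note t1 = s2[THEN conjunct1] and t2 = s2[THEN conjunct2]
  note u1 = t2[THEN conjunct1] and u2 = t2[THEN conjunct2]
  note v1 = u2[THEN conjunct1] and v2 = u2[THEN conjunct2]
  note w1 = v2[THEN conjunct1] and w2 = v2[THEN conjunct2]
  note x1 = w2[THEN conjunct1] and x2 = w2[THEN conjunct2]
  interpret hyperbolic_splitting F Es Eu C \<theta>
    by unfold_locales (rule F(1) c s1 t1 u1 v1 w1 x1 x2[THEN conjunct1, rule_format]
        x2[THEN conjunct2, rule_format]; assumption?)+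
  obtain M where M: "M > 0" "\<And>p v. norm (stable_part p v) \<le> M * norm v"
    using stable_part_bounded by blast
  define P where "P p = Blinfun (stable_part p)" for p
  have P: "blinfun_apply (P p) = stable_part p" for p
    unfolding P_def by (intro bounded_linear_Blinfun_apply linear_conv_bounded_linear[THEN iffD1] linear_stable_part)
  show ?thesis
  proof (rule that[of P "C * (1 + M)" \<theta>])
    show "continuous_on UNIV P"
      by (intro continuous_on_blinfun_componentwise) (simp add: P stable_part_continuous)
    show "norm (torus_deriv (F ^^ n) p (P p v)) \<le> C * (1 + M) * \<theta> ^ n * norm v" for n p v
    proof -
      have "norm (torus_deriv (F ^^ n) p (P p v)) \<le> C * \<theta> ^ n * norm (stable_part p v)"
        unfolding P by (rule est_s[OF stable_part_mem(1)])
      also have "\<dots> \<le> C * \<theta> ^ n * ((1 + M) * norm v)"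
        using M(2)[of p v] C_pos theta by (intro mult_left_mono) (auto simp: algebra_simps intro: add_increasing)
      finally show ?thesis by (simp add: mult_ac)
    qed
    show "norm (torus_deriv (inv F ^^ n) p (v - P p v)) \<le> C * (1 + M) * \<theta> ^ n * norm v" for n p v
    proof -
      have "norm (torus_deriv (inv F ^^ n) p (v - P p v)) \<le> C * \<theta> ^ n * norm (v - stable_part p v)"
        unfolding P by (rule est_u[OF stable_part_mem(2)])
      also have "norm (v - stable_part p v) \<le> (1 + M) * norm v"
        using M(2)[of p v] norm_triangle_ineq4[of v "stable_part p v"] by (simp add: algebra_simps)
      finally show ?thesis using C_pos theta by (simp add: mult_ac)
    qed
    show "\<exists>s. s \<noteq> 0 \<and> P p s = s" for p
      using stable_nontrivial[of p] stable_part_eqI[of _ p] sub_u unfolding P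
      by (metis cancel_comm_monoid_add_class.diff_cancel subspace_0)
    show "\<exists>u. u \<noteq> 0 \<and> P p u = 0" for p
      using unstable_nontrivial[of p] stable_part_eqI[of 0 p] sub_s unfolding P
      by (metis diff_zero subspace_0)
    show "P p (P p v) = P p v" for p v
      unfolding P using stable_part_mem(1) sub_u by (intro stable_part_eqI) (auto simp: subspace_0)
  qed (use C_pos M theta stable_part_equivariant P in auto)
qed

section \<open>Inhomogeneous equations over hyperbolic cocycles\<close>

instance bcontfun :: (metric_space, banach) banach ..

primrec cocycle :: "('y \<Rightarrow> 'y) \<Rightarrow> ('y \<Rightarrow> 'e::real_normed_vector \<Rightarrow>\<^sub>L 'e) \<Rightarrow> nat \<Rightarrow> 'y \<Rightarrow> 'e \<Rightarrow> 'e" where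
  "cocycle \<sigma> A 0 y v = v"
| "cocycle \<sigma> A (Suc n) y v = A ((\<sigma> ^^ n) y) (cocycle \<sigma> A n y v)"

text \<open>The action of a cocycle on bounded continuous sections: with \<tau> inverse to the base
  map, the value over \<open>\<tau> y\<close> is carried into the fibre over y.\<close>

definition pushforward :: "('y \<Rightarrow> 'y) \<Rightarrow> ('y \<Rightarrow> 'e \<Rightarrow>\<^sub>L 'e) \<Rightarrow> ('y::topological_space \<Rightarrow>\<^sub>C 'e::real_normed_vector) \<Rightarrow> ('y \<Rightarrow>\<^sub>C 'e)" where
  "pushforward \<tau> A u = Bcontfun (\<lambda>y. A (\<tau> y) (u (\<tau> y)))"

context
  fixes \<tau> :: "'y::topological_space \<Rightarrow> 'y" and A :: "'y \<Rightarrow> 'e::real_normed_vector \<Rightarrow>\<^sub>L 'e" and L :: real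
  assumes cont: "continuous_on UNIV \<tau>" "continuous_on UNIV A" and bound: "\<And>y. norm (A y) \<le> L"
begin

lemma pushforward_apply: "pushforward \<tau> A u y = A (\<tau> y) (u (\<tau> y))"
proof -
  have "(\<lambda>y. A (\<tau> y) (u (\<tau> y))) \<in> bcontfun"
  proof (rule bcontfun_normI)
    show "continuous_on UNIV (\<lambda>y. A (\<tau> y) (u (\<tau> y)))"
      by (intro continuous_intros continuous_on_compose2[OF cont(2) cont(1)]
          continuous_on_compose2[OF continuous_on_apply_bcontfun cont(1)]) auto
    show "norm (A (\<tau> y) (u (\<tau> y))) \<le> L * norm u" for y
      using norm_blinfun[of "A (\<tau> y)" "u (\<tau> y)"] bound[of "\<tau> y"] norm_bounded[of u "\<tau> y"]
      by (meson mult_mono norm_ge_zero order_trans)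
  qed
  then show ?thesis
    by (simp add: pushforward_def Bcontfun_inverse)
qed

lemma bounded_linear_pushforward: "bounded_linear (pushforward \<tau> A)"
proof (rule bounded_linear_intro[where K = L])
  show "norm (pushforward \<tau> A u) \<le> norm u * L" for u
  proof (rule norm_bound)
    show "norm (pushforward \<tau> A u y) \<le> norm u * L" for y
      unfolding pushforward_apply
      using norm_blinfun[of "A (\<tau> y)" "u (\<tau> y)"] bound[of "\<tau> y"] norm_bounded[of u "\<tau> y"]
      by (metis mult.commute mult_mono norm_ge_zero order_trans)
  qed
qed (auto intro!: bcontfun_eqI simp: pushforward_apply blinfun.add_right blinfun.scaleR_right)

lemma pushforward_funpow_apply:
  assumes "\<And>y. \<sigma> (\<tau> y) = y"
  shows "(pushforward \<tau> A ^^ n) u y = cocycle \<sigma> A n ((\<tau> ^^ n) y) (u ((\<tau> ^^ n) y))"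
proof -
  have st: "(\<sigma> ^^ n) ((\<tau> ^^ n) y) = y" for n y
    by (induction n arbitrary: y) (auto simp: funpow_swap1 assms)
  show ?thesis
  proof (induction n arbitrary: y)
    case (Suc n)
    have "(\<sigma> ^^ n) ((\<tau> ^^ n) (\<tau> y)) = \<tau> y" by (rule st)
    then show ?case
      by (simp add: pushforward_apply Suc funpow_swap1[of \<tau>])
  qed simp
qed

end

text \<open>The base is left abstract on purpose: it is the torus when the conjugacy is constructed,
  and the discrete integers, parametrising one orbit, when it is shown to be injective.\<close>

locale hyperbolic_cocycle =
  fixes \<sigma> \<tau> :: "'y::metric_space \<Rightarrow> 'y"
    and A A' P :: "'y \<Rightarrow> 'e::banach \<Rightarrow>\<^sub>L 'e" and B \<theta> L :: real
  assumes inverse_base: "\<sigma> (\<tau> y) = y" "\<tau> (\<sigma> y) = y"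
    and cont_base: "continuous_on UNIV \<sigma>" "continuous_on UNIV \<tau>"
    and cont: "continuous_on UNIV A" "continuous_on UNIV A'" "continuous_on UNIV P"
    and bound: "norm (A y) \<le> L" "norm (A' y) \<le> L" "norm (P y) \<le> L"
    and inverse_fibre: "A' (\<sigma> y) (A y v) = v" "A y (A' (\<sigma> y) v) = v"
    and equivariant: "P (\<sigma> y) (A y v) = A y (P y v)"
    and theta: "0 < \<theta>" "\<theta> < 1" and B_pos: "0 < B"
    and stable: "norm (cocycle \<sigma> A n y (P y v)) \<le> B * \<theta> ^ n * norm v"
    and unstable: "norm (cocycle \<tau> A' n y (v - P y v)) \<le> B * \<theta> ^ n * norm v"
begin

abbreviation E where "E \<equiv> pushforward \<tau> A"
abbreviation E' where "E' \<equiv> pushforward \<sigma> A'"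
abbreviation Q where "Q \<equiv> pushforward (\<lambda>y. y) P"

text \<open>Bounds the inverse of 1 - \<open>E\<close>: one geometric series for the stable part and
  one for the unstable part.\<close>

definition \<beta> :: real where "\<beta> = 2 * B / (1 - \<theta>)"

lemma beta_pos: "\<beta> > 0"
  using theta B_pos by (simp add: \<beta>_def)

lemmas E_apply = pushforward_apply[OF cont_base(2) cont(1) bound(1)]
lemmas E'_apply = pushforward_apply[OF cont_base(1) cont(2) bound(2)]
lemmas Q_apply = pushforward_apply[OF continuous_on_id[of UNIV] cont(3) bound(3)]
lemmas E_linear = bounded_linear_pushforward[OF cont_base(2) cont(1) bound(1)]

lemma E_E': "E (E' u) = u" and E'_E: "E' (E u) = u"
proof -
  show "E (E' u) = u"
    by (rule bcontfun_eqI) (simp add: E_apply E'_apply inverse_base, metis inverse_base(1) inverse_fibre(2))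
  show "E' (E u) = u"
    by (rule bcontfun_eqI) (simp add: E_apply E'_apply inverse_base inverse_fibre)
qed

lemma Q_E: "Q (E u) = E (Q u)"
  by (rule bcontfun_eqI) (simp add: E_apply Q_apply, metis inverse_base(1) equivariant)

lemma stable_funpow: "norm ((E ^^ n) (Q u)) \<le> B * \<theta> ^ n * norm u"
proof (rule norm_bound)
  fix y
  let ?z = "(\<tau> ^^ n) y"
  have "(E ^^ n) (Q u) y = cocycle \<sigma> A n ?z (P ?z (u ?z))"
    by (simp add: pushforward_funpow_apply[OF cont_base(2) cont(1) bound(1) inverse_base(1)] Q_apply)
  also have "norm \<dots> \<le> B * \<theta> ^ n * norm (u ?z)"
    by (rule stable)
  also have "\<dots> \<le> B * \<theta> ^ n * norm u"
    using norm_bounded[of u ?z] B_pos theta by (intro mult_left_mono) auto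
  finally show "norm ((E ^^ n) (Q u) y) \<le> B * \<theta> ^ n * norm u" .
qed

lemma unstable_funpow: "norm ((E' ^^ n) (u - Q u)) \<le> B * \<theta> ^ n * norm u"
proof (rule norm_bound)
  fix y
  let ?z = "(\<sigma> ^^ n) y"
  have "(E' ^^ n) (u - Q u) y = cocycle \<tau> A' n ?z (u ?z - P ?z (u ?z))"
    by (simp add: pushforward_funpow_apply[OF cont_base(1) cont(2) bound(2) inverse_base(2)] Q_apply)
  also have "norm \<dots> \<le> B * \<theta> ^ n * norm (u ?z)"
    by (rule unstable)
  also have "\<dots> \<le> B * \<theta> ^ n * norm u"
    using norm_bounded[of u ?z] B_pos theta by (intro mult_left_mono) auto
  finally show "norm ((E' ^^ n) (u - Q u) y) \<le> B * \<theta> ^ n * norm u" .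
qed

lemma geometric_sum_bound:
  fixes f :: "nat \<Rightarrow> 'b::banach"
  assumes "\<And>n. norm (f n) \<le> B * \<theta> ^ n * c" "c \<ge> 0"
  shows "summable f" "norm (suminf f) \<le> B / (1 - \<theta>) * c"
proof -
  have g: "(\<lambda>n. B * \<theta> ^ n * c) sums (B * (1 / (1 - \<theta>)) * c)"
    by (intro sums_mult sums_mult2 geometric_sums) (use theta in auto)
  show s: "summable f"
    by (rule summable_comparison_test'[OF sums_summable[OF g]]) (use assms in auto)
  have sn: "summable (\<lambda>n. norm (f n))"
    by (rule summable_comparison_test'[OF sums_summable[OF g]]) (use assms in auto)
  have "norm (suminf f) \<le> (\<Sum>n. norm (f n))"
    by (rule summable_norm[OF sn])
  also have "\<dots> \<le> (\<Sum>n. B * \<theta> ^ n * c)"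
    by (rule suminf_le[OF _ sn sums_summable[OF g]]) (use assms in auto)
  also have "\<dots> = B / (1 - \<theta>) * c"
    using sums_unique[OF g] by simp
  finally show "norm (suminf f) \<le> B / (1 - \<theta>) * c" .
qed

text \<open>The stable part of a fixed section is itself fixed and decays under forward iteration,
  so it vanishes. What remains is unstable, fixed, and decays under backward iteration.\<close>

lemma homogeneous_solution_zero:
  assumes "v = E v"
  shows "v = 0"
proof -
  have zero: "u = 0" if "\<And>n. norm u \<le> B * \<theta> ^ n * norm v" for u :: "'y \<Rightarrow>\<^sub>C 'e"
  proof -
    have "(\<lambda>n. B * \<theta> ^ n * norm v) \<longlonglongrightarrow> B * 0 * norm v"
      by (intro tendsto_intros LIMSEQ_power_zero) (use theta in auto)
    then have "norm u \<le> 0"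
      using that by (intro tendsto_lowerbound[of _ _ sequentially]) auto
    then show ?thesis by simp
  qed
  have 1: "E (Q v) = Q v" using Q_E[of v] assms by simp
  have "(E ^^ n) (Q v) = Q v" for n
    by (induction n) (simp_all add: 1)
  then have "Q v = 0"
    using zero[of "Q v"] stable_funpow[of _ v] by metis
  have 2: "E' v = v" using E'_E[of v] assms by simp
  have "(E' ^^ n) v = v" for n
    by (induction n) (simp_all add: 2)
  then show "v = 0"
    using zero[of v] unstable_funpow[of _ v] \<open>Q v = 0\<close> by simp
qed

text \<open>The two-sided Neumann series: the stable part of w is summed over forward iterates, the
  unstable part, with a minus sign, over backward iterates.\<close>

lemma inhomogeneous_solution:
  obtains v where "v = E v + w" "norm v \<le> \<beta> * norm w"
proof -
  let ?f = "\<lambda>n. (E ^^ n) (Q w)" and ?g = "\<lambda>n. (E' ^^ n) (w - Q w)"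
  \<comment> \<open>The backward sum starts at exponent one; applying \<open>E\<close> then restores
    the term of exponent zero, which supplies the unstable part of w.\<close>
  let ?h = "\<lambda>n. ?g (Suc n)"
  have f: "summable ?f" "norm (suminf ?f) \<le> B / (1 - \<theta>) * norm w"
    using geometric_sum_bound[of ?f "norm w"] stable_funpow by auto
  have gs: "summable ?g"
    using geometric_sum_bound[of ?g "norm w"] unstable_funpow by auto
  have "norm (?h n) \<le> B * \<theta> ^ n * norm w" for n
  proof -
    have "norm (?h n) \<le> B * \<theta> ^ Suc n * norm w"
      by (rule unstable_funpow)
    also have "\<dots> \<le> B * \<theta> ^ n * norm w"
      using theta B_pos by (intro mult_right_mono mult_left_mono power_decreasing) auto
    finally show ?thesis .
  qed
  then have h: "summable ?h" "norm (suminf ?h) \<le> B / (1 - \<theta>) * norm w"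
    using geometric_sum_bound[of ?h "norm w"] by auto
  have "E (suminf ?f) = (\<Sum>n. E (?f n))"
    by (rule bounded_linear.suminf[OF E_linear f(1)])
  also have "\<dots> = (\<Sum>n. ?f (Suc n))" by simp
  also have "\<dots> = suminf ?f - Q w"
    using suminf_split_head[OF f(1)] by simp
  finally have 1: "E (suminf ?f) = suminf ?f - Q w" .
  have "E (suminf ?h) = (\<Sum>n. E (?h n))"
    by (rule bounded_linear.suminf[OF E_linear h(1)])
  also have "\<dots> = suminf ?g" by (simp add: E_E')
  also have "\<dots> = suminf ?h + (w - Q w)"
    using suminf_split_head[OF gs] by simp
  finally have 2: "E (suminf ?h) = suminf ?h + (w - Q w)" .
  have 3: "E (suminf ?f - suminf ?h) = E (suminf ?f) - E (suminf ?h)"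
    by (rule linear_diff[OF bounded_linear.linear[OF E_linear]])
  have "suminf ?f - suminf ?h = E (suminf ?f - suminf ?h) + w"
    unfolding 3 1 2 by simp
  moreover have "norm (suminf ?f - suminf ?h) \<le> \<beta> * norm w"
    using norm_triangle_ineq4[of "suminf ?f" "suminf ?h"] f(2) h(2) by (simp add: \<beta>_def)
  ultimately show ?thesis using that by blast
qed

lemma inhomogeneous_bound:
  assumes "v = E v + w"
  shows "norm v \<le> \<beta> * norm w"
proof -
  obtain u where u: "u = E u + w" "norm u \<le> \<beta> * norm w"
    by (rule inhomogeneous_solution)
  have "v - u = E v - E u"
    using assms u(1) by (metis add_diff_cancel_right)
  then have "v - u = E (v - u)"
    using linear_diff[OF bounded_linear.linear[OF E_linear]] by metis
  then have "v = u"
    using homogeneous_solution_zero[of "v - u"] by simp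
  with u(2) show ?thesis by simp
qed

text \<open>With the solution operator S of the linear equation, u solves the problem as soon as u =
  S(R u). The hypotheses make this map a contraction by 1/2 of the ball of radius r into
  itself.\<close>

lemma nonlinear_solution:
  fixes R :: "'y \<Rightarrow> 'e \<Rightarrow> 'e"
  assumes r: "r > 0"
    and contR: "\<And>u. norm u \<le> r \<Longrightarrow> continuous_on UNIV (\<lambda>y. R y (apply_bcontfun u y))"
    and small: "\<And>y. \<beta> * norm (R y 0) \<le> r / 2"
    and lip: "\<And>y a b. norm a \<le> r \<Longrightarrow> norm b \<le> r \<Longrightarrow> \<beta> * norm (R y a - R y b) \<le> norm (a - b) / 2"
  obtains u where "norm u \<le> r" "\<And>y. apply_bcontfun u (\<sigma> y) = A y (u y) + R y (u y)"
proof -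
  have "\<exists>v. v = E v + w" for w
    using inhomogeneous_solution by blast
  then have "\<forall>w. \<exists>v. v = E v + w" by blast
  from choice[OF this] obtain S where S: "\<And>w. S w = E (S w) + w"
    by blast
  \<comment> \<open>S is a mere choice of solutions; uniqueness makes it Lipschitz with constant
    \<beta>.\<close>
  have Sdiff: "norm (S w - S w') \<le> \<beta> * norm (w - w')" for w w'
  proof (rule inhomogeneous_bound)
    have "S w - S w' = (E (S w) + w) - (E (S w') + w')"
      using arg_cong2[OF S[of w] S[of w'], of "(-)"] .
    also have "\<dots> = E (S w - S w') + (w - w')"
      unfolding linear_diff[OF bounded_linear.linear[OF E_linear]] by (rule add_diff_add)
    finally show "S w - S w' = E (S w - S w') + (w - w')" .
  qed
  have Snorm: "norm (S w) \<le> \<beta> * norm w" for w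
    by (rule inhomogeneous_bound[OF S])
  have Rb: "\<beta> * norm (R y a) \<le> r" if "norm a \<le> r" for y a
  proof -
    have "\<beta> * norm (R y a) \<le> \<beta> * (norm (R y 0) + norm (R y a - R y 0))"
      using beta_pos by (intro mult_left_mono) (auto intro: norm_triangle_sub)
    also have "\<dots> \<le> r / 2 + norm (a - 0) / 2"
      unfolding distrib_left by (intro add_mono small lip) (use that r in auto)
    finally show ?thesis using that by simp
  qed
  define N where "N u = Bcontfun (\<lambda>y. R (\<tau> y) (apply_bcontfun u (\<tau> y)))" for u
  have N: "apply_bcontfun (N u) y = R (\<tau> y) (apply_bcontfun u (\<tau> y))" if "norm u \<le> r" for u y
  proof -
    have "(\<lambda>y. R (\<tau> y) (apply_bcontfun u (\<tau> y))) \<in> bcontfun"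
    proof (rule bcontfun_normI)
      show "continuous_on UNIV (\<lambda>y. R (\<tau> y) (apply_bcontfun u (\<tau> y)))"
        by (rule continuous_on_compose2[OF contR[OF that] cont_base(2)]) auto
      show "norm (R (\<tau> y) (apply_bcontfun u (\<tau> y))) \<le> r / \<beta>" for y
        using Rb[of "apply_bcontfun u (\<tau> y)" "\<tau> y"] beta_pos norm_bounded[of u "\<tau> y"] that
        by (simp add: field_simps)
    qed
    then show ?thesis by (simp add: N_def Bcontfun_inverse)
  qed
  have "\<exists>!u\<in>cball 0 r. S (N u) = u"
  proof (rule Banach_fix[of _ "1/2"])
    show "Topological_Spaces.complete (cball (0::'y \<Rightarrow>\<^sub>C 'e) r)"
      by (simp add: complete_eq_closed)
    show "(\<lambda>u. S (N u)) ` cball 0 r \<subseteq> cball 0 r"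
    proof clarsimp
      fix u :: "'y \<Rightarrow>\<^sub>C 'e" assume u: "norm u \<le> r"
      have "norm (N u) \<le> r / \<beta>"
      proof (rule norm_bound)
        show "norm (apply_bcontfun (N u) y) \<le> r / \<beta>" for y
          unfolding N[OF u] using Rb[of "apply_bcontfun u (\<tau> y)" "\<tau> y"] beta_pos norm_bounded[of u "\<tau> y"] u
          by (simp add: field_simps)
      qed
      then have "\<beta> * norm (N u) \<le> r"
        using beta_pos by (simp add: field_simps)
      then show "norm (S (N u)) \<le> r"
        using Snorm[of "N u"] by simp
    qed
    fix u v :: "'y \<Rightarrow>\<^sub>C 'e" assume uv: "u \<in> cball 0 r" "v \<in> cball 0 r"
    have "norm (N u - N v) \<le> norm (u - v) / (2 * \<beta>)"
    proof (rule norm_bound)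
      fix y
      let ?a = "apply_bcontfun u (\<tau> y)" and ?b = "apply_bcontfun v (\<tau> y)"
      have "norm ?a \<le> r" "norm ?b \<le> r"
        using uv norm_bounded[of u "\<tau> y"] norm_bounded[of v "\<tau> y"] by auto
      then have "\<beta> * norm (R (\<tau> y) ?a - R (\<tau> y) ?b) \<le> norm (?a - ?b) / 2"
        by (rule lip)
      also have "norm (?a - ?b) \<le> norm (u - v)"
        using norm_bounded[of "u - v" "\<tau> y"] by simp
      finally show "norm (apply_bcontfun (N u - N v) y) \<le> norm (u - v) / (2 * \<beta>)"
        using uv beta_pos by (simp add: N field_simps)
    qed
    then have "\<beta> * norm (N u - N v) \<le> norm (u - v) / 2"
      using beta_pos by (simp add: field_simps)
    then show "dist (S (N u)) (S (N v)) \<le> 1/2 * dist u v"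
      using Sdiff[of "N u" "N v"] by (simp add: dist_norm)
  qed (use r in auto)
  then obtain u where u: "norm u \<le> r" "S (N u) = u" by auto
  have "apply_bcontfun u (\<sigma> y) = A y (u y) + R y (u y)" for y
  proof -
    have "u = E u + N u" using S[of "N u"] unfolding u(2) .
    then have "apply_bcontfun u (\<sigma> y) = apply_bcontfun (E u + N u) (\<sigma> y)" by simp
    also have "\<dots> = A y (u y) + R y (u y)"
      using u(1) by (simp add: E_apply N inverse_base)
    finally show ?thesis .
  qed
  with u(1) show ?thesis using that by blast
qed

text \<open>The defect is treated as the inhomogeneity: the solution bound gives norm d \<le> norm d
  / 2. This is how hyperbolicity expresses expansiveness.\<close>

lemma zero_if_almost_solution:
  assumes "\<And>y. \<beta> * norm (apply_bcontfun d (\<sigma> y) - A y (d y)) \<le> norm (d y) / 2"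
  shows "d = 0"
proof -
  have "norm d \<le> \<beta> * norm (d - E d)"
    by (rule inhomogeneous_bound) simp
  also have "norm (d - E d) \<le> norm d / (2 * \<beta>)"
  proof (rule norm_bound)
    fix y
    have "\<beta> * norm (apply_bcontfun d y - A (\<tau> y) (d (\<tau> y))) \<le> norm d / 2"
      using assms[of "\<tau> y"] norm_bounded[of d "\<tau> y"] by (simp add: inverse_base)
    then show "norm (apply_bcontfun (d - E d) y) \<le> norm d / (2 * \<beta>)"
      using beta_pos by (simp add: E_apply field_simps)
  qed
  finally have "norm d \<le> norm d / 2"
    using beta_pos by simp
  then show ?thesis by simp
qed

end

section \<open>Structural stability\<close>

lemma cocycle_semiconj:
  assumes "\<And>y. \<pi> (\<sigma> y) = \<sigma>' (\<pi> y)"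
  shows "cocycle \<sigma> (\<lambda>y. A (\<pi> y)) n y v = cocycle \<sigma>' A n (\<pi> y) v"
proof -
  have "\<pi> ((\<sigma> ^^ n) y) = (\<sigma>' ^^ n) (\<pi> y)" for n
    by (induction n) (simp_all add: assms)
  then show ?thesis
    by (induction n) simp_all
qed

text \<open>Used with \<pi> the parametrisation of an orbit by the integers.\<close>

lemma (in hyperbolic_cocycle) pullback:
  assumes "\<And>y. \<sigma>' (\<tau>' y) = y" "\<And>y. \<tau>' (\<sigma>' y) = y"
    and "continuous_on UNIV \<sigma>'" "continuous_on UNIV \<tau>'" "continuous_on UNIV \<pi>"
    and semi: "\<And>y. \<pi> (\<sigma>' y) = \<sigma> (\<pi> y)"
  shows "hyperbolic_cocycle \<sigma>' \<tau>' (\<lambda>y. A (\<pi> y)) (\<lambda>y. A' (\<pi> y)) (\<lambda>y. P (\<pi> y)) B \<theta> L"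
proof
  have semi': "\<pi> (\<tau>' y) = \<tau> (\<pi> y)" for y
    using semi[of "\<tau>' y"] assms(1) inverse_base(2) by metis
  show "norm (cocycle \<sigma>' (\<lambda>y. A (\<pi> y)) n y (P (\<pi> y) v)) \<le> B * \<theta> ^ n * norm v" for n y v
    using cocycle_semiconj[of \<pi> \<sigma>' \<sigma> A, OF semi] stable by metis
  show "norm (cocycle \<tau>' (\<lambda>y. A' (\<pi> y)) n y (v - P (\<pi> y) v)) \<le> B * \<theta> ^ n * norm v" for n y v
    using cocycle_semiconj[of \<pi> \<tau>' \<tau> A', OF semi'] unstable by metis
  show "continuous_on UNIV (\<lambda>y. A (\<pi> y))" "continuous_on UNIV (\<lambda>y. A' (\<pi> y))" "continuous_on UNIV (\<lambda>y. P (\<pi> y))"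
    using continuous_on_compose2[OF cont(1) assms(5)] continuous_on_compose2[OF cont(2) assms(5)]
      continuous_on_compose2[OF cont(3) assms(5)] by auto
qed (use assms(1-4) bound theta B_pos in \<open>auto simp: semi inverse_fibre equivariant\<close>)

lemma cocycle_torus_deriv:
  "C1_map F \<Longrightarrow> cocycle F (torus_deriv F) n p v = torus_deriv (F ^^ n) p v"
proof (induction n)
  case (Suc n)
  then show ?case
    unfolding torus_deriv_funpow_Suc[OF Suc.prems] by simp
qed (simp add: torus_deriv_id)

lemma anosov_hyperbolic_cocycle:
  assumes "anosov F"
  obtains P :: "torus \<Rightarrow> (real^2) \<Rightarrow>\<^sub>L (real^2)" and B \<theta> L where
    "hyperbolic_cocycle F (inv F) (torus_deriv F) (torus_deriv (inv F)) P B \<theta> L"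
    "\<And>p. \<exists>s. s \<noteq> 0 \<and> P p s = s" "\<And>p. \<exists>u. u \<noteq> 0 \<and> P p u = 0" "\<And>p v. P p (P p v) = P p v"
proof -
  have d: "C1_diffeo F" using assms by (simp add: anosov_def)
  note D = C1_diffeoD[OF d]
  obtain P :: "torus \<Rightarrow> (real^2) \<Rightarrow>\<^sub>L (real^2)" and B \<theta> where P: "continuous_on UNIV P" "B > 0" "0 < \<theta>" "\<theta> < 1"
    "\<And>p v. P (F p) (torus_deriv F p v) = torus_deriv F p (P p v)"
    "\<And>p v n. norm (torus_deriv (F ^^ n) p (P p v)) \<le> B * \<theta> ^ n * norm v"
    "\<And>p v n. norm (torus_deriv (inv F ^^ n) p (v - P p v)) \<le> B * \<theta> ^ n * norm v"
    "\<And>p. \<exists>s. s \<noteq> 0 \<and> P p s = s" "\<And>p. \<exists>u. u \<noteq> 0 \<and> P p u = 0" "\<And>p v. P p (P p v) = P p v"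
    using anosov_projection[OF assms] by blast
  obtain L1 where L1: "\<And>p. norm (torus_deriv F p) \<le> L1"
    using torus_continuous_bounded[OF C1_map_deriv_continuous[OF D(2)]] by metis
  obtain L2 where L2: "\<And>p. norm (torus_deriv (inv F) p) \<le> L2"
    using torus_continuous_bounded[OF C1_map_deriv_continuous[OF D(3)]] by metis
  obtain L3 where L3: "\<And>p. norm (P p) \<le> L3"
    using torus_continuous_bounded[OF P(1)] by metis
  have "hyperbolic_cocycle F (inv F) (torus_deriv F) (torus_deriv (inv F)) P B \<theta> (max L1 (max L2 L3))"
  proof
    show "norm (torus_deriv F p) \<le> max L1 (max L2 L3)" "norm (torus_deriv (inv F) p) \<le> max L1 (max L2 L3)"
      "norm (P p) \<le> max L1 (max L2 L3)" for p
      using L1[of p] L2[of p] L3[of p] by auto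
  qed (use D P C1_map_continuous C1_map_deriv_continuous in \<open>auto simp: cocycle_torus_deriv\<close>)
  then show ?thesis using that P by blast
qed

definition int_funpow :: "('a \<Rightarrow> 'a) \<Rightarrow> ('a \<Rightarrow> 'a) \<Rightarrow> int \<Rightarrow> 'a \<Rightarrow> 'a" where
  "int_funpow f f' n = (if n \<ge> 0 then f ^^ nat n else f' ^^ nat (- n))"

lemma int_funpow_succ:
  assumes "\<And>x. f (f' x) = x"
  shows "int_funpow f f' (n + 1) x = f (int_funpow f f' n x)"
proof (cases "n \<ge> 0")
  case True
  then have "nat (n + 1) = Suc (nat n)" by simp
  with True show ?thesis by (simp add: int_funpow_def)
next
  case False
  then obtain k where k: "nat (- n) = Suc k" by (cases "nat (- n)") auto
  then have n: "n = - int (Suc k)" using False by linarith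
  have "int_funpow f f' (n + 1) x = (f' ^^ k) x"
    unfolding n by (cases k) (auto simp: int_funpow_def nat_add_distrib)
  moreover have "int_funpow f f' n x = f' ((f' ^^ k) x)"
    using False k by (simp add: int_funpow_def)
  ultimately show ?thesis
    using assms by simp
qed

lemma int_funpow_0: "int_funpow f f' 0 x = x"
  by (simp add: int_funpow_def)

text \<open>Close lifts act identically on the lattice, since the two translation vectors differ by
  less than 1.\<close>

lemma lift_pair_translate:
  assumes "torus_lift F f" "torus_lift G g" "\<And>x. norm (g x - f x) < \<epsilon>" "\<epsilon> \<le> 1/2" "n \<in> int_lattice"
  obtains m where "m \<in> int_lattice" "\<And>x. f (x + n) = f x + m" "\<And>x. g (x + n) = g x + m"
proof -
  obtain m where m: "m \<in> int_lattice" "\<And>x. f (x + n) = f x + m"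
    using torus_lift_translate[OF assms(1,5)] by blast
  obtain k where k: "k \<in> int_lattice" "\<And>x. g (x + n) = g x + k"
    using torus_lift_translate[OF assms(2,5)] by blast
  have "k - m = (g (0 + n) - f (0 + n)) - (g 0 - f 0)"
    unfolding m(2) k(2) by simp
  also have "norm \<dots> \<le> norm (g (0 + n) - f (0 + n)) + norm (g 0 - f 0)"
    by (rule norm_triangle_ineq4)
  also have "\<dots> < 1"
    using assms(3)[of "0 + n"] assms(3)[of 0] assms(4) by linarith
  finally have "k - m = 0"
    by (intro lattice_small_eq_0 int_lattice_diff m k)
  with m k show ?thesis using that by simp
qed

lemma lift_deriv_bound:
  fixes T :: "(real^2) \<Rightarrow>\<^sub>L (real^2)"
  assumes "C1_map G" "torus_lift G g" "\<And>z. z \<in> cball x r \<Longrightarrow> norm (torus_deriv G (proj z) - T) \<le> c"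
    and "norm a \<le> r" "norm b \<le> r"
  shows "norm (g (x + a) - g (x + b) - T (a - b)) \<le> c * norm (a - b)"
proof -
  let ?h = "\<lambda>z. g z - T z"
  have "norm (?h (x + a) - ?h (x + b)) \<le> c * norm ((x + a) - (x + b))"
  proof (rule differentiable_bound[of "cball x r" _ "\<lambda>z. blinfun_apply (torus_deriv G (proj z) - T)"])
    show "(?h has_derivative blinfun_apply (torus_deriv G (proj z) - T)) (at z within cball x r)" for z
      by (rule has_derivative_at_withinI)
        (auto intro!: derivative_eq_intros torus_lift_has_derivative[OF assms(1,2)] simp: blinfun.diff_left)
    show "onorm (blinfun_apply (torus_deriv G (proj z) - T)) \<le> c" if "z \<in> cball x r" for z
      using assms(3)[OF that] by (simp add: norm_blinfun.rep_eq)
  qed (use assms in \<open>auto simp: dist_norm\<close>)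
  moreover have "?h (x + a) - ?h (x + b) = g (x + a) - g (x + b) - T (a - b)"
    by (simp add: blinfun.diff_right blinfun.add_right)
  ultimately show ?thesis by simp
qed

text \<open>Writing a lift of the conjugacy as h x = x + u, the equation h f = g h becomes u(F p) =
  DF(u p) + R p (u p), where R is small and has a small Lipschitz constant. Bounded displacement
  makes h onto. If h x = h y, the orbits of x and y stay close for all positive and negative times,
  and their difference almost solves the linear equation, so it is zero.\<close>

theorem structural_stability:
  assumes "anosov F"
  obtains \<epsilon> where "\<epsilon> > 0" "\<And>G. C1_diffeo G \<Longrightarrow> C1_close \<epsilon> F G \<Longrightarrow>
    \<exists>H H'. homeomorphism UNIV UNIV H H' \<and> (\<forall>p. H (F p) = G (H p))"
proof -
  obtain P B \<theta> L where "hyperbolic_cocycle F (inv F) (torus_deriv F) (torus_deriv (inv F)) P B \<theta> L"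
    using anosov_hyperbolic_cocycle[OF assms] by metis
  then interpret T: hyperbolic_cocycle F "inv F" "torus_deriv F" "torus_deriv (inv F)" P B \<theta> L .
  have dF: "C1_diffeo F" using assms by (simp add: anosov_def)
  note D = C1_diffeoD[OF dF]
  obtain f where f: "torus_lift F f"
    using torus_lift_exists[OF C1_map_continuous[OF D(2)]] .
  obtain f' where f': "torus_lift (inv F) f'" "\<And>x. f' (f x) = x" "\<And>x. f (f' x) = x"
    using torus_lift_inverse[OF D(1) f C1_map_continuous[OF D(3)]] by blast
  let ?\<beta> = T.\<beta>
  note beta_pos = T.beta_pos
  have scaled: "?\<beta> * a \<le> b / 2" if "a \<le> 1 / (2 * ?\<beta>) * b" for a b
    using that beta_pos by (simp add: field_simps)
  obtain r0 where r0: "r0 > 0"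
    "\<And>p q. dist p q < r0 \<Longrightarrow> dist (torus_deriv F p) (torus_deriv F q) < 1 / (4 * ?\<beta>)"
    using torus_continuous_uniform[OF C1_map_deriv_continuous[OF D(2)], of "1 / (4 * ?\<beta>)"] beta_pos by auto
  \<comment> \<open>Two orbits with the same image under h are up to 2 r apart, and this must stay
    within the range where the derivative of F hardly varies.\<close>
  define r where "r = r0 / 3"
  have r: "r > 0" "2 * r < r0" using r0 by (auto simp: r_def)
  \<comment> \<open>The three bounds serve, in order, the choice of a nearby lift of G, the
    Lipschitz constant of the remainder, and its size at zero displacement.\<close>
  define \<epsilon> where "\<epsilon> = min (1/2) (min (1 / (4 * ?\<beta>)) (r / (2 * ?\<beta>)))"
  have eps: "\<epsilon> > 0" "\<epsilon> \<le> 1/2" "\<epsilon> \<le> 1 / (4 * ?\<beta>)" "\<epsilon> \<le> r / (2 * ?\<beta>)"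
    using r beta_pos by (auto simp: \<epsilon>_def)
  show ?thesis
  proof (rule that[OF eps(1)])
    fix G assume dG: "C1_diffeo G" and close: "C1_close \<epsilon> F G"
    note DG = C1_diffeoD[OF dG]
    obtain g where g: "torus_lift G g" "\<And>x. norm (g x - f x) < \<epsilon>"
      using torus_lift_close[OF f C1_map_continuous[OF DG(2)] _ eps(2)] close
      unfolding C1_close_def by metis
    obtain g' where g': "\<And>x. g' (g x) = x"
      using torus_lift_inverse[OF DG(1) g(1) C1_map_continuous[OF DG(3)]] by blast
    \<comment> \<open>Independent of the representative, because f and g shift by the same lattice
      vector.\<close>
    define R where "R p v = g (rep_torus p + v) - f (rep_torus p) - torus_deriv F p v" for p v
    have R: "R (proj x) v = g (x + v) - f x - torus_deriv F (proj x) v" for x v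
    proof -
      define n where "n = rep_torus (proj x) - x"
      have "n \<in> int_lattice" by (simp add: n_def flip: proj_eq_iff)
      then obtain m where m: "\<And>x. f (x + n) = f x + m" "\<And>x. g (x + n) = g x + m"
        using lift_pair_translate[OF f g eps(2)] by blast
      have "rep_torus (proj x) = x + n" by (simp add: n_def)
      moreover have "x + n + v = (x + v) + n" by simp
      ultimately show ?thesis unfolding R_def by (simp only: m) simp
    qed
    have deriv_close: "norm (torus_deriv G (proj z) - torus_deriv F (proj x)) \<le> 1 / (2 * ?\<beta>)"
      if "z \<in> cball x r" for x z
    proof -
      have "dist (proj z) (proj x) < r0"
        using dist_proj_le[of z x] that r by (auto simp: dist_commute)
      then have "norm (torus_deriv F (proj z) - torus_deriv F (proj x)) < 1 / (4 * ?\<beta>)"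
        using r0(2) by (simp add: dist_norm)
      moreover have "norm (torus_deriv F (proj z) - torus_deriv G (proj z)) < 1 / (4 * ?\<beta>)"
        using close eps(3) unfolding C1_close_def by (meson less_le_trans)
      moreover have "norm (torus_deriv G (proj z) - torus_deriv F (proj x)) \<le>
          norm (torus_deriv F (proj z) - torus_deriv G (proj z)) + norm (torus_deriv F (proj z) - torus_deriv F (proj x))"
        using norm_triangle_ineq4[of "torus_deriv F (proj z) - torus_deriv F (proj x)"
            "torus_deriv F (proj z) - torus_deriv G (proj z)"] by simp
      ultimately show ?thesis by (simp add: field_simps)
    qed
    obtain u where u: "norm u \<le> r" "\<And>p. apply_bcontfun u (F p) = torus_deriv F p (u p) + R p (u p)"
    proof (rule T.nonlinear_solution[OF r(1), of R])
      fix u :: "torus \<Rightarrow>\<^sub>C (real^2)"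
      have "continuous_on UNIV (\<lambda>x. apply_bcontfun u (proj x))"
        by (rule continuous_on_compose2[OF continuous_on_apply_bcontfun continuous_on_proj]) auto
      moreover have "continuous_on UNIV (\<lambda>x. torus_deriv F (proj x))"
        using C1_map_deriv_continuous[OF D(2)] by (simp add: continuous_on_torus_iff)
      ultimately show "continuous_on UNIV (\<lambda>p. R p (apply_bcontfun u p))"
        unfolding continuous_on_torus_iff R
        by (intro continuous_intros continuous_on_compose2[OF torus_lift_continuous[OF g(1)]]
            torus_lift_continuous[OF f]) auto
    next
      fix p
      obtain x where x: "p = proj x" by (rule torus_cases)
      have "norm (R p 0) \<le> r / (2 * ?\<beta>)"
        using g(2)[of x] eps(4) by (simp add: x R)
      then show "?\<beta> * norm (R p 0) \<le> r / 2"
        using beta_pos by (simp add: field_simps)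
      fix a b :: "real^2" assume ab: "norm a \<le> r" "norm b \<le> r"
      have "R p a - R p b = g (x + a) - g (x + b) - torus_deriv F (proj x) (a - b)"
        by (simp add: x R blinfun.diff_right)
      also have "norm \<dots> \<le> 1 / (2 * ?\<beta>) * norm (a - b)"
        by (rule lift_deriv_bound[OF DG(2) g(1) deriv_close ab])
      finally show "?\<beta> * norm (R p a - R p b) \<le> norm (a - b) / 2"
        using beta_pos by (simp add: field_simps)
    qed blast
    have ub: "norm (apply_bcontfun u p) \<le> r" for p
      using norm_bounded[of u p] u(1) by simp
    define h where "h x = x + apply_bcontfun u (proj x)" for x
    have h_conj: "h (f x) = g (h x)" for x
      using u(2)[of "proj x"] by (simp add: h_def torus_lift_proj[OF f] R)
    have h_translate: "h (x + n) = h x + n" if "n \<in> int_lattice" for x n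
      by (simp add: h_def proj_add_lattice[OF that])
    have h_cont: "continuous_on S h" for S
    proof -
      have "continuous_on UNIV (\<lambda>x. apply_bcontfun u (proj x))"
        by (rule continuous_on_compose2[OF continuous_on_apply_bcontfun continuous_on_proj]) auto
      then have "continuous_on UNIV h"
        unfolding h_def by (intro continuous_intros)
      then show ?thesis by (rule continuous_on_subset) simp
    qed
    have h_surj: "\<exists>x. h x = y" for y
    proof -
      \<comment> \<open>Brouwer: h moves no point by more than r, so z \<mapsto> y + (z - h z) maps
        this ball to itself.\<close>
      have "\<exists>x\<in>cball y r. h x = y"
      proof (rule brouwer_surjective_cball[OF h_cont r(1), of y "{y}"])
        show "x + (z - h z) \<in> cball y r" if "x \<in> {y}" for x z
          using that ub[of "proj z"] by (simp add: h_def dist_norm)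
      qed simp
      then show ?thesis by blast
    qed
    have h_inj: "x = y" if "h x = h y" for x y
    proof -
      let ?X = "\<lambda>n. int_funpow f f' n x" and ?Y = "\<lambda>n. int_funpow f f' n y"
      note succ = int_funpow_succ[of f f', OF f'(3)]
      \<comment> \<open>Forward by the conjugacy equation, backward by injectivity of g.\<close>
      have eq: "h (?X n) = h (?Y n)" for n
      proof (induction n rule: int_induct[of _ 0])
        case base
        show ?case using that by (simp add: int_funpow_0)
      next
        case (step1 n)
        then show ?case by (simp add: succ h_conj)
      next
        case (step2 n)
        have "g (h (?X (n - 1))) = g (h (?Y (n - 1)))"
          using step2 succ[of "n - 1" x] succ[of "n - 1" y] by (simp flip: h_conj)
        then show ?case using g' by metis
      qed
      have norm_d: "norm (?Y n - ?X n) \<le> 2 * r" for n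
      proof -
        have "?Y n - ?X n = apply_bcontfun u (proj (?X n)) - apply_bcontfun u (proj (?Y n))"
          using eq[of n] unfolding h_def by (simp add: algebra_simps)
        then show ?thesis
          using ub[of "proj (?X n)"] ub[of "proj (?Y n)"] by (metis add_mono mult_2 norm_triangle_le_diff)
      qed
      \<comment> \<open>The integers are given the discrete metric, so that every bounded sequence
        is a bounded continuous section.\<close>
      let ?x = "\<lambda>k. ?X (of_discrete k)" and ?y = "\<lambda>k. ?Y (of_discrete k)"
      let ?s = "\<lambda>k. discrete (of_discrete k + 1)" and ?t = "\<lambda>k. discrete (of_discrete k - 1)"
      have succ': "?x (?s k) = f (?x k)" "?y (?s k) = f (?y k)" for k
        by (simp_all add: discrete_inverse succ)
      have cont: "continuous_on UNIV k" for k :: "int discrete \<Rightarrow> 'b::topological_space"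
        by (simp add: continuous_on_open_vimage open_discrete)
      define d :: "int discrete \<Rightarrow>\<^sub>C (real^2)" where "d = Bcontfun (\<lambda>k. ?y k - ?x k)"
      have d: "apply_bcontfun d k = ?y k - ?x k" for k
        unfolding d_def
        by (subst Bcontfun_inverse) (auto intro!: bcontfun_normI[where b = "2 * r"] norm_d cont)
      interpret Z: hyperbolic_cocycle ?s ?t "\<lambda>k. torus_deriv F (proj (?x k))"
        "\<lambda>k. torus_deriv (inv F) (proj (?x k))" "\<lambda>k. P (proj (?x k))" B \<theta> L
        by (rule T.pullback) (simp_all add: succ torus_lift_proj[OF f] cont discrete_inverse of_discrete_inverse)
      have "d = 0"
      proof (rule Z.zero_if_almost_solution)
        fix k
        have "norm (f (?x k + apply_bcontfun d k) - f (?x k + 0) - torus_deriv F (proj (?x k)) (apply_bcontfun d k - 0))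
            \<le> 1 / (2 * ?\<beta>) * norm (apply_bcontfun d k - 0)"
        proof (rule lift_deriv_bound[OF D(2) f, of _ "2 * r"])
          fix z assume "z \<in> cball (?x k) (2 * r)"
          then have "dist (proj z) (proj (?x k)) < r0"
            using dist_proj_le[of z "?x k"] r by (auto simp: dist_commute)
          then show "norm (torus_deriv F (proj z) - torus_deriv F (proj (?x k))) \<le> 1 / (2 * ?\<beta>)"
            using r0(2)[of "proj z" "proj (?x k)"] beta_pos by (simp add: dist_norm field_simps)
        qed (use norm_d r in \<open>auto simp: d\<close>)
        then have "norm (apply_bcontfun d (?s k) - torus_deriv F (proj (?x k)) (apply_bcontfun d k))
            \<le> 1 / (2 * ?\<beta>) * norm (apply_bcontfun d k)" (is "?N \<le> _ * ?c")
          unfolding d succ' by simp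
        then show "Z.\<beta> * ?N \<le> ?c / 2"
          by (rule scaled)
      qed
      then have "apply_bcontfun d (discrete 0) = 0" by simp
      then show "x = y" by (simp add: d int_funpow_0 discrete_inverse)
    qed
    define H where "H p = proj (h (rep_torus p))" for p
    have H: "H (proj x) = proj (h x)" for x
    proof -
      have "rep_torus (proj x) - x \<in> int_lattice" by (simp flip: proj_eq_iff)
      then have "h (x + (rep_torus (proj x) - x)) = h x + (rep_torus (proj x) - x)"
        by (rule h_translate)
      then show ?thesis
        using proj_add_lattice[OF \<open>rep_torus (proj x) - x \<in> int_lattice\<close>] by (simp add: H_def)
    qed
    have conj: "H (F p) = G (H p)" for p
    proof -
      obtain x where x: "p = proj x" by (rule torus_cases)
      have "H (F p) = H (proj (f x))" by (simp add: x torus_lift_proj[OF f])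
      also have "\<dots> = G (H p)" by (simp add: x H h_conj torus_lift_proj[OF g(1)])
      finally show ?thesis .
    qed
    have "continuous_on UNIV H"
      unfolding continuous_on_torus_iff H
      by (rule continuous_on_compose2[OF continuous_on_proj h_cont]) auto
    moreover have "inj H"
    proof (rule injI)
      fix p q assume pq: "H p = H q"
      obtain x where x: "p = proj x" by (rule torus_cases)
      obtain y where y: "q = proj y" by (rule torus_cases)
      define n where "n = h x - h y"
      have n: "n \<in> int_lattice"
        using pq by (simp add: n_def x y H proj_eq_iff)
      have "h x = h (y + n)"
        by (simp add: h_translate[OF n]) (simp add: n_def)
      then have "x = y + n" by (rule h_inj)
      then show "p = q"
        using proj_add_lattice[OF n] by (simp add: x y)
    qed
    moreover have "range H = UNIV"
    proof -
      have "\<exists>p. H p = q" for q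
        using h_surj surj_proj H by metis
      then show ?thesis by (metis surj_def)
    qed
    ultimately obtain H' where "homeomorphism UNIV UNIV H H'"
      using homeomorphism_compact[OF compact_torus] by metis
    then show "\<exists>H H'. homeomorphism UNIV UNIV H H' \<and> (\<forall>p. H (F p) = G (H p))"
      using conj by blast
  qed
qed

section \<open>Curves in an expanded cone field\<close>

text \<open>The determinant of v and w. Divided by the product of the norms it is the sine of their
  angle, the measure of angles used below.\<close>

definition area :: "real^2 \<Rightarrow> real^2 \<Rightarrow> real" where
  "area v w = v $ 1 * w $ 2 - v $ 2 * w $ 1"

lemma area_add_right: "area v (w + z) = area v w + area v z"
  by (simp add: area_def algebra_simps)

lemma area_self [simp]: "area v v = 0"
  by (simp add: area_def)

lemma norm_power2_real2: "(norm (v :: real^2))\<^sup>2 = (v $ 1)\<^sup>2 + (v $ 2)\<^sup>2"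
  by (simp add: norm_vec_def L2_set_def sum_2)

lemma inner_real2: "(v :: real^2) \<bullet> w = v $ 1 * w $ 1 + v $ 2 * w $ 2"
  by (simp add: inner_vec_def sum_2)

text \<open>Lagrange's identity in the plane.\<close>

lemma area_power2: "(area v w)\<^sup>2 = (norm v)\<^sup>2 * (norm w)\<^sup>2 - (v \<bullet> w)\<^sup>2"
  unfolding norm_power2_real2 inner_real2 area_def by algebra

lemma abs_area_le: "\<bar>area v w\<bar> \<le> norm v * norm w"
proof (rule power2_le_imp_le)
  show "\<bar>area v w\<bar>\<^sup>2 \<le> (norm v * norm w)\<^sup>2"
    using area_power2[of v w] by (simp add: power_mult_distrib)
qed simp

text \<open>The constant factor is the determinant of D; it cancels when two areas are
  compared.\<close>

lemma area_linear:
  fixes D :: "(real^2) \<Rightarrow>\<^sub>L (real^2)"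
  shows "area (D v) (D w) = area (D (axis 1 1)) (D (axis 2 1)) * area v w"
proof -
  have e: "u = u $ 1 *\<^sub>R axis 1 1 + u $ 2 *\<^sub>R axis 2 1" for u :: "real^2"
    by (simp add: vec_eq_iff forall_2 axis_def)
  have D: "D u = u $ 1 *\<^sub>R D (axis 1 1) + u $ 2 *\<^sub>R D (axis 2 1)" for u
    by (subst e) (simp only: blinfun.add_right blinfun.scaleR_right)
  show ?thesis
    by (subst (1) D, subst (2) D) (simp add: area_def algebra_simps)
qed

text \<open>Up to a sign, unit vectors in the plane are no farther apart than twice the sine of
  their angle. Multiplying by both norms avoids division; the sign \<sigma> makes the angle
  acute.\<close>

lemma direction_distance:
  obtains \<sigma> :: real where "\<bar>\<sigma>\<bar> = 1"
    "norm (norm w *\<^sub>R v - \<sigma> *\<^sub>R norm v *\<^sub>R w) \<le> 2 * \<bar>area v w\<bar>"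
proof -
  define \<sigma> :: real where "\<sigma> = (if v \<bullet> w \<ge> 0 then 1 else - 1)"
  let ?m = "norm v * norm w"
  have s: "\<sigma> * (v \<bullet> w) = \<bar>v \<bullet> w\<bar>" "\<sigma> * \<sigma> = 1" by (auto simp: \<sigma>_def)
  have cs: "\<bar>v \<bullet> w\<bar> \<le> ?m" by (rule Cauchy_Schwarz_ineq2)
  let ?u = "norm w *\<^sub>R v - \<sigma> *\<^sub>R norm v *\<^sub>R w"
  have "(norm ?u)\<^sup>2 = ?u \<bullet> ?u"
    by (rule power2_norm_eq_inner)
  also have "\<dots> = (norm w)\<^sup>2 * (v \<bullet> v) + (\<sigma> * \<sigma>) * (norm v)\<^sup>2 * (w \<bullet> w) - 2 * ?m * (\<sigma> * (v \<bullet> w))"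
    by (simp add: inner_diff_left inner_diff_right inner_commute[of w v] power2_eq_square algebra_simps)
  also have "\<dots> = 2 * (?m * (?m - \<bar>v \<bullet> w\<bar>))"
    unfolding s by (simp add: dot_square_norm power2_eq_square algebra_simps)
  \<comment> \<open>Enlarging the first factor completes the difference of squares in Lagrange's
    identity.\<close>
  also have "\<dots> \<le> 2 * ((?m + \<bar>v \<bullet> w\<bar>) * (?m - \<bar>v \<bullet> w\<bar>))"
    using cs by (intro mult_left_mono mult_right_mono) auto
  also have "\<dots> = 2 * (area v w)\<^sup>2"
    unfolding area_power2 by (simp add: power2_eq_square algebra_simps flip: abs_mult)
  also have "\<dots> \<le> (2 * \<bar>area v w\<bar>)\<^sup>2"
    by (simp add: power_mult_distrib)
  finally have "norm (norm w *\<^sub>R v - \<sigma> *\<^sub>R norm v *\<^sub>R w) \<le> 2 * \<bar>area v w\<bar>"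
    by (rule power2_le_imp_le) simp
  moreover have "\<bar>\<sigma>\<bar> = 1" by (simp add: \<sigma>_def)
  ultimately show ?thesis using that by blast
qed

lemma continuous_on_if_lipschitz:
  fixes f :: "'a::real_normed_vector \<Rightarrow> 'b::real_normed_vector"
  assumes "\<And>x y. norm (f x - f y) \<le> L * norm (x - y)" "L \<ge> 0"
  shows "continuous_on S f"
  by (rule lipschitz_on_continuous_on[of L], rule lipschitz_onI) (use assms in \<open>auto simp: dist_norm\<close>)

text \<open>The last assumption replaces an invariant stable bundle for g: a vector s uniformly
  transverse to the cone that is not sent to anything long. It is scaled so that both of its bounds
  have constant 1.\<close>

locale cone_expanding =
  fixes g :: "real^2 \<Rightarrow> real^2" and Dg :: "real^2 \<Rightarrow> (real^2) \<Rightarrow>\<^sub>L (real^2)"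
    and C :: "real^2 \<Rightarrow> (real^2) set" and L \<Lambda> :: real
  assumes deriv: "(g has_derivative blinfun_apply (Dg x)) (at x)"
    and L_pos: "L > 0" and lipschitz: "norm (Dg x - Dg y) \<le> L * norm (x - y)"
    and bound: "norm (Dg x) \<le> \<Lambda>"
    and cone: "v \<in> C x \<Longrightarrow> Dg x v \<in> C (g x)"
    and expand: "v \<in> C x \<Longrightarrow> 2 * norm v \<le> norm (Dg x v)"
    and contracted: "\<exists>s. norm (Dg x s) \<le> 1 \<and> (\<forall>v\<in>C x. norm v \<le> \<bar>area v s\<bar>)"
begin

text \<open>The length scale for bounded distortion. The first bound keeps the sine of the angle
  between tangents below 1/2; in the second, L + 2 \<Lambda> L is the rate of logarithmic distortion
  per unit of distance, and ln 2 turns it into a speed ratio of at most 2.\<close>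

definition small_length :: "real \<Rightarrow> bool" where
  "small_length \<delta> \<longleftrightarrow> 0 < \<delta> \<and> L * \<delta> \<le> 1/2 \<and> (L + 2 * \<Lambda> * L) * \<delta> \<le> ln 2"

lemma Lambda_nonneg: "\<Lambda> \<ge> 0"
  using bound[of 0] norm_ge_zero order_trans by blast

lemma small_length_exists: obtains \<delta> where "small_length \<delta>"
proof -
  define c where "c = L + 2 * \<Lambda> * L"
  have c: "c > 0" using L_pos Lambda_nonneg by (simp add: c_def add_pos_nonneg)
  define \<delta> where "\<delta> = min (1 / (2 * L)) (ln 2 / c)"
  have "\<delta> \<le> 1 / (2 * L)" "\<delta> \<le> ln 2 / c"
    by (simp_all add: \<delta>_def)
  then have "L * \<delta> \<le> 1/2" "c * \<delta> \<le> ln 2"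
    using L_pos c by (simp_all add: field_simps)
  moreover have "\<delta> > 0"
    using L_pos c by (simp add: \<delta>_def)
  ultimately have "small_length \<delta>"
    by (simp add: small_length_def c_def)
  then show ?thesis using that by blast
qed

lemma cont_g: "continuous_on S g"
  using deriv by (meson continuous_at_imp_continuous_on has_derivative_continuous)

lemma cont_Dg: "continuous_on S Dg"
  using continuous_on_if_lipschitz[of Dg L] lipschitz L_pos by simp

text \<open>The area form is contracted relative to the lengths, because the cone is expanded while some
  transverse direction is contracted.\<close>

lemma angle_step:
  assumes v: "v \<in> C x" and w: "w \<in> C y" and xy: "norm (x - y) \<le> \<eta>"
    and vw: "\<bar>area v w\<bar> \<le> L * \<eta> * (norm v * norm w)"
  shows "\<bar>area (Dg x v) (Dg y w)\<bar> \<le> L * (2 * \<eta>) * (norm (Dg x v) * norm (Dg y w))"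
proof (cases "v = 0")
  case False
  let ?v = "Dg x v" and ?w = "Dg y w"
  have eta: "\<eta> \<ge> 0" using xy norm_ge_zero order_trans by blast
  obtain s where s: "norm (Dg x s) \<le> 1" "norm v \<le> \<bar>area v s\<bar>"
    using contracted[of x] v by blast
  \<comment> \<open>Both sides contain the determinant of \<open>Dg x\<close> exactly once; the
    transverse vector s serves to eliminate it.\<close>
  have "\<bar>area ?v (Dg x w)\<bar> * \<bar>area v s\<bar> = \<bar>area v w\<bar> * \<bar>area ?v (Dg x s)\<bar>"
    unfolding area_linear[of "Dg x" v w] area_linear[of "Dg x" v s] by (simp add: abs_mult)
  also have "\<dots> \<le> (L * \<eta> * (norm v * norm w)) * (norm ?v * 1)"
  proof (intro mult_mono vw)
    have "norm ?v * norm (Dg x s) \<le> norm ?v * 1"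
      by (intro mult_left_mono s(1)) simp
    then show "\<bar>area ?v (Dg x s)\<bar> \<le> norm ?v * 1"
      using abs_area_le[of ?v "Dg x s"] by linarith
  qed (use L_pos eta in auto)
  finally have "\<bar>area ?v (Dg x w)\<bar> * \<bar>area v s\<bar> \<le> (L * \<eta> * (norm w * norm ?v)) * norm v"
    by (simp add: mult_ac)
  moreover have "\<bar>area ?v (Dg x w)\<bar> * norm v \<le> \<bar>area ?v (Dg x w)\<bar> * \<bar>area v s\<bar>"
    using s(2) by (intro mult_left_mono) auto
  ultimately have "\<bar>area ?v (Dg x w)\<bar> * norm v \<le> (L * \<eta> * (norm w * norm ?v)) * norm v"
    by linarith
  then have 1: "\<bar>area ?v (Dg x w)\<bar> \<le> L * \<eta> * (norm w * norm ?v)"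
    using False by simp
  have "norm ((Dg y - Dg x) w) \<le> norm (Dg y - Dg x) * norm w"
    by (rule norm_blinfun)
  also have "\<dots> \<le> (L * \<eta>) * norm w"
    using lipschitz[of y x] xy L_pos
    by (intro mult_right_mono) (auto simp: norm_minus_commute intro: order_trans mult_left_mono)
  finally have d: "norm ((Dg y - Dg x) w) \<le> L * \<eta> * norm w" .
  have "\<bar>area ?v ((Dg y - Dg x) w)\<bar> \<le> norm ?v * (L * \<eta> * norm w)"
    using abs_area_le[of ?v "(Dg y - Dg x) w"] mult_left_mono[OF d, of "norm ?v"] by simp
  moreover have "area ?v ?w = area ?v (Dg x w) + area ?v ((Dg y - Dg x) w)"
    unfolding area_add_right[symmetric] by (simp add: blinfun.diff_left)
  ultimately have "\<bar>area ?v ?w\<bar> \<le> L * \<eta> * (norm w * norm ?v) + norm ?v * (L * \<eta> * norm w)"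
    using 1 abs_triangle_ineq[of "area ?v (Dg x w)" "area ?v ((Dg y - Dg x) w)"] by linarith
  also have "\<dots> = L * \<eta> * norm ?v * (2 * norm w)" by simp
  \<comment> \<open>Expansion of w pays for the sum of the two errors: the old angle and the
    variation of the derivative.\<close>
  also have "\<dots> \<le> L * \<eta> * norm ?v * norm ?w"
    using expand[OF w] L_pos eta by (intro mult_left_mono) auto
  also have "\<dots> \<le> L * (2 * \<eta>) * (norm ?v * norm ?w)"
    using L_pos eta by simp
  finally show ?thesis .
qed (simp add: area_def)

text \<open>Replacing v by a multiple of w costs \<Lambda> times twice their area; replacing
  \<open>Dg x\<close> by \<open>Dg y\<close> costs L \<eta>. Together this is a factor 1 + c \<le>
  exp c, where the given ratio is exp c as well; their product is the same bound with \<eta>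
  doubled.\<close>

lemma length_step:
  assumes v: "v \<in> C x" and w: "w \<in> C y" and xy: "norm (x - y) \<le> \<eta>"
    and vw: "\<bar>area v w\<bar> \<le> L * \<eta> * (norm v * norm w)"
    and w0: "w \<noteq> 0" and ratio: "norm v \<le> exp ((L + 2 * \<Lambda> * L) * \<eta>) * norm w"
  shows "norm (Dg x v) \<le> exp ((L + 2 * \<Lambda> * L) * (2 * \<eta>)) * norm (Dg y w)"
proof -
  let ?c = "(L + 2 * \<Lambda> * L) * \<eta>"
  have eta: "\<eta> \<ge> 0" using xy norm_ge_zero order_trans by blast
  have c: "?c \<ge> 0" using L_pos Lambda_nonneg eta by simp
  obtain \<sigma> :: real where \<sigma>: "\<bar>\<sigma>\<bar> = 1"
    "norm (norm w *\<^sub>R v - \<sigma> *\<^sub>R norm v *\<^sub>R w) \<le> 2 * \<bar>area v w\<bar>"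
    by (rule direction_distance)
  have "norm w * norm (Dg x v) = norm (Dg x (norm w *\<^sub>R v))"
    by (simp add: blinfun.scaleR_right)
  also have "norm w *\<^sub>R v = (norm w *\<^sub>R v - \<sigma> *\<^sub>R norm v *\<^sub>R w) + \<sigma> *\<^sub>R norm v *\<^sub>R w"
    by simp
  also have "norm (Dg x \<dots>) \<le> norm (Dg x (norm w *\<^sub>R v - \<sigma> *\<^sub>R norm v *\<^sub>R w)) + norm (Dg x (\<sigma> *\<^sub>R norm v *\<^sub>R w))"
    unfolding blinfun.add_right by (rule norm_triangle_ineq)
  also have "\<dots> \<le> \<Lambda> * (2 * \<bar>area v w\<bar>) + norm v * norm (Dg x w)"
  proof (rule add_mono)
    show "norm (Dg x (norm w *\<^sub>R v - \<sigma> *\<^sub>R norm v *\<^sub>R w)) \<le> \<Lambda> * (2 * \<bar>area v w\<bar>)"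
      using norm_blinfun[of "Dg x" "norm w *\<^sub>R v - \<sigma> *\<^sub>R norm v *\<^sub>R w"] bound[of x] \<sigma>(2) Lambda_nonneg
      by (meson mult_mono norm_ge_zero order_trans)
    show "norm (Dg x (\<sigma> *\<^sub>R norm v *\<^sub>R w)) \<le> norm v * norm (Dg x w)"
      using \<sigma>(1) by (simp add: blinfun.scaleR_right abs_mult)
  qed
  also have "\<dots> \<le> \<Lambda> * (2 * (L * \<eta> * (norm v * norm w))) + norm v * (norm (Dg y w) + L * \<eta> * norm w)"
  proof (intro add_mono mult_left_mono vw)
    have "Dg x w = Dg y w + (Dg x - Dg y) w" by (simp add: blinfun.diff_left)
    then have "norm (Dg x w) \<le> norm (Dg y w) + norm ((Dg x - Dg y) w)"
      by (metis norm_triangle_ineq)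
    also have "norm ((Dg x - Dg y) w) \<le> norm (Dg x - Dg y) * norm w"
      by (rule norm_blinfun)
    also have "norm (Dg x - Dg y) * norm w \<le> (L * \<eta>) * norm w"
      using lipschitz[of x y] xy L_pos
      by (intro mult_right_mono) (auto intro: order_trans mult_left_mono)
    finally show "norm (Dg x w) \<le> norm (Dg y w) + L * \<eta> * norm w" by simp
  qed (use Lambda_nonneg in auto)
  also have "\<dots> = norm v * (norm (Dg y w) + ?c * norm w)"
    by (simp add: algebra_simps)
  also have "\<dots> \<le> norm v * (norm (Dg y w) + ?c * norm (Dg y w))"
    using expand[OF w] c norm_ge_zero[of w] by (intro mult_left_mono add_left_mono) (linarith | simp)+
  also have "\<dots> \<le> (exp ?c * norm w) * (exp ?c * norm (Dg y w))"
  proof (rule mult_mono[OF ratio])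
    have "(1 + ?c) * norm (Dg y w) \<le> exp ?c * norm (Dg y w)"
      by (intro mult_right_mono exp_ge_add_one_self) auto
    then show "norm (Dg y w) + ?c * norm (Dg y w) \<le> exp ?c * norm (Dg y w)"
      by (simp add: algebra_simps)
  qed (use c in auto)
  also have "\<dots> = norm w * (exp ((L + 2 * \<Lambda> * L) * (2 * \<eta>)) * norm (Dg y w))"
  proof -
    have "exp ((L + 2 * \<Lambda> * L) * (2 * \<eta>)) = exp ?c * exp ?c"
      by (simp flip: exp_add add: algebra_simps)
    then show ?thesis by (simp only: mult_ac)
  qed
  finally show ?thesis using w0 by simp
qed

end

text \<open>A straight segment whose fixed direction lies in every cone along it; its images are the
  curves to be studied. Constant initial velocity means no distortion at time zero.\<close>

locale cone_segment = cone_expanding +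
  fixes x\<^sub>0 v\<^sub>0 :: "real^2" and r :: real
  assumes v0: "v\<^sub>0 \<noteq> 0" and r_pos: "r > 0"
    and segment: "\<bar>t\<bar> \<le> r \<Longrightarrow> v\<^sub>0 \<in> C (x\<^sub>0 + t *\<^sub>R v\<^sub>0)"
begin

definition curve :: "nat \<Rightarrow> real \<Rightarrow> real^2" where
  "curve n t = (g ^^ n) (x\<^sub>0 + t *\<^sub>R v\<^sub>0)"

definition velocity :: "nat \<Rightarrow> real \<Rightarrow> real^2" where
  "velocity n t = cocycle g Dg n (x\<^sub>0 + t *\<^sub>R v\<^sub>0) v\<^sub>0"

definition len :: "nat \<Rightarrow> real \<Rightarrow> real \<Rightarrow> real" where
  "len n a b = integral {a..b} (\<lambda>t. norm (velocity n t))"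

lemma curve_Suc: "curve (Suc n) t = g (curve n t)"
  and velocity_Suc: "velocity (Suc n) t = Dg (curve n t) (velocity n t)"
  by (simp_all add: curve_def velocity_def)

lemma velocity_0: "velocity 0 t = v\<^sub>0"
  by (simp add: velocity_def)

lemma curve_deriv: "(curve n has_vector_derivative velocity n t) (at t)"
proof (induction n)
  case 0
  then show ?case
    unfolding curve_def velocity_def
    by (auto simp: has_vector_derivative_def intro!: derivative_eq_intros)
next
  case (Suc n)
  have "((\<lambda>t. g (curve n t)) has_derivative (\<lambda>h. Dg (curve n t) (h *\<^sub>R velocity n t))) (at t)"
    using has_derivative_compose[OF Suc[unfolded has_vector_derivative_def] deriv] .
  then show ?case
    by (simp add: has_vector_derivative_def blinfun.scaleR_right velocity_Suc curve_Suc[abs_def])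
qed

lemma cont_curve: "continuous_on S (curve n)"
  using curve_deriv by (meson continuous_at_imp_continuous_on has_vector_derivative_continuous)

lemma cont_velocity: "continuous_on S (velocity n)"
proof (induction n)
  case 0
  then show ?case by (simp add: velocity_def)
next
  case (Suc n)
  then show ?case
    unfolding velocity_Suc[abs_def]
    by (intro continuous_intros continuous_on_compose2[OF cont_Dg[of UNIV] cont_curve]) auto
qed

lemma velocity_cone: "\<bar>t\<bar> \<le> r \<Longrightarrow> velocity n t \<in> C (curve n t)"
  by (induction n) (use segment cone in \<open>auto simp: velocity_Suc curve_Suc\<close>, simp add: velocity_def curve_def segment)

lemma velocity_growth:
  assumes "\<bar>t\<bar> \<le> r" "k \<le> n"
  shows "2 ^ (n - k) * norm (velocity k t) \<le> norm (velocity n t)"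
  using assms(2)
proof (induction n rule: dec_induct)
  case (step n)
  have "2 * norm (velocity n t) \<le> norm (velocity (Suc n) t)"
    unfolding velocity_Suc by (rule expand[OF velocity_cone[OF assms(1)]])
  with step show ?case by (simp add: Suc_diff_le)
qed simp

lemma velocity_lower: "\<bar>t\<bar> \<le> r \<Longrightarrow> 2 ^ n * norm v\<^sub>0 \<le> norm (velocity n t)"
  using velocity_growth[of t 0 n] by (simp add: velocity_0)

lemma velocity_nonzero: "\<bar>t\<bar> \<le> r \<Longrightarrow> velocity n t \<noteq> 0"
  using velocity_lower[of t n] v0 by (metis norm_zero not_le mult_pos_pos zero_less_norm_iff zero_less_numeral zero_less_power)

lemma speed_integrable: "(\<lambda>t. norm (velocity n t)) integrable_on {a..b}"
  by (intro integrable_continuous_real continuous_intros cont_velocity)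

lemma len_combine: "a \<le> b \<Longrightarrow> b \<le> c \<Longrightarrow> len n a b + len n b c = len n a c"
  unfolding len_def by (intro Henstock_Kurzweil_Integration.integral_combine speed_integrable)

lemma len_nonneg: "len n a b \<ge> 0"
  unfolding len_def by (intro integral_nonneg speed_integrable) auto

lemma len_mono: "a \<le> c \<Longrightarrow> c \<le> d \<Longrightarrow> d \<le> b \<Longrightarrow> len n c d \<le> len n a b"
  using len_combine[of a c b n] len_combine[of c d b n] len_nonneg[of n a c] len_nonneg[of n d b] by simp

lemma curve_dist_le_len:
  assumes "a \<le> b"
  shows "norm (curve n b - curve n a) \<le> len n a b"
proof -
  have "(velocity n has_integral (curve n b - curve n a)) {a..b}"
    using assms curve_deriv
    by (intro fundamental_theorem_of_calculus) (auto intro: has_vector_derivative_at_within)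
  then have "curve n b - curve n a = integral {a..b} (velocity n)"
    by (simp add: integral_unique)
  also have "norm \<dots> \<le> len n a b"
    unfolding len_def
    by (intro integral_norm_bound_integral speed_integrable integrable_continuous_real cont_velocity) auto
  finally show ?thesis .
qed

lemma curve_dist_le:
  assumes "a \<le> s" "s \<le> b" "a \<le> t" "t \<le> b"
  shows "norm (curve n s - curve n t) \<le> len n a b"
proof (cases "s \<le> t")
  case True
  then show ?thesis
    using curve_dist_le_len[OF True, of n] len_mono[of a s t b n] assms by (simp add: norm_minus_commute)
next
  case False
  then show ?thesis
    using curve_dist_le_len[of t s n] len_mono[of a t s b n] assms by simp
qed

lemma len_growth:
  assumes "- r \<le> a" "b \<le> r" "k \<le> n"
  shows "len k a b \<le> len n a b / 2 ^ (n - k)"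
proof -
  have "len k a b \<le> integral {a..b} (\<lambda>t. norm (velocity n t) / 2 ^ (n - k))"
    unfolding len_def
    by (rule integral_le) (use assms velocity_growth in
        \<open>auto intro!: integrable_continuous_real continuous_intros cont_velocity simp: field_simps\<close>)
  then show ?thesis by (simp add: len_def)
qed

text \<open>Lengths at least double at each step, so k steps after the start a piece of final length
  \<delta> has length at most \<delta> / 2^(n - k). This doubling is the one built into
  \<open>angle_step\<close> and \<open>length_step\<close>; both bounds hold trivially at time
  zero.\<close>

lemma distortion:
  assumes ab: "- r \<le> a" "b \<le> r" and len: "len n a b \<le> \<delta>" and \<delta>: "small_length \<delta>"
    and st: "s \<in> {a..b}" "t \<in> {a..b}"
  shows "norm (velocity n t) \<le> 2 * norm (velocity n s)"
    "\<bar>area (velocity n t) (velocity n s)\<bar> \<le> 1/2 * (norm (velocity n t) * norm (velocity n s))"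
proof -
  define \<eta> where "\<eta> k = \<delta> / 2 ^ (n - k)" for k
  have eta_Suc: "\<eta> (Suc k) = 2 * \<eta> k" if "k < n" for k
  proof -
    have "n - k = Suc (n - Suc k)" using that by simp
    then show ?thesis by (simp add: \<eta>_def)
  qed
  have range: "\<bar>s\<bar> \<le> r" "\<bar>t\<bar> \<le> r" using st ab by auto
  have close: "norm (curve k t - curve k s) \<le> \<eta> k" if "k \<le> n" for k
  proof -
    have "norm (curve k t - curve k s) \<le> len k a b"
      using st by (intro curve_dist_le) auto
    also have "\<dots> \<le> len n a b / 2 ^ (n - k)"
      by (rule len_growth[OF ab that])
    also have "\<dots> \<le> \<eta> k"
      unfolding \<eta>_def using len by (intro divide_right_mono) auto
    finally show ?thesis .
  qed
  have "\<eta> 0 \<ge> 0" using \<delta> by (simp add: \<eta>_def small_length_def)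
  have "k \<le> n \<Longrightarrow> \<bar>area (velocity k t) (velocity k s)\<bar> \<le> L * \<eta> k * (norm (velocity k t) * norm (velocity k s))
      \<and> norm (velocity k t) \<le> exp ((L + 2 * \<Lambda> * L) * \<eta> k) * norm (velocity k s)" for k
  proof (induction k)
    case 0
    have "1 * norm v\<^sub>0 \<le> exp ((L + 2 * \<Lambda> * L) * \<eta> 0) * norm v\<^sub>0"
      using \<open>\<eta> 0 \<ge> 0\<close> L_pos Lambda_nonneg by (intro mult_right_mono) auto
    then show ?case using \<open>\<eta> 0 \<ge> 0\<close> L_pos by (simp add: velocity_0)
  next
    case (Suc k)
    then have IH: "\<bar>area (velocity k t) (velocity k s)\<bar> \<le> L * \<eta> k * (norm (velocity k t) * norm (velocity k s))"
      "norm (velocity k t) \<le> exp ((L + 2 * \<Lambda> * L) * \<eta> k) * norm (velocity k s)" and k: "k \<le> n"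
      by auto
    have e: "\<eta> (Suc k) = 2 * \<eta> k" using Suc.prems by (intro eta_Suc) simp
    show ?case
      unfolding e velocity_Suc
      using angle_step[OF velocity_cone[OF range(2)] velocity_cone[OF range(1)] close[OF k] IH(1)]
        length_step[OF velocity_cone[OF range(2)] velocity_cone[OF range(1)] close[OF k] IH(1)
          velocity_nonzero[OF range(1)] IH(2)] by blast
  qed
  from this[of n] have
    1: "\<bar>area (velocity n t) (velocity n s)\<bar> \<le> (L * \<delta>) * (norm (velocity n t) * norm (velocity n s))" and
    2: "norm (velocity n t) \<le> exp ((L + 2 * \<Lambda> * L) * \<delta>) * norm (velocity n s)"
    by (auto simp: \<eta>_def)
  have "exp ((L + 2 * \<Lambda> * L) * \<delta>) \<le> exp (ln 2)"
    using \<delta> by (simp only: exp_le_cancel_iff small_length_def)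
  then have "exp ((L + 2 * \<Lambda> * L) * \<delta>) * norm (velocity n s) \<le> 2 * norm (velocity n s)"
    by (intro mult_right_mono) auto
  with 2 show "norm (velocity n t) \<le> 2 * norm (velocity n s)" by linarith
  have "(L * \<delta>) * (norm (velocity n t) * norm (velocity n s)) \<le> 1/2 * (norm (velocity n t) * norm (velocity n s))"
    using \<delta> by (intro mult_right_mono) (auto simp: small_length_def)
  with 1 show "\<bar>area (velocity n t) (velocity n s)\<bar> \<le> 1/2 * (norm (velocity n t) * norm (velocity n s))"
    by linarith
qed

text \<open>A short image curve is nearly straight: every tangent keeps a definite component, of
  constant sign, along the initial one. Integrating that component bounds the displacement from
  below.\<close>

lemma spread:
  assumes ab: "- r \<le> a" "a \<le> b" "b \<le> r" and len: "len n a b \<le> \<delta>" and \<delta>: "small_length \<delta>"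
  shows "len n a b / 2 \<le> norm (curve n b - curve n a)"
proof -
  let ?e = "velocity n a"
  have e: "?e \<noteq> 0" using ab by (intro velocity_nonzero) auto
  let ?f = "\<lambda>t. velocity n t \<bullet> ?e"
  have low: "norm (velocity n t) * norm ?e / 2 \<le> \<bar>?f t\<bar>" if "t \<in> {a..b}" for t
  proof -
    let ?m = "norm (velocity n t) * norm ?e"
    have "\<bar>area (velocity n t) ?e\<bar> \<le> 1/2 * ?m"
      using distortion(2)[OF ab(1,3) len \<delta> _ that, of a] ab by simp
    then have "(area (velocity n t) ?e)\<^sup>2 \<le> (1/2 * ?m)\<^sup>2"
      by (rule abs_le_square_iff[THEN iffD1, OF order_trans]) simp
    then have "?m\<^sup>2 - (?f t)\<^sup>2 \<le> ?m\<^sup>2 / 4"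
      unfolding area_power2 by (simp add: power_mult_distrib power_divide)
    moreover have "?m\<^sup>2 \<ge> 0" by simp
    moreover have "(?m / 2)\<^sup>2 = ?m\<^sup>2 / 4" by (simp add: power_divide)
    ultimately have "(?m / 2)\<^sup>2 \<le> (?f t)\<^sup>2" by linarith
    then show ?thesis
      using abs_le_square_iff[of "?m / 2" "?f t"] by simp
  qed
  \<comment> \<open>A change of sign would pass through a tangent orthogonal to the initial one,
    against the lower bound just obtained.\<close>
  have pos: "?f t > 0" if t: "t \<in> {a..b}" for t
  proof (rule ccontr)
    assume "\<not> ?thesis"
    moreover have "?f a > 0" using e by simp
    ultimately obtain u where u: "a \<le> u" "u \<le> t" "?f u = 0"
      using IVT2'[of ?f t 0 a] t by (force intro: continuous_intros cont_velocity)
    have "norm (velocity n u) > 0" using u t ab by (simp add: velocity_nonzero)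
    then show False using low[of u] u t e by (simp add: mult_le_0_iff)
  qed
  have int: "(velocity n has_integral (curve n b - curve n a)) {a..b}"
    using ab curve_deriv
    by (intro fundamental_theorem_of_calculus) (auto intro: has_vector_derivative_at_within)
  have i1: "(?f has_integral ((curve n b - curve n a) \<bullet> ?e)) {a..b}"
    by (rule has_integral_linear[OF int bounded_linear_inner_left, unfolded o_def])
  have i2: "((\<lambda>t. norm (velocity n t) * norm ?e / 2) has_integral (len n a b * norm ?e / 2)) {a..b}"
    unfolding len_def
    by (intro has_integral_divide has_integral_mult_left integrable_integral speed_integrable)
  have "norm (velocity n t) * norm ?e / 2 \<le> ?f t" if "t \<in> {a..b}" for t
    using low[OF that] pos[OF that] by simp
  then have "len n a b * norm ?e / 2 \<le> (curve n b - curve n a) \<bullet> ?e"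
    by (rule has_integral_le[OF i2 i1])
  also have "\<dots> \<le> norm (curve n b - curve n a) * norm ?e"
    by (rule norm_cauchy_schwarz)
  finally show ?thesis using e by simp
qed

text \<open>If the complement of T were smaller than claimed, every parameter would be so close to T
  that, at the speed allowed by bounded distortion, the whole image curve would lie within \<rho> of
  W. Being connected, it would have endpoints less than \<delta>/4 apart, against
  \<open>spread\<close>.\<close>

lemma gap_proportion:
  assumes ab: "- r \<le> a" "a < b" "b \<le> r" and len: "\<delta> / 2 \<le> len n a b" "len n a b \<le> \<delta>"
    and \<delta>: "small_length \<delta>"
    and T: "closed T" "\<And>t. t \<in> T \<Longrightarrow> curve n t \<in> W"
    and W: "\<And>S x y. connected S \<Longrightarrow> (\<And>z. z \<in> S \<Longrightarrow> \<exists>w\<in>W. dist z w < \<rho>) \<Longrightarrow> x \<in> S \<Longrightarrow> y \<in> S \<Longrightarrow> dist x y < \<delta> / 4"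
    and \<kappa>: "0 < \<kappa>" "\<kappa> \<le> 1" "2 * \<delta> * \<kappa> < \<rho>"
  shows "\<kappa> * (b - a) \<le> measure lebesgue ({a..b} - T)"
proof (rule ccontr)
  assume neg: "\<not> ?thesis"
  define h where "h = \<kappa> * (b - a)"
  have h: "0 < h" "h \<le> b - a"
    using ab \<kappa> mult_right_mono[OF \<kappa>(2), of "b - a"] by (auto simp: h_def)
  have near: "\<exists>s\<in>T. s \<in> {a..b} \<and> \<bar>t - s\<bar> \<le> h" if t: "t \<in> {a..b}" for t
  proof (rule ccontr)
    assume no: "\<not> ?thesis"
    \<comment> \<open>A window of length h that contains t, fits into the interval, and misses
      T.\<close>
    define l where "l = min t (b - h)"
    have l: "a \<le> l" "l + h \<le> b" "l \<le> t" "t \<le> l + h"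
      using t h by (auto simp: l_def)
    have "{l..l + h} \<subseteq> {a..b} - T"
      using no l by (force simp: abs_le_iff)
    then have "measure lebesgue {l..l + h} \<le> measure lebesgue ({a..b} - T)"
      using T(1) by (intro measure_mono_fmeasurable fmeasurable_Diff) (auto intro: borel_closed)
    then show False
      using neg h by (simp add: h_def)
  qed
  \<comment> \<open>The average speed is at most \<delta> / (b - a), and no speed exceeds twice any
    other.\<close>
  have fast: "norm (velocity n u) * (b - a) \<le> 2 * \<delta>" if u: "u \<in> {a..b}" for u
  proof -
    have "integral {a..b} (\<lambda>t. norm (velocity n u) / 2) \<le> len n a b"
      unfolding len_def
      by (intro integral_le speed_integrable integrable_const_ivl)
        (use distortion(1)[OF ab(1,3) len(2) \<delta> _ u] in \<open>force simp: field_simps\<close>)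
    then show ?thesis using ab len(2) by (simp add: field_simps)
  qed
  have step: "norm (curve n t - curve n s) < \<rho>" if "s \<in> {a..b}" "t \<in> {a..b}" "\<bar>t - s\<bar> \<le> h" for s t
  proof -
    have "norm (curve n t - curve n s) \<le> 2 * \<delta> / (b - a) * norm (t - s)"
    proof (rule differentiable_bound[of "{a..b}" _ "\<lambda>u h. h *\<^sub>R velocity n u"])
      fix u assume u: "u \<in> {a..b}"
      show "(curve n has_derivative (\<lambda>h. h *\<^sub>R velocity n u)) (at u within {a..b})"
        using curve_deriv has_derivative_at_withinI unfolding has_vector_derivative_def by blast
      show "onorm (\<lambda>h. h *\<^sub>R velocity n u) \<le> 2 * \<delta> / (b - a)"
      proof (rule onorm_bound)
        have v: "norm (velocity n u) \<le> 2 * \<delta> / (b - a)"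
          using fast[OF u] ab by (simp add: field_simps)
        then show "norm (h *\<^sub>R velocity n u) \<le> 2 * \<delta> / (b - a) * norm h" for h :: real
          using mult_left_mono[OF v, of "\<bar>h\<bar>"] by (simp add: mult.commute)
        show "0 \<le> 2 * \<delta> / (b - a)"
          using v norm_ge_zero order_trans by blast
      qed
    qed (use that in auto)
    also have "\<dots> \<le> 2 * \<delta> / (b - a) * h"
      using that ab \<delta> by (intro mult_left_mono) (auto simp: small_length_def)
    also have "\<dots> = 2 * \<delta> * \<kappa>"
      using ab by (simp add: h_def)
    finally show ?thesis using \<kappa> by simp
  qed
  have "dist (curve n b) (curve n a) < \<delta> / 4"
  proof (rule W[of "curve n ` {a..b}"])
    show "connected (curve n ` {a..b})"
      by (intro connected_continuous_image cont_curve connected_Icc)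
    fix z assume "z \<in> curve n ` {a..b}"
    then obtain t where t: "t \<in> {a..b}" "z = curve n t" by blast
    then obtain s where s: "s \<in> T" "s \<in> {a..b}" "\<bar>t - s\<bar> \<le> h" using near by blast
    then show "\<exists>w\<in>W. dist z w < \<rho>"
      using step[OF s(2) t(1) s(3)] T(2) t(2) by (auto simp: dist_norm)
  qed (use ab in auto)
  moreover have "len n a b / 2 \<le> norm (curve n b - curve n a)"
    using ab by (intro spread[OF _ _ _ len(2) \<delta>]) auto
  ultimately show False using len(1) by (simp add: dist_norm)
qed

lemma len_continuous: "continuous_on {a..b} (\<lambda>c. len n a c)"
  unfolding len_def by (rule indefinite_integral_continuous_1[OF speed_integrable])

lemma len_lower:
  assumes "- r \<le> a" "a \<le> b" "b \<le> r"
  shows "2 ^ n * norm v\<^sub>0 * (b - a) \<le> len n a b"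
proof -
  have "integral {a..b} (\<lambda>t. 2 ^ n * norm v\<^sub>0) \<le> len n a b"
    unfolding len_def
    by (intro integral_le speed_integrable integrable_const_ivl) (use assms velocity_lower in auto)
  then show ?thesis using assms by (simp add: mult_ac)
qed

text \<open>A substitute for the density theorem. Cut the n-th image curve into pieces of length
  about \<delta>: each piece that meets the closed set T also contains a fixed proportion of gaps.
  So the neighbourhoods \<open>N n\<close> exceed T by at least \<kappa> times its measure, although
  they shrink to T.\<close>

theorem segment_null:
  assumes \<delta>: "small_length \<delta>" and \<rho>: "\<rho> > 0"
    and W: "\<And>S x y. connected S \<Longrightarrow> (\<And>z. z \<in> S \<Longrightarrow> \<exists>w\<in>W. dist z w < \<rho>) \<Longrightarrow> x \<in> S \<Longrightarrow> y \<in> S \<Longrightarrow> dist x y < \<delta> / 4"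
    and closed_W: "closed W"
  shows "negligible {t \<in> {- r..r}. \<forall>n. curve n t \<in> W}"
proof -
  define T where "T = {t \<in> {- r..r}. \<forall>n. curve n t \<in> W}"
  have "T = {- r..r} \<inter> (\<Inter>n. curve n -` W)" by (auto simp: T_def)
  moreover have "closed ({- r..r} \<inter> (\<Inter>n. curve n -` W))"
    by (intro closed_Int closed_atLeastAtMost closed_INT ballI continuous_closed_vimage closed_W)
      (use cont_curve[of UNIV] in \<open>auto simp: continuous_on_eq_continuous_at\<close>)
  ultimately have T: "closed T" "T \<subseteq> {- r..r}" by (auto simp: T_def)
  have \<delta>_pos: "\<delta> > 0" using \<delta> by (simp add: small_length_def)
  define \<kappa> where "\<kappa> = min 1 (\<rho> / (4 * \<delta>))"
  have "2 * \<delta> * \<kappa> \<le> 2 * \<delta> * (\<rho> / (4 * \<delta>))"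
    using \<delta>_pos by (intro mult_left_mono) (auto simp: \<kappa>_def)
  then have \<kappa>: "0 < \<kappa>" "\<kappa> \<le> 1" "2 * \<delta> * \<kappa> < \<rho>"
    using \<delta>_pos \<rho> by (auto simp: \<kappa>_def)
  have T_fm: "T \<in> lmeasurable"
    using T by (intro bounded_set_imp_lmeasurable) (auto intro: bounded_subset[OF bounded_closed_interval] borel_closed)
  show ?thesis
  proof (cases "T = {}")
    case True
    show ?thesis unfolding T_def[symmetric] True by simp
  next
    case nonempty: False
    \<comment> \<open>The radius is the largest parameter width of a piece whose n-th image has
      length \<delta>; a piece that meets T therefore lies inside \<open>N n\<close>.\<close>
    define N where "N n = {t \<in> {- r..r}. infdist t T \<le> \<delta> / (2 ^ n * norm v\<^sub>0)}" for n
    have N_closed: "closed (N n)" for n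
    proof -
      have "N n = {- r..r} \<inter> {t. infdist t T \<le> \<delta> / (2 ^ n * norm v\<^sub>0)}" by (auto simp: N_def)
      then show ?thesis
        by (auto intro!: closed_Int closed_Collect_le continuous_intros)
    qed
    have N_fm: "N n \<in> lmeasurable" for n
      using N_closed by (intro bounded_set_imp_lmeasurable)
        (auto intro: bounded_subset[of "{- r..r}"] borel_closed simp: N_def)
    have T_N: "T \<subseteq> N n" for n
      using T \<delta>_pos by (auto simp: N_def)
    have key: "\<kappa> * measure lebesgue T \<le> measure lebesgue (N n - T)" if large: "\<delta> \<le> len n (- r) r" for n
    proof -
      \<comment> \<open>Number of pieces of equal length. Since the total length is at least
        \<delta>, rounding up at most doubles the quotient, which keeps each piece between
        \<delta>/2 and \<delta>.\<close>
      define k where "k = nat \<lceil>len n (- r) r / \<delta>\<rceil>"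
      define \<epsilon> where "\<epsilon> = len n (- r) r / k"
      have x1: "len n (- r) r / \<delta> \<ge> 1" using large \<delta>_pos by simp
      then have k: "k \<ge> 1" "len n (- r) r / \<delta> \<le> k" "k \<le> 2 * (len n (- r) r / \<delta>)"
        unfolding k_def by linarith+
      have \<epsilon>: "\<delta> / 2 \<le> \<epsilon>" "\<epsilon> \<le> \<delta>" "k * \<epsilon> = len n (- r) r"
        using k \<delta>_pos by (simp_all add: \<epsilon>_def field_simps)
      \<comment> \<open>Induction on the number j of pieces to the left of c; the intermediate value
        theorem finds the preceding cut.\<close>
      have "\<kappa> * measure lebesgue (T \<inter> {- r..c}) \<le> measure lebesgue ((N n - T) \<inter> {- r..c})"
        if "- r \<le> c" "c \<le> r" "len n (- r) c = j * \<epsilon>" for c and j :: nat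
        using that
      proof (induction j arbitrary: c)
        case 0
        have "2 ^ n * norm v\<^sub>0 * (c - (- r)) \<le> 0"
          using len_lower[of "- r" c n] 0 by simp
        moreover have "2 ^ n * norm v\<^sub>0 > 0" using v0 by simp
        ultimately have "c - (- r) \<le> 0" by (metis mult_pos_pos not_le)
        then have "c = - r" using 0 by simp
        then have "T \<inter> {- r..c} \<subseteq> {- r}" by auto
        then have "negligible (T \<inter> {- r..c})"
          using negligible_subset negligible_sing by blast
        then show ?case by (simp add: negligible_imp_measure0)
      next
        case (Suc j)
        have le: "0 \<le> j * \<epsilon>" "j * \<epsilon> \<le> len n (- r) c"
          using Suc.prems \<epsilon> \<delta>_pos by (auto simp: algebra_simps)
        have "len n (- r) (- r) = 0" by (simp add: len_def)
        then obtain b where b: "- r \<le> b" "b \<le> c" "len n (- r) b = j * \<epsilon>"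
          using IVT'[of "len n (- r)" "- r" "j * \<epsilon>" c] le Suc.prems len_continuous by auto
        have bc: "len n b c = \<epsilon>"
          using len_combine[of "- r" b c n] b Suc.prems by (simp add: algebra_simps)
        have "b \<noteq> c" using b Suc.prems \<epsilon> \<delta>_pos by (auto simp: algebra_simps)
        then have "b < c" using b by simp
        have split: "measure lebesgue (S \<inter> {- r..c}) = measure lebesgue (S \<inter> {- r..b}) + measure lebesgue (S \<inter> {b..c})"
          if "S \<in> lmeasurable" for S
        proof -
          have "S \<inter> {- r..c} = (S \<inter> {- r..b}) \<union> (S \<inter> {b..c})"
            using b by auto
          moreover have "negligible ((S \<inter> {- r..b}) \<inter> (S \<inter> {b..c}))"
            by (rule negligible_subset[OF negligible_sing[of b]]) auto
          ultimately show ?thesis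
            using measure_Un3[of "S \<inter> {- r..b}" lebesgue "S \<inter> {b..c}"] that
            by (simp add: fmeasurable_Int_fmeasurable negligible_imp_measure0)
        qed
        have "\<kappa> * measure lebesgue (T \<inter> {b..c}) \<le> measure lebesgue ((N n - T) \<inter> {b..c})"
        proof (cases "T \<inter> {b..c} = {}")
          case False
          then obtain s where s: "s \<in> T" "s \<in> {b..c}" by blast
          have "2 ^ n * norm v\<^sub>0 * (c - b) \<le> \<delta>"
            using len_lower[of b c n] b Suc.prems bc \<epsilon> by auto
          then have w: "c - b \<le> \<delta> / (2 ^ n * norm v\<^sub>0)"
            using v0 by (simp add: field_simps)
          have "t \<in> N n" if t: "t \<in> {b..c}" for t
          proof -
            have "infdist t T \<le> dist t s" by (rule infdist_le[OF s(1)])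
            also have "\<dots> \<le> c - b" using s t by (auto simp: dist_real_def)
            finally show ?thesis using w t b Suc.prems by (auto simp: N_def)
          qed
          then have "(N n - T) \<inter> {b..c} = {b..c} - T" by auto
          moreover have "\<kappa> * (c - b) \<le> measure lebesgue ({b..c} - T)"
          proof (rule gap_proportion[where W = W and n = n, OF _ \<open>b < c\<close> _ _ _ \<delta> T(1) _ _ \<kappa>])
            show "dist x y < \<delta> / 4"
              if "connected S" "\<And>z. z \<in> S \<Longrightarrow> \<exists>w\<in>W. dist z w < \<rho>" "x \<in> S" "y \<in> S" for S x y
              using W that by blast
          qed (use b Suc.prems bc \<epsilon> in \<open>auto simp: T_def\<close>)
          moreover have "measure lebesgue (T \<inter> {b..c}) \<le> measure lebesgue {b..c}"
            using T_fm by (intro measure_mono_fmeasurable) (auto intro: fmeasurable_Int_fmeasurable)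
          then have "\<kappa> * measure lebesgue (T \<inter> {b..c}) \<le> \<kappa> * (c - b)"
            using \<open>b < c\<close> \<kappa>(1) by (intro mult_left_mono) auto
          ultimately show ?thesis by simp
        qed (simp add: measure_nonneg)
        moreover have "\<kappa> * measure lebesgue (T \<inter> {- r..b}) \<le> measure lebesgue ((N n - T) \<inter> {- r..b})"
          using Suc b by auto
        ultimately show ?case
          using split[OF T_fm] split[of "N n - T"] N_fm T_fm by (simp add: fmeasurable_Diff fmeasurableD distrib_left)
      qed
      from this[of r k] have "\<kappa> * measure lebesgue (T \<inter> {- r..r}) \<le> measure lebesgue ((N n - T) \<inter> {- r..r})"
        using r_pos \<epsilon>(3) by simp
      moreover have "T \<inter> {- r..r} = T" "(N n - T) \<inter> {- r..r} = N n - T"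
        using T by (auto simp: N_def)
      ultimately show ?thesis by simp
    qed
    have "(\<lambda>n. measure lebesgue (N n)) \<longlonglongrightarrow> measure lebesgue (\<Inter>n. N n)"
    proof (rule Lim_measure_decseq)
      show "range N \<subseteq> sets lebesgue" using N_fm by (auto simp: fmeasurableD)
      show "decseq N"
      proof (unfold decseq_def, intro allI impI subsetI)
        fix m n :: nat and t assume mn: "m \<le> n" and t: "t \<in> N n"
        have "\<delta> / (2 ^ n * norm v\<^sub>0) \<le> \<delta> / (2 ^ m * norm v\<^sub>0)"
          using \<delta>_pos v0 mn by (intro divide_left_mono mult_right_mono power_increasing mult_pos_pos) auto
        then show "t \<in> N m" using t by (auto simp: N_def)
      qed
      show "emeasure lebesgue (N n) \<noteq> \<infinity>" for n
        using fmeasurableD2[OF N_fm[of n]] by simp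
    qed
    moreover have "(\<Inter>n. N n) = T"
    proof
      show "T \<subseteq> (\<Inter>n. N n)" using T_N by blast
      show "(\<Inter>n. N n) \<subseteq> T"
      proof
        fix t assume t: "t \<in> (\<Inter>n. N n)"
        have "(\<lambda>n. \<delta> / norm v\<^sub>0 * (1/2) ^ n) \<longlonglongrightarrow> \<delta> / norm v\<^sub>0 * 0"
          by (intro tendsto_intros LIMSEQ_power_zero) simp
        moreover have "infdist t T \<le> \<delta> / norm v\<^sub>0 * (1/2) ^ n" for n
          using t by (auto simp: N_def power_divide mult.commute)
        ultimately have "infdist t T \<le> 0"
          by (intro tendsto_lowerbound[of _ _ sequentially]) auto
        then show "t \<in> T"
          using in_closed_iff_infdist_zero[OF T(1) nonempty] infdist_nonneg[of t T] by simp
      qed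
    qed
    ultimately have "(\<lambda>n. measure lebesgue (N n) - measure lebesgue T) \<longlonglongrightarrow> measure lebesgue T - measure lebesgue T"
      by (intro tendsto_intros) simp
    moreover have "\<forall>\<^sub>F n in sequentially. \<kappa> * measure lebesgue T \<le> measure lebesgue (N n) - measure lebesgue T"
    proof -
      obtain m where "\<delta> / (norm v\<^sub>0 * (2 * r)) < 2 ^ m"
        using real_arch_pow[of 2] by auto
      then have m: "\<delta> < 2 ^ m * (norm v\<^sub>0 * (2 * r))"
        using v0 r_pos by (simp add: field_simps)
      have "\<delta> \<le> 2 ^ n * (norm v\<^sub>0 * (2 * r))" if "m \<le> n" for n
      proof -
        have "(2::real) ^ m * (norm v\<^sub>0 * (2 * r)) \<le> 2 ^ n * (norm v\<^sub>0 * (2 * r))"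
          using that r_pos by (intro mult_right_mono power_increasing) auto
        with m show ?thesis by linarith
      qed
      then have "\<forall>\<^sub>F n in sequentially. \<delta> \<le> 2 ^ n * (norm v\<^sub>0 * (2 * r))"
        by (rule eventually_sequentiallyI)
      then show ?thesis
      proof eventually_elim
        case (elim n)
        then have "\<delta> \<le> len n (- r) r"
          using len_lower[of "- r" r n] r_pos by (simp add: algebra_simps)
        then show ?case
          using key[of n] measurable_measure_Diff[of "N n" lebesgue T] N_fm T_fm T_N
          by (simp add: fmeasurableD)
      qed
    qed
    ultimately have "\<kappa> * measure lebesgue T \<le> 0"
      by (intro tendsto_lowerbound[of _ _ sequentially]) auto
    then have "measure lebesgue T = 0"
      using \<kappa>(1) measure_nonneg[of lebesgue T] by (simp add: mult_le_0_iff)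
    then have "negligible T"
      using T_fm by (simp add: negligible_iff_measure)
    then show ?thesis by (simp add: T_def)
  qed
qed

end

text \<open>Near each point a constant direction lies in all the cones. Foliating a small square by
  segments in that direction, each slice of the trapped set is null, so the square meets the trapped
  set in a null set.\<close>

theorem (in cone_expanding) trapped_negligible:
  assumes \<delta>: "small_length \<delta>" and \<rho>: "\<rho> > 0"
    and W: "\<And>S x y. connected S \<Longrightarrow> (\<And>z. z \<in> S \<Longrightarrow> \<exists>w\<in>W. dist z w < \<rho>) \<Longrightarrow> x \<in> S \<Longrightarrow> y \<in> S \<Longrightarrow> dist x y < \<delta> / 4"
    and closed_W: "closed W"
    and cone_locally_constant: "\<And>z. \<exists>v r. v \<noteq> 0 \<and> r > 0 \<and> (\<forall>y\<in>ball z r. v \<in> C y)"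
  shows "negligible {x. \<forall>n. (g ^^ n) x \<in> W}"
proof -
  define \<Omega> where "\<Omega> = {x. \<forall>n. (g ^^ n) x \<in> W}"
  have cont: "continuous_on UNIV (g ^^ n)" for n
  proof (induction n)
    case (Suc n)
    then show ?case
      using continuous_on_compose2[OF cont_g[of UNIV] Suc] by (simp add: o_def)
  qed (simp add: continuous_on_id[unfolded id_def] id_def)
  have "closed (\<Inter>n. (g ^^ n) -` W)"
    using closed_W cont by (intro closed_INT ballI continuous_closed_vimage) (auto simp: continuous_on_eq_continuous_at)
  moreover have "\<Omega> = (\<Inter>n. (g ^^ n) -` W)" by (auto simp: \<Omega>_def)
  ultimately have closed_\<Omega>: "closed \<Omega>" by simp
  have "\<exists>U. openin (top_of_set \<Omega>) U \<and> z \<in> U \<and> negligible U" if "z \<in> \<Omega>" for z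
  proof -
    obtain v r0 where v: "v \<noteq> 0" "r0 > 0" "\<And>y. y \<in> ball z r0 \<Longrightarrow> v \<in> C y"
      using cone_locally_constant[of z] by blast
    \<comment> \<open>v turned by a right angle, so that \<Phi> below is a similarity and its
      coordinates are inner products.\<close>
    define w :: "real^2" where "w = (\<chi> i. if i = 1 then - v $ 2 else v $ 1)"
    have w: "w $ 1 = - v $ 2" "w $ 2 = v $ 1" by (simp_all add: w_def)
    have nw: "norm w = norm v"
    proof -
      have "(norm w)\<^sup>2 = (norm v)\<^sup>2" by (simp add: norm_power2_real2 w)
      then show ?thesis by simp
    qed
    \<comment> \<open>Keeps the whole coordinate square inside the ball where v lies in the
      cones.\<close>
    define r where "r = r0 / (3 * norm v)"
    have r: "r > 0" "2 * r * norm v < r0"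
      using v by (auto simp: r_def field_simps)
    define \<Phi> :: "real \<times> real \<Rightarrow> real^2" where "\<Phi> q = z + fst q *\<^sub>R w + snd q *\<^sub>R v" for q
    define S where "S = {- r..r} \<times> {- r..r} \<inter> \<Phi> -` \<Omega>"
    have contS: "closed S"
      unfolding S_def \<Phi>_def
      by (intro closed_Int closed_Times closed_atLeastAtMost closed_vimage closed_\<Omega> continuous_intros)
    have slice: "Pair s -` S \<in> null_sets lborel" for s
    proof (cases "s \<in> {- r..r}")
      case True
      interpret cone_segment g Dg C L \<Lambda> "z + s *\<^sub>R w" v r
      proof
        fix t assume t: "\<bar>t\<bar> \<le> r"
        have "norm (s *\<^sub>R w + t *\<^sub>R v) \<le> \<bar>s\<bar> * norm v + \<bar>t\<bar> * norm v"
          using norm_triangle_ineq[of "s *\<^sub>R w" "t *\<^sub>R v"] by (simp add: nw)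
        also have "\<dots> \<le> r * norm v + r * norm v"
          using t True by (intro add_mono mult_right_mono) auto
        also have "\<dots> < r0" using r by simp
        finally have "norm (s *\<^sub>R w + t *\<^sub>R v) < r0" .
        moreover have "dist z (z + (s *\<^sub>R w + t *\<^sub>R v)) = norm (s *\<^sub>R w + t *\<^sub>R v)"
          by (metis add_diff_cancel_left' dist_commute dist_norm)
        ultimately show "v \<in> C (z + s *\<^sub>R w + t *\<^sub>R v)"
          by (intro v(3)) (simp add: add.assoc)
      qed (use v r in auto)
      have "negligible {t \<in> {- r..r}. \<forall>n. curve n t \<in> W}"
        by (rule segment_null[OF \<delta> \<rho> W closed_W])
      moreover have "Pair s -` S = {t \<in> {- r..r}. \<forall>n. curve n t \<in> W}"
        using True by (auto simp: S_def \<Phi>_def \<Omega>_def curve_def)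
      ultimately have "Pair s -` S \<in> null_sets lebesgue"
        by (simp add: negligible_iff_null_sets)
      moreover have "Pair s -` S \<in> sets lborel"
        using contS by (auto intro!: borel_closed closed_vimage continuous_intros)
      ultimately show ?thesis
        by (auto simp: null_sets_def)
    next
      case False
      then have "Pair s -` S = {}" by (auto simp: S_def)
      then show ?thesis by simp
    qed
    have "S \<in> sets (lborel \<Otimes>\<^sub>M lborel)"
      unfolding lborel_prod using contS by (simp add: borel_closed)
    then have "emeasure (lborel \<Otimes>\<^sub>M lborel) S = (\<integral>\<^sup>+ s. emeasure lborel (Pair s -` S) \<partial>lborel)"
      by (rule lborel.emeasure_pair_measure_alt)
    also have "\<dots> = 0"
      using slice by (simp add: null_sets_def)
    finally have "S \<in> null_sets lborel"
      using contS by (auto simp: null_sets_def lborel_prod borel_closed)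
    then have "negligible S"
      by (simp add: negligible_iff_null_sets null_sets_completionI)
    moreover have "(\<Phi> has_derivative (\<lambda>h. fst h *\<^sub>R w + snd h *\<^sub>R v)) (at q within S)" for q
      unfolding \<Phi>_def[abs_def] by (auto intro!: derivative_eq_intros)
    then have "\<Phi> differentiable_on S"
      unfolding differentiable_on_def differentiable_def by blast
    ultimately have neg: "negligible (\<Phi> ` S)"
      by (intro negligible_differentiable_image_negligible) auto
    have "\<Omega> \<inter> ball z (r * norm v) \<subseteq> \<Phi> ` S"
    proof
      fix y assume y: "y \<in> \<Omega> \<inter> ball z (r * norm v)"
      define m where "m = (norm v)\<^sup>2"
      have "m > 0" using v(1) by (simp add: m_def)
      moreover have "m = v $ 1 * v $ 1 + v $ 2 * v $ 2"
        unfolding m_def norm_power2_real2 by (simp add: power2_eq_square)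
      ultimately have m: "m > 0" "m = v $ 1 * v $ 1 + v $ 2 * v $ 2" by auto
      define u where "u = y - z"
      define s where "s = (u \<bullet> w) / m"
      define t where "t = (u \<bullet> v) / m"
      have "m * (s * w $ i + t * v $ i) = m * u $ i" for i
      proof -
        have "m * (s * w $ i + t * v $ i) = (u \<bullet> w) * w $ i + (u \<bullet> v) * v $ i"
          using m(1) by (simp add: s_def t_def field_simps)
        also have "\<dots> = m * u $ i"
          using exhaust_2[of i] by (auto simp: inner_real2 w m(2) algebra_simps)
        finally show ?thesis .
      qed
      then have "u = s *\<^sub>R w + t *\<^sub>R v"
        using m(1) by (auto simp: vec_eq_iff)
      then have "y = \<Phi> (s, t)"
        by (simp add: \<Phi>_def u_def algebra_simps)
      moreover have "\<bar>(u \<bullet> x) / m\<bar> \<le> r" if "norm x = norm v" for x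
      proof -
        have "\<bar>u \<bullet> x\<bar> \<le> norm u * norm v"
          using Cauchy_Schwarz_ineq2[of u x] that by simp
        also have "\<dots> \<le> (r * norm v) * norm v"
          using y by (intro mult_right_mono) (auto simp: u_def dist_norm norm_minus_commute)
        finally show ?thesis
          using m(1) by (simp add: m_def power2_eq_square field_simps)
      qed
      then have "\<bar>s\<bar> \<le> r" "\<bar>t\<bar> \<le> r"
        using nw by (auto simp: s_def t_def)
      ultimately show "y \<in> \<Phi> ` S"
        using y by (intro image_eqI[of _ _ "(s, t)"]) (auto simp: S_def abs_le_iff)
    qed
    then have "negligible (\<Omega> \<inter> ball z (r * norm v))"
      using neg negligible_subset by blast
    then show ?thesis
      using that r v by (intro exI[of _ "\<Omega> \<inter> ball z (r * norm v)"]) auto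
  qed
  then have "negligible \<Omega>"
    unfolding locally_negligible_alt[of \<Omega>] by blast
  then show ?thesis by (simp add: \<Omega>_def)
qed

section \<open>Perturbations of diffeomorphisms\<close>

lemma blinfun_inverse_exists:
  fixes T :: "'a::euclidean_space \<Rightarrow>\<^sub>L 'a"
  assumes "k > 0" "\<And>v. k * norm v \<le> norm (T v)"
  obtains S :: "'a \<Rightarrow>\<^sub>L 'a" where "\<And>v. S (T v) = v" "\<And>v. T (S v) = v" "norm S \<le> 1 / k"
proof -
  have lin: "linear (blinfun_apply T)" by (simp add: blinfun.bounded_linear_right bounded_linear.linear)
  have inj: "inj (blinfun_apply T)"
    unfolding linear_injective_0[OF lin]
  proof (intro allI impI)
    fix v assume "T v = 0"
    then have "k * norm v \<le> 0" using assms(2)[of v] by simp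
    then show "v = 0" using assms(1) by (simp add: mult_le_0_iff)
  qed
  obtain s where s: "linear s" "\<And>v. s (T v) = v" "\<And>v. T (s v) = v"
    using linear_injective_isomorphism[OF lin inj] by metis
  have S: "blinfun_apply (Blinfun s) = s"
    using s(1) by (intro bounded_linear_Blinfun_apply) (simp add: linear_conv_bounded_linear)
  have "norm (Blinfun s) \<le> 1 / k"
  proof (rule norm_blinfun_bound)
    show "norm (Blinfun s v) \<le> 1 / k * norm v" for v
      using assms(2)[of "s v"] assms(1) by (simp add: S s(3) field_simps)
  qed (use assms(1) in simp)
  then show ?thesis using that[of "Blinfun s"] S s by simp
qed

lemma lift_lipschitz:
  assumes "C1_map F" "torus_lift F f" "\<And>p. norm (torus_deriv F p) \<le> M"
  shows "norm (f x - f y) \<le> M * norm (x - y)"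
proof (rule differentiable_bound[of UNIV f "\<lambda>x. blinfun_apply (torus_deriv F (proj x))"])
  show "onorm (blinfun_apply (torus_deriv F (proj x))) \<le> M" for x
    using assms(3) by (simp add: norm_blinfun.rep_eq[symmetric])
qed (use torus_lift_has_derivative[OF assms(1,2)] in auto)

lemma identity_perturbation_bijective:
  fixes \<phi> :: "'a::banach \<Rightarrow> 'a"
  assumes "0 \<le> q" "q < 1" and lip: "\<And>x y. norm (\<phi> x - \<phi> y) \<le> q * norm (x - y)"
  obtains \<psi> where "\<And>x. \<psi> (x + \<phi> x) = x" "\<And>y. \<psi> y + \<phi> (\<psi> y) = y"
    "\<And>x y. (1 - q) * norm (\<psi> x - \<psi> y) \<le> norm (x - y)"
proof -
  have "\<exists>x. x + \<phi> x = y" for y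
  proof -
    have "\<exists>!x. y - \<phi> x = x"
      by (rule banach_fix_type[of q])
        (use assms(1,2) lip in \<open>auto simp: dist_norm norm_minus_commute\<close>)
    then show ?thesis by (metis diff_add_cancel)
  qed
  then obtain \<psi> where psi: "\<And>y. \<psi> y + \<phi> (\<psi> y) = y" by metis
  have expand: "(1 - q) * norm (x - y) \<le> norm ((x + \<phi> x) - (y + \<phi> y))" for x y
  proof -
    have "norm (x - y) \<le> norm ((x + \<phi> x) - (y + \<phi> y)) + norm (\<phi> x - \<phi> y)"
      using norm_triangle_ineq4[of "(x + \<phi> x) - (y + \<phi> y)" "\<phi> x - \<phi> y"] by simp
    then show ?thesis using lip[of x y] by (simp add: algebra_simps)
  qed
  have "\<psi> (x + \<phi> x) = x" for x
  proof -
    have "(1 - q) * norm (\<psi> (x + \<phi> x) - x) \<le> 0"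
      using expand[of "\<psi> (x + \<phi> x)" x] by (simp add: psi)
    then show ?thesis using assms(2) by (simp add: mult_le_0_iff)
  qed
  moreover have "(1 - q) * norm (\<psi> x - \<psi> y) \<le> norm (x - y)" for x y
    using expand[of "\<psi> x" "\<psi> y"] by (simp add: psi)
  ultimately show ?thesis using that psi by blast
qed

text \<open>On the plane, g composed with the inverse of f is the identity plus a 1/2-Lipschitz map,
  hence bijective. Injectivity descends to the torus because both lifts act alike on the lattice;
  the inverse is C^1 since the derivatives are uniformly invertible.\<close>

lemma C1_diffeo_perturbation:
  assumes F: "C1_diffeo F"
  obtains c where "c > 0" "\<And>G. C1_map G \<Longrightarrow> C1_close c F G \<Longrightarrow> C1_diffeo G"
proof -
  note D = C1_diffeoD[OF F]
  obtain M where M: "M > 0" "\<And>p. norm (torus_deriv (inv F) p) \<le> M"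
    using torus_continuous_bounded[OF C1_map_deriv_continuous[OF D(3)]] by blast
  obtain f where f: "torus_lift F f"
    using torus_lift_exists[OF C1_map_continuous[OF D(2)]] .
  obtain f' where f': "torus_lift (inv F) f'" "\<And>x. f' (f x) = x" "\<And>x. f (f' x) = x"
    using torus_lift_inverse[OF D(1) f C1_map_continuous[OF D(3)]] by blast
  \<comment> \<open>The bound 1/2 selects a nearby lift; the other makes c M at most 1/2, both for
    the contraction and for the invertibility of the derivative.\<close>
  define c where "c = min (1/2) (1 / (2 * M))"
  have c: "c > 0" "c \<le> 1/2" "c * M \<le> 1/2"
    using M(1) by (auto simp: c_def min_def field_simps)
  show ?thesis
  proof (rule that[OF c(1)])
    fix G assume G: "C1_map G" and close: "C1_close c F G"
    obtain g where g: "torus_lift G g" "\<And>x. norm (g x - f x) < c"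
      using torus_lift_close[OF f C1_map_continuous[OF G] _ c(2)] close
      unfolding C1_close_def by metis
    note df = torus_lift_has_derivative[OF D(2) f] and df' = torus_lift_has_derivative[OF D(3) f'(1)]
      and dg = torus_lift_has_derivative[OF G g(1)]
    define \<phi> where "\<phi> y = g (f' y) - y" for y
    have lip: "norm (\<phi> x - \<phi> y) \<le> 1/2 * norm (x - y)" for x y
    proof (rule differentiable_bound[of UNIV \<phi>
          "\<lambda>y. blinfun_apply ((torus_deriv G (proj (f' y)) - torus_deriv F (proj (f' y))) o\<^sub>L torus_deriv (inv F) (proj y))"])
      fix y
      let ?p = "proj (f' y)"
      have inv: "torus_deriv F ?p (torus_deriv (inv F) (proj y) v) = v" for v
        using D(5,7) torus_lift_proj[OF f'(1), of y] by metis
      have "((\<lambda>y. g (f' y) - y) has_derivative (\<lambda>v. torus_deriv G ?p (torus_deriv (inv F) (proj y) v) - v)) (at y)"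
        by (intro has_derivative_diff has_derivative_compose[OF df' dg] has_derivative_ident)
      moreover have "(\<lambda>v. torus_deriv G ?p (torus_deriv (inv F) (proj y) v) - v) =
          blinfun_apply ((torus_deriv G ?p - torus_deriv F ?p) o\<^sub>L torus_deriv (inv F) (proj y))"
        by (simp add: fun_eq_iff blinfun.diff_left inv)
      ultimately show "(\<phi> has_derivative blinfun_apply ((torus_deriv G ?p - torus_deriv F ?p) o\<^sub>L torus_deriv (inv F) (proj y))) (at y within UNIV)"
        by (simp add: \<phi>_def[abs_def])
      have "norm ((torus_deriv G ?p - torus_deriv F ?p) o\<^sub>L torus_deriv (inv F) (proj y)) \<le>
          norm (torus_deriv G ?p - torus_deriv F ?p) * norm (torus_deriv (inv F) (proj y))"
        by (rule norm_blinfun_compose)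
      also have "\<dots> \<le> c * M"
        using close M(2) c(1) unfolding C1_close_def
        by (intro mult_mono) (auto simp: norm_minus_commute less_imp_le)
      finally show "onorm (blinfun_apply ((torus_deriv G ?p - torus_deriv F ?p) o\<^sub>L torus_deriv (inv F) (proj y))) \<le> 1/2"
        using c(3) by (simp add: norm_blinfun.rep_eq)
    qed auto
    obtain \<psi> where \<psi>: "\<And>x. \<psi> (x + \<phi> x) = x" "\<And>y. \<psi> y + \<phi> (\<psi> y) = y"
      "\<And>x y. (1 - 1/2) * norm (\<psi> x - \<psi> y) \<le> norm (x - y)"
      using identity_perturbation_bijective[of "1/2" \<phi>] lip by auto
    define g' where "g' y = f' (\<psi> y)" for y
    have g'g: "g' (g x) = x" and gg': "g (g' y) = y" for x y
    proof -
      have "g x = f x + \<phi> (f x)" by (simp add: \<phi>_def f')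
      then show "g' (g x) = x" using \<psi>(1)[of "f x"] by (simp add: g'_def f')
      show "g (g' y) = y" using \<psi>(2)[of y] by (simp add: g'_def \<phi>_def)
    qed
    have cont_\<psi>: "continuous_on UNIV \<psi>"
      by (rule continuous_on_if_lipschitz[of _ 2]) (use \<psi>(3) in \<open>auto simp: mult.commute\<close>)
    have cont_g': "continuous_on UNIV g'"
      unfolding g'_def
      by (rule continuous_on_compose2[OF torus_lift_continuous[OF f'(1)] cont_\<psi>]) auto
    have "bij G"
    proof (rule bijI)
      show "inj G"
      proof (rule injI)
        fix p q assume pq: "G p = G q"
        obtain x where x: "p = proj x" by (rule torus_cases)
        obtain y where y: "q = proj y" by (rule torus_cases)
        define n where "n = g x - g y"
        have n: "n \<in> int_lattice"
          using pq by (simp add: n_def x y torus_lift_proj[OF g(1)] flip: proj_eq_iff)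
        obtain m where m: "m \<in> int_lattice" "\<And>y. f' (y + n) = f' y + m"
          using torus_lift_translate[OF f'(1) n] by blast
        obtain k where k: "\<And>x. f (x + m) = f x + k" "\<And>x. g (x + m) = g x + k"
          using lift_pair_translate[OF f g c(2) m(1)] by metis
        have "f (f' 0 + m) = 0 + n" using m(2)[of 0] f'(3) by metis
        \<comment> \<open>Hence the translation m, found from the inverse of f, moves g by precisely
          the n that separates \<open>g x\<close> from \<open>g y\<close>.\<close>
        then have "k = n" using k(1)[of "f' 0"] f'(3) by simp
        then have "g (y + m) = g x" using k(2)[of y] by (simp add: n_def)
        then have "y + m = x" using g'g by metis
        then show "p = q" using proj_add_lattice[OF m(1)] x y by metis
      qed
      have "\<exists>p. G p = q" for q
        using surj_proj[of q] gg' torus_lift_proj[OF g(1)] by metis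
      then show "range G = UNIV" by (metis surj_def)
    qed
    then have Ginv: "inv G (G p) = p" "G (inv G p) = p" for p
      by (auto simp: bij_is_inj bij_is_surj surj_f_inv_f)
    have lift': "torus_lift (inv G) g'"
      unfolding torus_lift_def using cont_g' Ginv(1) gg' torus_lift_proj[OF g(1)] by metis
    have lower: "1 / (2 * M) * norm v \<le> norm (torus_deriv G p v)" for p v
    proof -
      have "norm (torus_deriv (inv F) (F p) (torus_deriv F p v)) \<le> norm (torus_deriv (inv F) (F p)) * norm (torus_deriv F p v)"
        by (rule norm_blinfun)
      also have "\<dots> \<le> M * norm (torus_deriv F p v)"
        by (intro mult_right_mono M(2)) simp
      finally have "norm v \<le> M * norm (torus_deriv F p v)"
        by (simp add: D(6))
      also have "\<dots> \<le> M * (norm (torus_deriv G p v) + c * norm v)"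
      proof (intro mult_left_mono)
        have "norm ((torus_deriv F p - torus_deriv G p) v) \<le> norm (torus_deriv F p - torus_deriv G p) * norm v"
          by (rule norm_blinfun)
        also have "\<dots> \<le> c * norm v"
          using close unfolding C1_close_def by (intro mult_right_mono) (auto intro: less_imp_le)
        finally show "norm (torus_deriv F p v) \<le> norm (torus_deriv G p v) + c * norm v"
          using norm_triangle_ineq[of "torus_deriv G p v" "(torus_deriv F p - torus_deriv G p) v"]
          by (simp add: blinfun.diff_left)
      qed (use M in simp)
      also have "\<dots> \<le> M * norm (torus_deriv G p v) + 1/2 * norm v"
        using mult_right_mono[OF c(3), of "norm v"] by (simp add: algebra_simps)
      finally show ?thesis using M(1) by (simp add: field_simps)
    qed
    have "\<exists>S. (\<forall>v. blinfun_apply S (torus_deriv G p v) = v) \<and> (\<forall>v. torus_deriv G p (blinfun_apply S v) = v) \<and> norm S \<le> 2 * M" for p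
      by (rule blinfun_inverse_exists[of "1 / (2 * M)" "torus_deriv G p"]) (use lower M in auto)
    then obtain S where S: "\<And>p v. blinfun_apply (S p) (torus_deriv G p v) = v"
      "\<And>p v. torus_deriv G p (blinfun_apply (S p) v) = v" "\<And>p. norm (S p) \<le> 2 * M"
      by metis
    have "C1_map (inv G)"
    proof (rule C1_mapI_lift(1)[OF lift'])
      fix y
      show "(g' has_derivative blinfun_apply (S (proj (g' y)))) (at y)"
      proof (rule has_derivative_inverse_basic[of g "blinfun_apply (torus_deriv G (proj (g' y)))" g' y _ UNIV])
        show "(g has_derivative blinfun_apply (torus_deriv G (proj (g' y)))) (at (g' y))"
          by (rule dg)
        show "blinfun_apply (S (proj (g' y))) \<circ> blinfun_apply (torus_deriv G (proj (g' y))) = id"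
          by (simp add: fun_eq_iff S)
        show "continuous (at y) g'"
          using cont_g' by (simp add: continuous_on_eq_continuous_at)
      qed (auto simp: gg' blinfun.bounded_linear_right)
    next
      \<comment> \<open>The resolvent identity makes inversion locally Lipschitz, so continuity of
        the derivative passes to the inverse matrices.\<close>
      have S_diff: "norm (S p - S q) \<le> (2 * M * (2 * M)) * norm (torus_deriv G p - torus_deriv G q)" for p q
      proof -
        have "S p - S q = S p o\<^sub>L (torus_deriv G q - torus_deriv G p) o\<^sub>L S q"
          by (intro blinfun_eqI) (simp add: blinfun.diff_left blinfun.diff_right S)
        also have "norm \<dots> \<le> norm (S p o\<^sub>L (torus_deriv G q - torus_deriv G p)) * norm (S q)"
          by (rule norm_blinfun_compose)
        also have "\<dots> \<le> (norm (S p) * norm (torus_deriv G q - torus_deriv G p)) * norm (S q)"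
          by (intro mult_right_mono norm_blinfun_compose) simp
        also have "\<dots> \<le> (2 * M * norm (torus_deriv G q - torus_deriv G p)) * (2 * M)"
          using S(3) M(1) by (intro mult_mono) auto
        finally show ?thesis by (simp add: norm_minus_commute mult_ac)
      qed
      have "continuous_on UNIV S"
        unfolding continuous_on_iff
      proof (intro ballI allI impI)
        fix p and e :: real assume e: "e > 0"
        have "e / (2 * M * (2 * M)) > 0" using e M by simp
        then obtain d where d: "d > 0" "\<And>q. dist q p < d \<Longrightarrow> dist (torus_deriv G q) (torus_deriv G p) < e / (2 * M * (2 * M))"
          using C1_map_deriv_continuous[OF G] unfolding continuous_on_iff by (metis UNIV_I)
        have "dist (S q) (S p) < e" if "dist q p < d" for q
        proof -
          have "dist (S q) (S p) \<le> (2 * M * (2 * M)) * dist (torus_deriv G q) (torus_deriv G p)"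
            using S_diff by (simp add: dist_norm)
          also have "\<dots> < e"
            using d(2)[OF that] M(1) by (simp add: field_simps)
          finally show ?thesis .
        qed
        then show "\<exists>d>0. \<forall>q\<in>UNIV. dist q p < d \<longrightarrow> dist (S q) (S p) < e"
          using d(1) by blast
      qed
      then show "continuous_on UNIV (\<lambda>y. S (proj (g' y)))"
        by (rule continuous_on_compose2[OF _ continuous_on_compose2[OF continuous_on_proj cont_g']]) auto
    qed
    then show "C1_diffeo G"
      using \<open>bij G\<close> G by (simp add: C1_diffeo_def)
  qed
qed

section \<open>Smoothing by averages over small squares\<close>

lemma prod_UNIV_2: "prod f (UNIV :: 2 set) = f 1 * f 2"
  by (simp add: UNIV_2)

text \<open>The two averages differ by an integral over the symmetric difference of two translated
  squares, whose area is at most 4 h times the translation. For translations longer than h the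
  trivial bound suffices.\<close>

lemma box_average_lipschitz:
  fixes \<Phi> :: "real^2 \<Rightarrow> 'b::banach"
  assumes cont: "continuous_on UNIV \<Phi>" and bound: "\<And>x. norm (\<Phi> x) \<le> \<Lambda>" and h: "h > 0"
  defines "e \<equiv> \<chi> i. h"
  shows "norm (integral (cbox 0 e) (\<lambda>t. \<Phi> (x + t)) - integral (cbox 0 e) (\<lambda>t. \<Phi> (y + t))) \<le> 4 * \<Lambda> * h * norm (x - y)"
proof -
  have Lambda: "\<Lambda> \<ge> 0" using bound norm_ge_zero order_trans by blast
  have content: "measure lborel (cbox z (z + e)) = h * h" for z :: "real^2"
    using h by (subst content_cbox_cart) (auto simp: e_def power2_eq_square interval_ne_empty_cart less_imp_le)
  have int: "\<Phi> integrable_on cbox a b" for a b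
    by (intro integrable_continuous continuous_on_subset[OF cont]) auto
  have shift: "integral (cbox 0 e) (\<lambda>t. \<Phi> (z + t)) = integral (cbox z (z + e)) \<Phi>" for z
    using integral_shift_cbox_plus[of 0 e \<Phi> z] by (simp add: o_def add.commute)
  show ?thesis
  proof (cases "norm (x - y) \<le> h")
    case True
    \<comment> \<open>c and d are the corners of the intersection of the two squares.\<close>
    define c :: "real^2" where "c = (\<chi> i. max (x $ i) (y $ i))"
    define d :: "real^2" where "d = (\<chi> i. min (x $ i + h) (y $ i + h))"
    let ?A = "cbox x (x + e)" and ?B = "cbox y (y + e)" and ?C = "cbox c d"
    have C: "t \<in> ?C \<longleftrightarrow> t \<in> ?A \<and> t \<in> ?B" for t
      by (auto simp: mem_box_cart c_def d_def e_def)
    have i: "\<bar>x $ i - y $ i\<bar> \<le> norm (x - y)" for i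
      using component_le_norm_cart[of "x - y" i] by simp
    have i': "d $ i - c $ i = h - \<bar>x $ i - y $ i\<bar>" for i
      by (auto simp: c_def d_def min_def max_def)
    have "h * h - 2 * h * norm (x - y) \<le> (h - norm (x - y)) * (h - norm (x - y))"
      by (simp add: algebra_simps)
    also have "\<dots> \<le> (d $ 1 - c $ 1) * (d $ 2 - c $ 2)"
      unfolding i' using True i[of 1] i[of 2] by (intro mult_mono) auto
    also have "\<dots> = measure lborel ?C"
    proof (subst content_cbox_cart)
      have "c $ i \<le> d $ i" for i using i'[of i] i[of i] True by linarith
      then show "?C \<noteq> {}" by (simp add: interval_ne_empty_cart)
    qed (simp add: prod_UNIV_2)
    finally have contC: "h * h - 2 * h * norm (x - y) \<le> measure lborel ?C" .
    let ?r = "\<lambda>S t. if t \<in> S then \<Phi> t else 0"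
    let ?i = "\<lambda>S t. if t \<in> S then (1::real) else 0"
    have r: "?r (cbox a b) integrable_on UNIV" "integral UNIV (?r (cbox a b)) = integral (cbox a b) \<Phi>" for a b
      using int by (auto simp: integrable_restrict_UNIV integral_restrict_UNIV)
    have ii: "?i (cbox a b) integrable_on UNIV" "integral UNIV (?i (cbox a b)) = measure lborel (cbox a b)" for a b :: "real^2"
      by (auto simp: integrable_restrict_UNIV integral_restrict_UNIV integrable_const)
    have ii': "(?i (cbox a b) has_integral measure lborel (cbox a b)) UNIV" for a b :: "real^2"
      using integrable_integral[OF ii(1)[of a b]] unfolding ii(2) .
    have diff: "integral ?A \<Phi> - integral ?B \<Phi> = integral UNIV (\<lambda>t. ?r ?A t - ?r ?B t)"
      using r by (simp add: Henstock_Kurzweil_Integration.integral_diff)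
    \<comment> \<open>The combination of indicators on the right is the indicator of the symmetric
      difference.\<close>
    have 1: "norm (integral UNIV (\<lambda>t. ?r ?A t - ?r ?B t)) \<le> integral UNIV (\<lambda>t. \<Lambda> * (?i ?A t + ?i ?B t - 2 * ?i ?C t))"
    proof (rule integral_norm_bound_integral)
      show "(\<lambda>t. ?r ?A t - ?r ?B t) integrable_on UNIV"
        by (intro integrable_diff r)
      show "(\<lambda>t. \<Lambda> * (?i ?A t + ?i ?B t - 2 * ?i ?C t)) integrable_on UNIV"
        by (intro integrable_on_mult_right integrable_diff integrable_add ii)
      show "norm (?r ?A t - ?r ?B t) \<le> \<Lambda> * (?i ?A t + ?i ?B t - 2 * ?i ?C t)" for t
        using bound[of t] Lambda C[of t] by auto
    qed
    have 2: "((\<lambda>t. ?i ?A t + ?i ?B t) has_integral (measure lborel ?A + measure lborel ?B)) UNIV"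
      by (rule has_integral_add[OF ii'[of x "x + e"] ii'[of y "y + e"]])
    have 3: "((\<lambda>t. 2 * ?i ?C t) has_integral (2 * measure lborel ?C)) UNIV"
      by (rule has_integral_mult_right[OF ii'[of c d], of 2])
    have 4: "integral UNIV (\<lambda>t. \<Lambda> * (?i ?A t + ?i ?B t - 2 * ?i ?C t)) =
        \<Lambda> * (measure lborel ?A + measure lborel ?B - 2 * measure lborel ?C)"
      by (rule integral_unique[OF has_integral_mult_right[OF has_integral_diff[OF 2 3], of \<Lambda>]])
    have 5: "\<Lambda> * (measure lborel ?A + measure lborel ?B - 2 * measure lborel ?C) \<le> \<Lambda> * (4 * h * norm (x - y))"
      using contC unfolding content by (intro mult_left_mono Lambda) linarith
    show ?thesis
      using 1 4 5 unfolding shift diff by (simp only: mult_ac)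
  next
    case False
    have b: "norm (integral (cbox z (z + e)) \<Phi>) \<le> \<Lambda> * (h * h)" for z
      using has_integral_bound[OF Lambda integrable_integral[OF int[of z "z + e"]]] bound content[of z] by simp
    have "norm (integral (cbox x (x + e)) \<Phi> - integral (cbox y (y + e)) \<Phi>) \<le> \<Lambda> * (h * h) + \<Lambda> * (h * h)"
      using norm_triangle_ineq4 b by (meson add_mono order_trans)
    also have "\<dots> = 2 * \<Lambda> * h * h" by simp
    also have "\<dots> \<le> 4 * \<Lambda> * h * norm (x - y)"
      using False h Lambda by (intro mult_mono) auto
    finally show ?thesis unfolding shift .
  qed
qed

text \<open>Averaging a lift over a small square makes its derivative Lipschitz.\<close>

lemma C1_diffeo_lipschitz_approximation:
  assumes F: "C1_diffeo F" and \<epsilon>: "\<epsilon> > 0"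
  obtains G L where "C1_diffeo G" "C1_close \<epsilon> F G" "L > 0"
    "\<And>x y. norm (torus_deriv G (proj x) - torus_deriv G (proj y)) \<le> L * norm (x - y)"
proof -
  note D = C1_diffeoD[OF F]
  obtain c where c: "c > 0" "\<And>G. C1_map G \<Longrightarrow> C1_close c F G \<Longrightarrow> C1_diffeo G"
    using C1_diffeo_perturbation[OF F] by blast
  \<comment> \<open>Strictly below both radii: non-strict estimates with \<eta> will give closeness
    to F and the diffeomorphism property.\<close>
  define \<eta> where "\<eta> = min \<epsilon> c / 2"
  have \<eta>: "\<eta> > 0" "\<eta> < \<epsilon>" "\<eta> < c" using \<epsilon> c(1) by (auto simp: \<eta>_def min_def)
  obtain f where f: "torus_lift F f"
    using torus_lift_exists[OF C1_map_continuous[OF D(2)]] .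
  define \<Phi> where "\<Phi> x = torus_deriv F (proj x)" for x
  have df: "(f has_derivative blinfun_apply (\<Phi> x)) (at x)" for x
    unfolding \<Phi>_def by (rule torus_lift_has_derivative[OF D(2) f])
  have cont_\<Phi>: "continuous_on S \<Phi>" for S
  proof (rule continuous_on_subset[of UNIV])
    show "continuous_on UNIV \<Phi>"
      unfolding \<Phi>_def using C1_map_deriv_continuous[OF D(2)] by (simp add: continuous_on_torus_iff)
  qed simp
  have cont_f: "continuous_on S f" for S
    using torus_lift_continuous[OF f] continuous_on_subset by blast
  obtain \<Lambda> where \<Lambda>: "\<Lambda> > 0" "\<And>p. norm (torus_deriv F p) \<le> \<Lambda>"
    using torus_continuous_bounded[OF C1_map_deriv_continuous[OF D(2)]] by blast
  obtain d where d: "d > 0" "\<And>p q. dist p q < d \<Longrightarrow> dist (torus_deriv F p) (torus_deriv F q) < \<eta>"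
    using torus_continuous_uniform[OF C1_map_deriv_continuous[OF D(2)] \<eta>(1)] by blast
  \<comment> \<open>Points of the square have norm at most 2 h: within this range the derivative
    varies by less than \<eta>, and f moves by at most \<eta>.\<close>
  define h where "h = min (d / 3) (\<eta> / (2 * \<Lambda>))"
  have h: "h > 0" "2 * h < d" "\<Lambda> * (2 * h) \<le> \<eta>"
    using d(1) \<eta>(1) \<Lambda>(1) by (auto simp: h_def min_def field_simps)
  define e :: "real^2" where "e = (\<chi> i. h)"
  let ?Q = "cbox 0 e"
  have content: "measure lborel ?Q = h * h"
    using h(1) by (subst content_cbox_cart) (auto simp: e_def power2_eq_square interval_ne_empty_cart less_imp_le)
  have small: "norm t \<le> 2 * h" if "t \<in> ?Q" for t
  proof -
    have "norm t \<le> (\<Sum>i\<in>UNIV. \<bar>t $ i\<bar>)" by (rule norm_le_l1_cart)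
    also have "\<dots> \<le> (\<Sum>i\<in>(UNIV :: 2 set). h)"
      using that by (intro sum_mono) (auto simp: mem_box_cart e_def)
    finally show ?thesis by simp
  qed
  define g where "g x = (1 / (h * h)) *\<^sub>R integral ?Q (\<lambda>t. f (x + t))" for x
  define \<Psi> where "\<Psi> x = (1 / (h * h)) *\<^sub>R integral ?Q (\<lambda>t. \<Phi> (x + t))" for x
  have int_f: "(\<lambda>t. f (x + t)) integrable_on ?Q" for x
    by (intro integrable_continuous continuous_on_compose2[OF cont_f[of UNIV]] continuous_intros) auto
  have int_\<Phi>: "(\<lambda>t. \<Phi> (x + t)) integrable_on ?Q" for x
    by (intro integrable_continuous continuous_on_compose2[OF cont_\<Phi>[of UNIV]] continuous_intros) auto
  have dg: "(g has_derivative blinfun_apply (\<Psi> x)) (at x)" for x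
  proof -
    have "((\<lambda>x. integral ?Q (\<lambda>t. f (x + t))) has_derivative blinfun_apply (integral ?Q (\<lambda>t. \<Phi> (x + t)))) (at x within UNIV)"
    proof (rule leibniz_rule[where fx = "\<lambda>x t. \<Phi> (x + t)" and U = UNIV])
      show "((\<lambda>x. f (x + t)) has_derivative blinfun_apply (\<Phi> (y + t))) (at y within UNIV)" for y t
      proof -
        have t: "((\<lambda>x. x + t) has_derivative (\<lambda>h. h)) (at y)"
          by (auto intro!: derivative_eq_intros)
        show ?thesis
          using has_derivative_compose[OF t df] by simp
      qed
      show "continuous_on (UNIV \<times> ?Q) (\<lambda>(x, t). \<Phi> (x + t))"
        unfolding split_beta by (intro continuous_on_compose2[OF cont_\<Phi>[of UNIV]] continuous_intros) auto
    qed (use int_f in auto)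
    then have "((\<lambda>x. (1 / (h * h)) *\<^sub>R integral ?Q (\<lambda>t. f (x + t))) has_derivative
        (\<lambda>v. (1 / (h * h)) *\<^sub>R blinfun_apply (integral ?Q (\<lambda>t. \<Phi> (x + t))) v)) (at x)"
      by (intro has_derivative_scaleR_right) simp
    then show ?thesis
      by (simp add: g_def[abs_def] \<Psi>_def scaleR_blinfun.rep_eq)
  qed
  have average: "norm ((1 / (h * h)) *\<^sub>R integral ?Q u - a) \<le> b"
    if "u integrable_on ?Q" "\<And>t. t \<in> ?Q \<Longrightarrow> norm (u t - a) \<le> b" "b \<ge> 0" for u :: "real^2 \<Rightarrow> 'b::banach" and a b
  proof -
    have i: "((\<lambda>t. u t - a) has_integral (integral ?Q u - (h * h) *\<^sub>R a)) ?Q"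
      using has_integral_diff[OF integrable_integral[OF that(1)] has_integral_const[of a 0 e]]
      unfolding content .
    have "norm (integral ?Q u - (h * h) *\<^sub>R a) \<le> b * (h * h)"
      using has_integral_bound[OF that(3) i that(2)] unfolding content .
    then have "(1 / (h * h)) * norm (integral ?Q u - (h * h) *\<^sub>R a) \<le> (1 / (h * h)) * (b * (h * h))"
      by (intro mult_left_mono) auto
    moreover have "(1 / (h * h)) *\<^sub>R integral ?Q u - a = (1 / (h * h)) *\<^sub>R (integral ?Q u - (h * h) *\<^sub>R a)"
      using h(1) by (simp add: scaleR_diff_right)
    ultimately show ?thesis
      using h(1) by simp
  qed
  have close_f: "norm (g x - f x) \<le> \<eta>" for x
    unfolding g_def
  proof (rule average[OF int_f])
    fix t assume t: "t \<in> ?Q"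
    have "norm (f (x + t) - f x) \<le> \<Lambda> * norm (x + t - x)"
      by (rule lift_lipschitz[OF D(2) f \<Lambda>(2)])
    also have "\<dots> \<le> \<Lambda> * (2 * h)"
      using small[OF t] \<Lambda>(1) by (intro mult_left_mono) auto
    finally show "norm (f (x + t) - f x) \<le> \<eta>" using h(3) by simp
  qed (use \<eta> in simp)
  have close_\<Phi>: "norm (\<Psi> x - \<Phi> x) \<le> \<eta>" for x
    unfolding \<Psi>_def
  proof (rule average[OF int_\<Phi>])
    fix t assume t: "t \<in> ?Q"
    have "dist (proj (x + t)) (proj x) < d"
      using dist_proj_le[of "x + t" x] small[OF t] h(2) by (simp add: dist_norm)
    then show "norm (\<Phi> (x + t) - \<Phi> x) \<le> \<eta>"
      using d(2) by (simp add: \<Phi>_def dist_norm less_imp_le)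
  qed (use \<eta> in simp)
  have lip: "norm (\<Psi> x - \<Psi> y) \<le> (4 * \<Lambda> / h) * norm (x - y)" for x y
  proof -
    have "norm (integral ?Q (\<lambda>t. \<Phi> (x + t)) - integral ?Q (\<lambda>t. \<Phi> (y + t))) \<le> 4 * \<Lambda> * h * norm (x - y)"
      unfolding e_def by (rule box_average_lipschitz[OF cont_\<Phi> _ h(1)]) (simp add: \<Phi>_def \<Lambda>)
    then have "(1 / (h * h)) * norm (integral ?Q (\<lambda>t. \<Phi> (x + t)) - integral ?Q (\<lambda>t. \<Phi> (y + t)))
        \<le> (1 / (h * h)) * (4 * \<Lambda> * h * norm (x - y))"
      by (intro mult_left_mono) auto
    also have "\<dots> = (4 * \<Lambda> / h) * norm (x - y)"
      using h(1) by simp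
    also have "(1 / (h * h)) * norm (integral ?Q (\<lambda>t. \<Phi> (x + t)) - integral ?Q (\<lambda>t. \<Phi> (y + t))) = norm (\<Psi> x - \<Psi> y)"
      unfolding \<Psi>_def scaleR_diff_right[symmetric] using h(1) by simp
    finally show ?thesis .
  qed
  have translate: "proj (g (x + n)) = proj (g x)" if n: "n \<in> int_lattice" for x n
  proof -
    obtain m where m: "m \<in> int_lattice" "\<And>x. f (x + n) = f x + m"
      using torus_lift_translate[OF f n] by blast
    have "f (x + n + t) = f (x + t) + m" for t
      using m(2)[of "x + t"] by (simp add: add_ac)
    then have "integral ?Q (\<lambda>t. f (x + n + t)) = integral ?Q (\<lambda>t. f (x + t) + m)"
      by simp
    also have "\<dots> = integral ?Q (\<lambda>t. f (x + t)) + (h * h) *\<^sub>R m"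
      using has_integral_add[OF integrable_integral[OF int_f[of x]] has_integral_const[of m 0 e]] content
      by (simp add: integral_unique)
    finally have "g (x + n) = g x + m"
      using h(1) by (simp add: g_def scaleR_add_right)
    then show ?thesis by (simp add: proj_add_lattice[OF m(1)])
  qed
  define G where "G p = proj (g (rep_torus p))" for p
  have "proj (g x) = G (proj x)" for x
  proof -
    have "rep_torus (proj x) - x \<in> int_lattice" by (simp flip: proj_eq_iff)
    from translate[OF this, of x] show ?thesis by (simp add: G_def)
  qed
  moreover have "continuous_on UNIV g"
    using dg by (meson continuous_at_imp_continuous_on has_derivative_continuous)
  ultimately have lift: "torus_lift G g" by (simp add: torus_lift_def)
  have cont_\<Psi>: "continuous_on UNIV \<Psi>"
    by (rule continuous_on_if_lipschitz[OF lip]) (use \<Lambda>(1) h(1) in simp)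
  note G = C1_mapI_lift[OF lift dg cont_\<Psi>]
  have close: "C1_close r F G" if "\<eta> < r" for r
    unfolding C1_close_def
  proof
    fix p
    obtain x where x: "p = proj x" by (rule torus_cases)
    have "dist (F p) (G p) \<le> dist (f x) (g x)"
      using dist_proj_le[of "f x" "g x"] by (simp add: x torus_lift_proj[OF f] torus_lift_proj[OF lift])
    also have "\<dots> \<le> \<eta>" using close_f[of x] by (simp add: dist_norm norm_minus_commute)
    finally have "dist (F p) (G p) < r" using that by simp
    moreover have "norm (torus_deriv F p - torus_deriv G p) \<le> \<eta>"
      using close_\<Phi>[of x] by (simp add: x G(2) \<Phi>_def norm_minus_commute)
    ultimately show "dist (F p) (G p) < r \<and> norm (torus_deriv F p - torus_deriv G p) < r"
      using that by simp
  qed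
  show ?thesis
  proof (rule that[of G "4 * \<Lambda> / h"])
    show "C1_diffeo G" by (rule c(2)[OF G(1) close[OF \<eta>(3)]])
    show "C1_close \<epsilon> F G" by (rule close[OF \<eta>(2)])
    show "4 * \<Lambda> / h > 0" using \<Lambda>(1) h(1) by simp
    show "norm (torus_deriv G (proj x) - torus_deriv G (proj y)) \<le> 4 * \<Lambda> / h * norm (x - y)" for x y
      using lip by (simp add: G(2))
  qed
qed

section \<open>Closeness and regularity of iterates\<close>

lemma norm_blinfun_compose_diff:
  fixes A A' :: "'b::real_normed_vector \<Rightarrow>\<^sub>L 'c::real_normed_vector" and S T :: "'a::real_normed_vector \<Rightarrow>\<^sub>L 'b"
  shows "norm ((A o\<^sub>L S) - (A' o\<^sub>L T)) \<le> norm A * norm (S - T) + norm (A - A') * norm T"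
proof -
  have eq: "(A o\<^sub>L S) - (A' o\<^sub>L T) = (A o\<^sub>L (S - T)) + ((A - A') o\<^sub>L T)"
    by (intro blinfun_eqI) (simp add: blinfun.diff_left blinfun.diff_right blinfun.add_left)
  show ?thesis
    unfolding eq by (intro norm_triangle_mono norm_blinfun_compose)
qed

lemma C1_close_mono: "C1_close \<epsilon> F G \<Longrightarrow> \<epsilon> \<le> \<epsilon>' \<Longrightarrow> C1_close \<epsilon>' F G"
  unfolding C1_close_def by (meson less_le_trans)

lemma C1_close_funpow:
  assumes F: "C1_map F" and \<eta>: "\<eta> > 0"
  shows "\<exists>\<epsilon>>0. \<forall>G. C1_map G \<longrightarrow> C1_close \<epsilon> F G \<longrightarrow> C1_close \<eta> (F ^^ n) (G ^^ n)"
  using \<eta>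
proof (induction n arbitrary: \<eta>)
  case 0
  then show ?case by (intro exI[of _ 1]) (auto simp: C1_close_def)
next
  case (Suc n)
  obtain \<Lambda> where \<Lambda>: "\<Lambda> > 0" "\<And>p. norm (torus_deriv F p) \<le> \<Lambda>"
    using torus_continuous_bounded[OF C1_map_deriv_continuous[OF F]] by blast
  obtain \<Lambda>n where \<Lambda>n: "\<Lambda>n > 0" "\<And>p. norm (torus_deriv (F ^^ n) p) \<le> \<Lambda>n"
    using torus_continuous_bounded[OF C1_map_deriv_continuous[OF C1_map_funpow[OF F]]] by blast
  \<comment> \<open>Two errors \<mu> occur in the position, and 2 \<mu> times a bound for the n-th
    derivative occurs in the chain rule.\<close>
  define \<mu> where "\<mu> = min (\<eta> / 4) (\<eta> / (4 * (\<Lambda>n + 1)))"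
  have \<mu>: "\<mu> > 0" "\<mu> \<le> \<eta> / 4" "\<mu> * (\<Lambda>n + 1) \<le> \<eta> / 4"
  proof -
    show "\<mu> > 0" using Suc.prems \<Lambda>n(1) by (simp add: \<mu>_def)
    show "\<mu> \<le> \<eta> / 4" unfolding \<mu>_def by (rule min.cobounded1)
    have "\<mu> * (\<Lambda>n + 1) \<le> \<eta> / (4 * (\<Lambda>n + 1)) * (\<Lambda>n + 1)"
      using \<Lambda>n(1) by (intro mult_right_mono) (auto simp: \<mu>_def)
    moreover have "\<eta> / (4 * k) * k = \<eta> / 4" if "k > 0" for k
      using that by simp
    from this[of "\<Lambda>n + 1"] have "\<eta> / (4 * (\<Lambda>n + 1)) * (\<Lambda>n + 1) = \<eta> / 4" using \<Lambda>n(1) by linarith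
    ultimately show "\<mu> * (\<Lambda>n + 1) \<le> \<eta> / 4" by (rule ord_le_eq_trans)
  qed
  obtain d1 where d1: "d1 > 0" "\<And>p q. dist p q < d1 \<Longrightarrow> dist (F p) (F q) < \<mu>"
    using torus_continuous_uniform[OF C1_map_continuous[OF F] \<mu>(1)] by blast
  obtain d2 where d2: "d2 > 0" "\<And>p q. dist p q < d2 \<Longrightarrow> dist (torus_deriv F p) (torus_deriv F q) < \<mu>"
    using torus_continuous_uniform[OF C1_map_deriv_continuous[OF F] \<mu>(1)] by blast
  \<comment> \<open>The moduli of continuity of F and of its derivative; 1 to bound the derivative
    of \<open>G ^^ n\<close>; the last term for the other product in the chain rule.\<close>
  define \<eta>' where "\<eta>' = min (min d1 d2) (min 1 (\<eta> / (4 * \<Lambda>)))"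
  have \<eta>': "\<eta>' > 0" "\<eta>' \<le> d1" "\<eta>' \<le> d2" "\<eta>' \<le> 1" "\<Lambda> * \<eta>' \<le> \<eta> / 4"
  proof -
    show "\<eta>' > 0" "\<eta>' \<le> d1" "\<eta>' \<le> d2" "\<eta>' \<le> 1"
      using d1 d2 Suc.prems \<Lambda> by (auto simp: \<eta>'_def)
    have "\<Lambda> * \<eta>' \<le> \<Lambda> * (\<eta> / (4 * \<Lambda>))"
      using \<Lambda>(1) by (intro mult_left_mono) (auto simp: \<eta>'_def)
    then show "\<Lambda> * \<eta>' \<le> \<eta> / 4" using \<Lambda>(1) by simp
  qed
  obtain \<epsilon> where \<epsilon>: "\<epsilon> > 0" "\<And>G. C1_map G \<Longrightarrow> C1_close \<epsilon> F G \<Longrightarrow> C1_close \<eta>' (F ^^ n) (G ^^ n)"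
    using Suc.IH[OF \<eta>'(1)] by blast
  show ?case
  proof (intro exI[of _ "min \<epsilon> \<mu>"] conjI allI impI)
    fix G assume G: "C1_map G" and close: "C1_close (min \<epsilon> \<mu>) F G"
    have c1: "C1_close \<mu> F G" and c2: "C1_close \<eta>' (F ^^ n) (G ^^ n)"
      using C1_close_mono[OF close] \<epsilon>(2)[OF G] by auto
    show "C1_close \<eta> (F ^^ Suc n) (G ^^ Suc n)"
      unfolding C1_close_def torus_deriv_funpow_Suc[OF F] torus_deriv_funpow_Suc[OF G]
    proof
      fix p
      let ?a = "(F ^^ n) p" and ?b = "(G ^^ n) p"
      let ?A = "torus_deriv F ?a" and ?A' = "torus_deriv F ?b" and ?B = "torus_deriv G ?b"
      let ?S = "torus_deriv (F ^^ n) p" and ?T = "torus_deriv (G ^^ n) p"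
      have ab: "dist ?a ?b < \<eta>'" and ST: "norm (?S - ?T) < \<eta>'"
        using c2 by (auto simp: C1_close_def)
      have "dist (F ?a) (G ?b) \<le> dist (F ?a) (F ?b) + dist (F ?b) (G ?b)"
        by (rule dist_triangle)
      also have "\<dots> < \<mu> + \<mu>"
        using d1(2)[of ?a ?b] ab \<eta>'(2) c1 unfolding C1_close_def by (intro add_strict_mono) auto
      finally have 1: "dist ((F ^^ Suc n) p) ((G ^^ Suc n) p) < \<eta>"
        using \<mu>(2) Suc.prems by simp
      have "norm (?A - ?B) \<le> norm (?A - ?A') + norm (?A' - ?B)"
        using norm_triangle_ineq[of "?A - ?A'" "?A' - ?B"] by simp
      also have "\<dots> \<le> \<mu> + \<mu>"
        using d2(2)[of ?a ?b] ab \<eta>'(3) c1 unfolding C1_close_def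
        by (intro add_mono) (auto simp: dist_norm less_imp_le)
      finally have AB: "norm (?A - ?B) \<le> 2 * \<mu>" by simp
      have "norm ?T \<le> norm ?S + norm (?S - ?T)"
        using norm_triangle_ineq4[of ?S "?S - ?T"] by simp
      then have T: "norm ?T \<le> \<Lambda>n + 1"
        using \<Lambda>n(2)[of p] ST \<eta>'(4) by linarith
      have "norm ((?A o\<^sub>L ?S) - (?B o\<^sub>L ?T)) \<le> norm ?A * norm (?S - ?T) + norm (?A - ?B) * norm ?T"
        by (rule norm_blinfun_compose_diff)
      also have "\<dots> \<le> \<Lambda> * \<eta>' + (2 * \<mu>) * (\<Lambda>n + 1)"
        using \<Lambda>(2)[of ?a] \<Lambda>(1) ST AB T \<mu>(1) by (intro add_mono mult_mono) auto
      also have "\<dots> \<le> \<eta> / 4 + 2 * (\<eta> / 4)"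
        using \<eta>'(5) \<mu>(3) by simp
      also have "\<dots> < \<eta>" using Suc.prems by simp
      finally show "dist ((F ^^ Suc n) p) ((G ^^ Suc n) p) < \<eta> \<and> norm ((?A o\<^sub>L ?S) - (?B o\<^sub>L ?T)) < \<eta>"
        using 1 by simp
    qed
  qed (use \<epsilon> \<mu> in auto)
qed

text \<open>Cones are expanded only by an iterate, so the Lipschitz bound has to be passed on to
  iterates.\<close>

lemma torus_deriv_funpow_lipschitz:
  assumes G: "C1_map G"
    and lip: "\<And>x y. norm (torus_deriv G (proj x) - torus_deriv G (proj y)) \<le> L * norm (x - y)" and L: "L > 0"
  shows "\<exists>L'>0. \<forall>x y. norm (torus_deriv (G ^^ n) (proj x) - torus_deriv (G ^^ n) (proj y)) \<le> L' * norm (x - y)"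
proof (induction n)
  case 0
  show ?case by (intro exI[of _ 1]) simp
next
  case (Suc n)
  then obtain L' where L': "L' > 0" "\<And>x y. norm (torus_deriv (G ^^ n) (proj x) - torus_deriv (G ^^ n) (proj y)) \<le> L' * norm (x - y)"
    by blast
  note Gn = C1_map_funpow[OF G, of n]
  obtain g where g: "torus_lift (G ^^ n) g"
    using torus_lift_exists[OF C1_map_continuous[OF Gn]] .
  obtain \<Lambda> where \<Lambda>: "\<Lambda> > 0" "\<And>p. norm (torus_deriv G p) \<le> \<Lambda>"
    using torus_continuous_bounded[OF C1_map_deriv_continuous[OF G]] by blast
  obtain \<Lambda>n where \<Lambda>n: "\<Lambda>n > 0" "\<And>p. norm (torus_deriv (G ^^ n) p) \<le> \<Lambda>n"
    using torus_continuous_bounded[OF C1_map_deriv_continuous[OF Gn]] by blast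
  show ?case
  proof (intro exI[of _ "\<Lambda> * L' + L * \<Lambda>n * \<Lambda>n"] conjI allI)
    show "\<Lambda> * L' + L * \<Lambda>n * \<Lambda>n > 0" using \<Lambda> \<Lambda>n L' L by (simp add: add_pos_pos)
    fix x y
    let ?A = "torus_deriv G ((G ^^ n) (proj x))" and ?B = "torus_deriv G ((G ^^ n) (proj y))"
    let ?S = "torus_deriv (G ^^ n) (proj x)" and ?T = "torus_deriv (G ^^ n) (proj y)"
    have "norm (?A - ?B) \<le> L * norm (g x - g y)"
      using lip[of "g x" "g y"] by (simp add: torus_lift_proj[OF g])
    also have "\<dots> \<le> L * (\<Lambda>n * norm (x - y))"
      using L by (intro mult_left_mono lift_lipschitz[OF Gn g \<Lambda>n(2)]) auto
    finally have AB: "norm (?A - ?B) \<le> L * (\<Lambda>n * norm (x - y))" .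
    have "norm ((?A o\<^sub>L ?S) - (?B o\<^sub>L ?T)) \<le> norm ?A * norm (?S - ?T) + norm (?A - ?B) * norm ?T"
      by (rule norm_blinfun_compose_diff)
    also have "\<dots> \<le> \<Lambda> * (L' * norm (x - y)) + (L * (\<Lambda>n * norm (x - y))) * \<Lambda>n"
      using \<Lambda> \<Lambda>n L'(2) AB L by (intro add_mono mult_mono) auto
    finally show "norm (torus_deriv (G ^^ Suc n) (proj x) - torus_deriv (G ^^ Suc n) (proj y))
        \<le> (\<Lambda> * L' + L * \<Lambda>n * \<Lambda>n) * norm (x - y)"
      unfolding torus_deriv_funpow_Suc[OF G] by (simp add: algebra_simps)
  qed
qed

section \<open>Totally disconnected sets attract almost nothing\<close>

text \<open>In a compact Hausdorff space, two closed sets that no connected set joins can be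
  separated by a clopen partition; here p and the complement of a ball around it.\<close>

lemma totally_disconnected_clopen:
  fixes K :: "'a::metric_space set"
  assumes K: "compact K" and td: "\<And>C. C \<subseteq> K \<Longrightarrow> connected C \<Longrightarrow> \<exists>x. C \<subseteq> {x}"
    and p: "p \<in> K" and d: "d > 0"
  obtains U V where "compact U" "compact V" "U \<union> V = K" "U \<inter> V = {}" "p \<in> U" "U \<subseteq> ball p d"
proof -
  let ?X = "top_of_set K"
  have "separated_between ?X {p} (K - ball p d)"
  proof (rule cut_wire_fence_theorem_gen)
    show "compact_space ?X" using K by (simp add: compact_space_subtopology)
    show "Hausdorff_space ?X \<or> regular_space ?X \<or> normal_space ?X"
      by (simp add: Hausdorff_space_subtopology)
    show "compactin ?X {p}" using p by simp
    show "closedin ?X (K - ball p d)"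
      by (metis closedin_closed_Int Diff_eq open_ball closed_Compl)
    fix C assume "connectedin ?X C"
    then have "C \<subseteq> K" "connected C" by (simp_all add: connectedin_subtopology)
    then obtain x where "C \<subseteq> {x}" using td by blast
    then show "disjnt C {p} \<or> disjnt C (K - ball p d)"
      using d by (cases "x = p") (auto simp: disjnt_def)
  qed
  then obtain U V where UV: "closedin ?X U" "closedin ?X V" "U \<union> V = K" "disjnt U V" "{p} \<subseteq> U" "K - ball p d \<subseteq> V"
    unfolding separated_between_alt by auto
  show ?thesis
  proof (rule that)
    show "compact U" "compact V" using UV K by (auto intro: closedin_compact)
    show "U \<subseteq> ball p d" using UV(3,4,6) by (auto simp: disjnt_def)
  qed (use UV in \<open>auto simp: disjnt_def\<close>)
qed

lemma compact_separated_distance: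
  fixes U V :: "'a::metric_space set"
  assumes "compact U" "closed V" "U \<inter> V = {}"
  shows "\<exists>\<rho>>0. \<forall>u\<in>U. \<forall>v\<in>V. \<rho> \<le> dist u v"
proof (cases "U = {} \<or> V = {}")
  case True
  then show ?thesis by (intro exI[of _ 1]) auto
next
  case False
  have "continuous_on U (\<lambda>u. infdist u V)"
    by (rule continuous_on_infdist[OF continuous_on_id])
  then obtain u0 where u0: "u0 \<in> U" "\<And>u. u \<in> U \<Longrightarrow> infdist u0 V \<le> infdist u V"
    using continuous_attains_inf[OF assms(1)] False by blast
  have "infdist u0 V > 0"
    using u0(1) assms False in_closed_iff_infdist_zero[OF assms(2), of u0] infdist_nonneg[of u0 V] by fastforce
  moreover have "infdist u0 V \<le> dist u v" if "u \<in> U" "v \<in> V" for u v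
    using u0(2)[OF that(1)] infdist_le[OF that(2), of u] by simp
  ultimately show ?thesis by blast
qed

lemma compact_infdist_attained:
  fixes K :: "'a::metric_space set"
  assumes "compact K" "K \<noteq> {}"
  shows "\<exists>k\<in>K. dist q k \<le> infdist q K"
proof -
  have "continuous_on K (dist q)" by (intro continuous_intros)
  then obtain k where k: "k \<in> K" "\<And>a. a \<in> K \<Longrightarrow> dist q k \<le> dist q a"
    using continuous_attains_inf[OF assms] by blast
  have "dist q k \<le> infdist q K"
    unfolding infdist_notempty[OF assms(2)] by (intro cINF_greatest assms(2) k(2))
  with k(1) show ?thesis by blast
qed

text \<open>Cover K by finitely many small clopen pieces, each at positive distance from the rest. A
  connected set in a sufficiently thin neighbourhood cannot cross such a gap, so it stays near one
  piece.\<close>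

lemma totally_disconnected_neighbourhood:
  fixes K :: "'a::metric_space set"
  assumes K: "compact K" and td: "\<And>C. C \<subseteq> K \<Longrightarrow> connected C \<Longrightarrow> \<exists>x. C \<subseteq> {x}" and d: "d > 0"
  obtains \<rho> where "\<rho> > 0"
    "\<And>S x y. connected S \<Longrightarrow> (\<And>z. z \<in> S \<Longrightarrow> \<exists>w\<in>K. dist z w < \<rho>) \<Longrightarrow> x \<in> S \<Longrightarrow> y \<in> S \<Longrightarrow> dist x y < d"
proof -
  have "\<exists>U V \<rho>. U \<union> V = K \<and> p \<in> U \<and> openin (top_of_set K) U \<and> U \<subseteq> ball p (d/4) \<and> \<rho> > 0 \<and> (\<forall>u\<in>U. \<forall>v\<in>V. \<rho> \<le> dist u v)"
    if p: "p \<in> K" for p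
  proof -
    obtain U V where UV: "compact U" "compact V" "U \<union> V = K" "U \<inter> V = {}" "p \<in> U" "U \<subseteq> ball p (d/4)"
      using totally_disconnected_clopen[OF K td p, of "d/4"] d by auto
    obtain \<rho> where "\<rho> > 0" "\<forall>u\<in>U. \<forall>v\<in>V. \<rho> \<le> dist u v"
      using compact_separated_distance[OF UV(1) compact_imp_closed[OF UV(2)] UV(4)] by blast
    moreover have "openin (top_of_set K) (K \<inter> - V)"
      using compact_imp_closed[OF UV(2)] by (intro openin_open_Int) (simp add: open_Compl)
    then have "openin (top_of_set K) U"
      by (rule ssubst[of U "K \<inter> - V", rotated]) (use UV(3,4) in blast)
    ultimately show ?thesis using UV by blast
  qed
  then obtain U V \<rho> where U: "\<And>p. p \<in> K \<Longrightarrow> U p \<union> V p = K \<and> p \<in> U p \<and> openin (top_of_set K) (U p) \<and>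
      U p \<subseteq> ball p (d/4) \<and> \<rho> p > 0 \<and> (\<forall>u\<in>U p. \<forall>v\<in>V p. \<rho> p \<le> dist u v)"
    by metis
  have "\<exists>T. finite T \<and> T \<subseteq> K \<and> K \<subseteq> (\<Union>p\<in>T. U p)"
  proof -
    have "\<exists>W. open W \<and> U p = K \<inter> W" if "p \<in> K" for p
      using U[OF that] by (auto simp: openin_open)
    then obtain W where W: "\<And>p. p \<in> K \<Longrightarrow> open (W p) \<and> U p = K \<inter> W p" by metis
    obtain T where "T \<subseteq> K" "finite T" "K \<subseteq> (\<Union>p\<in>T. W p)"
      using compactE_image[OF K, of K W] W U by (metis IntD2 UN_I subsetI)
    moreover from this have "K \<subseteq> (\<Union>p\<in>T. U p)" using W by blast
    ultimately show ?thesis by blast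
  qed
  then obtain T where T: "finite T" "T \<subseteq> K" "K \<subseteq> (\<Union>p\<in>T. U p)" by blast
  \<comment> \<open>Half of every gap keeps the thickened sides disjoint; d/4 keeps a thickened
    piece within d/2 of its centre.\<close>
  define r where "r = Min (insert (d/4) ((\<lambda>p. \<rho> p / 2) ` T))"
  have r: "r > 0" "r \<le> d/4" "\<And>p. p \<in> T \<Longrightarrow> 2 * r \<le> \<rho> p"
  proof -
    show "r > 0" unfolding r_def using T U d by (subst Min_gr_iff) auto
    show "r \<le> d/4" unfolding r_def using T by (intro Min_le) auto
    fix p assume "p \<in> T"
    then have "r \<le> \<rho> p / 2" unfolding r_def using T by (intro Min_le) auto
    then show "2 * r \<le> \<rho> p" by simp
  qed
  show ?thesis
  proof (rule that[OF r(1)])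
    fix S x y assume S: "connected S" "\<And>z. z \<in> S \<Longrightarrow> \<exists>w\<in>K. dist z w < r" "x \<in> S" "y \<in> S"
    obtain w where w: "w \<in> K" "dist x w < r" using S(2)[OF S(3)] by blast
    obtain p where p: "p \<in> T" "w \<in> U p" using w T(3) by blast
    note Up = U[OF subsetD[OF T(2) p(1)]]
    let ?N = "\<lambda>A. \<Union>a\<in>A. ball a r"
    have sub: "S \<subseteq> ?N (U p) \<union> ?N (V p)"
    proof
      fix z assume "z \<in> S"
      then obtain w' where "w' \<in> K" "dist z w' < r" using S(2) by blast
      moreover have "w' \<in> U p \<union> V p" using Up \<open>w' \<in> K\<close> by blast
      ultimately show "z \<in> ?N (U p) \<union> ?N (V p)" by (auto simp: dist_commute)
    qed
    have disj: "?N (U p) \<inter> ?N (V p) = {}"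
    proof (rule ccontr)
      assume "\<not> ?thesis"
      then obtain z u v where z: "u \<in> U p" "v \<in> V p" "dist u z < r" "dist v z < r" by auto
      have "dist u v \<le> dist u z + dist v z" by (rule dist_triangle2)
      also have "\<dots> < \<rho> p" using z r(3)[OF p(1)] by simp
      finally show False using Up z by force
    qed
    have x: "x \<in> ?N (U p)" using w p by (auto simp: dist_commute)
    have "?N (U p) \<inter> ?N (V p) \<inter> S = {}" using disj by simp
    then have "?N (U p) \<inter> S = {} \<or> ?N (V p) \<inter> S = {}"
      by (intro connectedD[OF S(1)] sub open_UN ballI open_ball)
    then have all: "S \<subseteq> ?N (U p)" using sub x S(3) by blast
    have near: "dist p z < d/2" if z: "z \<in> S" for z
    proof -
      obtain u where "u \<in> U p" "dist u z < r" using all z by auto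
      moreover have "dist p u < d/4" using Up \<open>u \<in> U p\<close> by auto
      ultimately show ?thesis
        using dist_triangle[of p z u] r(2) by simp
    qed
    show "dist x y < d"
      using near[OF S(3)] near[OF S(4)] dist_triangle3[of x y p] by simp
  qed
qed

text \<open>Otherwise some z in S lies at distance exactly d from x. Its projection is closer than
  d, so another representative lies within d of x, and the two representatives would differ by a
  nonzero lattice vector of norm below 1.\<close>

lemma connected_lift_small:
  assumes S: "connected S" and d: "d \<le> 1/2"
    and close: "\<And>x y. x \<in> S \<Longrightarrow> y \<in> S \<Longrightarrow> dist (proj x) (proj y) < d" and xy: "x \<in> S" "y \<in> S"
  shows "dist x y < d"
proof (rule ccontr)
  assume neg: "\<not> ?thesis"
  have "connected (dist x ` S)"
    by (intro connected_continuous_image S continuous_intros)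
  moreover have "0 \<in> dist x ` S" "dist x y \<in> dist x ` S"
    using xy by (auto intro: image_eqI[of _ _ x])
  ultimately have "{0..dist x y} \<subseteq> dist x ` S"
    by (metis connected_contains_Icc)
  moreover have "d \<in> {0..dist x y}"
    using neg close[OF xy(1,1)] by auto
  ultimately obtain z where z: "z \<in> S" "dist x z = d" by auto
  obtain w where w: "proj w = proj z" "dist (proj x) (proj z) = dist x w"
    by (rule dist_proj_attained)
  have wz: "w - z \<in> int_lattice" using w(1) by (simp add: proj_eq_iff)
  have "norm (w - z) \<le> dist x w + dist x z"
    using dist_triangle3[of w z x] by (simp add: dist_norm)
  also have "\<dots> < 1" using z(2) w(2) close[OF xy(1) z(1)] d by simp
  finally have "w = z" using lattice_small_eq_0[OF wz] by simp
  then show False using w(2) z close[OF xy(1) z(1)] by simp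
qed

text \<open>The cone is the set of vectors whose unstable component, in the splitting of F,
  dominates. A high iterate of F maps it strictly inside itself with large expansion, and this
  survives C^1 perturbation; no splitting for G is constructed. N and \<epsilon> do not depend on L,
  so smoothing may produce a huge Lipschitz constant.\<close>

theorem anosov_perturbation_expands_cone:
  assumes "anosov F"
  obtains N \<epsilon> where "N > 0" "\<epsilon> > 0"
    "\<And>G L g. C1_map G \<Longrightarrow> C1_close \<epsilon> F G \<Longrightarrow> L > 0 \<Longrightarrow>
      (\<And>x y. norm (torus_deriv G (proj x) - torus_deriv G (proj y)) \<le> L * norm (x - y)) \<Longrightarrow>
      torus_lift (G ^^ N) g \<Longrightarrow>
      \<exists>C L' \<Lambda>. cone_expanding g (\<lambda>x. torus_deriv (G ^^ N) (proj x)) C L' \<Lambda> \<and>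
        (\<forall>z. \<exists>v r. v \<noteq> 0 \<and> r > 0 \<and> (\<forall>y\<in>ball z r. v \<in> C y))"
proof -
  obtain P :: "torus \<Rightarrow> (real^2) \<Rightarrow>\<^sub>L (real^2)" and B \<theta> Lb where
    hc: "hyperbolic_cocycle F (inv F) (torus_deriv F) (torus_deriv (inv F)) P B \<theta> Lb"
    and nontrivial: "\<And>p. \<exists>s. s \<noteq> 0 \<and> P p s = s" "\<And>p. \<exists>u. u \<noteq> 0 \<and> P p u = 0"
    and idem: "\<And>p v. P p (P p v) = P p v"
    using anosov_hyperbolic_cocycle[OF assms] by blast
  interpret T: hyperbolic_cocycle F "inv F" "torus_deriv F" "torus_deriv (inv F)" P B \<theta> Lb
    by (rule hc)
  have dF: "C1_diffeo F" using assms by (simp add: anosov_def)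
  note D = C1_diffeoD[OF dF]
  define M where "M = 1 + Lb"
  have Lb: "Lb \<ge> 0" using T.bound(1) norm_ge_zero order_trans by blast
  have M: "M \<ge> 1" "norm (P p v) \<le> M * norm v" "norm (v - P p v) \<le> M * norm v" for p v
  proof -
    have *: "norm (P p v) \<le> Lb * norm v"
      using norm_blinfun[of "P p" v] T.bound(3)[of p] by (meson mult_right_mono norm_ge_zero order_trans)
    then show "norm (P p v) \<le> M * norm v" by (simp add: M_def algebra_simps add_increasing)
    show "norm (v - P p v) \<le> M * norm v"
      using * norm_triangle_ineq4[of v "P p v"] by (simp add: M_def algebra_simps)
    show "M \<ge> 1" using Lb by (simp add: M_def)
  qed
  \<comment> \<open>Chosen so that the iterate stretches the unstable part of a cone vector v to
    length at least 4 M times the norm of v; perturbation errors reduce this to 3 M.\<close>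
  define \<kappa> where "\<kappa> = 1 / (8 * M)"
  have kM: "\<kappa> > 0" "\<kappa> * M = 1/8" "\<kappa> \<le> 1/8" using M(1) by (auto simp: \<kappa>_def field_simps)
  obtain n where "\<theta> ^ n < \<kappa> / B"
    using real_arch_pow_inv[of "\<kappa> / B" \<theta>] kM(1) T.B_pos T.theta by auto
  define N where "N = Suc n"
  have "\<theta> ^ N \<le> \<theta> ^ n" unfolding N_def using T.theta by (intro power_decreasing) auto
  then have BN: "B * \<theta> ^ N \<le> \<kappa>"
    using \<open>\<theta> ^ n < \<kappa> / B\<close> T.B_pos by (simp add: field_simps) (smt (verit) mult_left_mono mult.commute)
  have equiv: "P ((F ^^ k) p) (torus_deriv (F ^^ k) p v) = torus_deriv (F ^^ k) p (P p v)" for k p v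
  proof (induction k)
    case (Suc k)
    then show ?case
      unfolding torus_deriv_funpow_Suc[OF D(2)] by (simp add: T.equivariant)
  qed simp
  have stable: "norm (torus_deriv (F ^^ N) p (P p v)) \<le> \<kappa> * norm v" for p v
  proof -
    have "norm (torus_deriv (F ^^ N) p (P p v)) \<le> B * \<theta> ^ N * norm v"
      using T.stable[of N p v] by (simp add: cocycle_torus_deriv[OF D(2)])
    also have "\<dots> \<le> \<kappa> * norm v" using BN by (intro mult_right_mono) auto
    finally show ?thesis .
  qed
  have unstable: "norm (v - P p v) \<le> \<kappa> * norm (torus_deriv (F ^^ N) p (v - P p v))" for p v
  proof -
    let ?z = "torus_deriv (F ^^ N) p (v - P p v)" and ?q = "(F ^^ N) p"
    have "P ?q ?z = 0"
      unfolding equiv by (simp add: blinfun.diff_right idem)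
    then have "norm (torus_deriv (inv F ^^ N) ?q ?z) \<le> B * \<theta> ^ N * norm ?z"
      using T.unstable[of N ?q ?z] by (simp add: cocycle_torus_deriv[OF D(3)])
    also have "torus_deriv (inv F ^^ N) ?q ?z = v - P p v"
      using C1_diffeoD(6)[OF C1_diffeo_funpow(1)[OF dF]] C1_diffeo_funpow(2)[OF dF] by metis
    also have "B * \<theta> ^ N * norm ?z \<le> \<kappa> * norm ?z" using BN by (intro mult_right_mono) auto
    finally show ?thesis .
  qed
  obtain \<Lambda> where \<Lambda>: "\<Lambda> > 0" "\<And>p. norm (torus_deriv (F ^^ N) p) \<le> \<Lambda>"
    using torus_continuous_bounded[OF C1_map_deriv_continuous[OF C1_map_funpow[OF D(2)]]] by blast
  \<comment> \<open>Tolerance for moving the base point of the projection; its contribution to the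
    error below is half of \<kappa>.\<close>
  define \<mu> where "\<mu> = \<kappa> / (2 * (\<Lambda> + 1))"
  have "\<kappa> / (2 * k) * k = \<kappa> / 2" if "k > 0" for k using that by simp
  from this[of "\<Lambda> + 1"] have \<mu>: "\<mu> > 0" "\<mu> * (\<Lambda> + 1) = \<kappa> / 2"
    using kM(1) \<Lambda>(1) unfolding \<mu>_def by (simp, linarith)
  obtain d where d: "d > 0" "\<And>p q. dist p q < d \<Longrightarrow> dist (P p) (P q) < \<mu>"
    using torus_continuous_uniform[OF T.cont(3) \<mu>(1)] by blast
  \<comment> \<open>Tolerance for the iterate itself: the other half of \<kappa>, and small enough
    to keep base points within the modulus d.\<close>
  define \<eta> where "\<eta> = min (min 1 (\<kappa> / (2 * M))) d"
  have \<eta>: "\<eta> > 0" "\<eta> \<le> 1" "M * \<eta> \<le> \<kappa> / 2" "\<eta> \<le> d" "\<eta> \<le> \<kappa>"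
  proof -
    show "\<eta> > 0" "\<eta> \<le> d" using kM M(1) d(1) by (auto simp: \<eta>_def)
    show "\<eta> \<le> 1" unfolding \<eta>_def by (intro min.coboundedI1 min.cobounded1)
    have 1: "\<eta> \<le> \<kappa> / (2 * M)" by (simp add: \<eta>_def)
    then have "M * \<eta> \<le> M * (\<kappa> / (2 * M))" using M(1) by (intro mult_left_mono) auto
    also have "\<dots> = \<kappa> / 2" using M(1) by simp
    finally show 2: "M * \<eta> \<le> \<kappa> / 2" .
    have "1 * \<eta> \<le> M * \<eta>" using M(1) \<open>\<eta> > 0\<close> by (intro mult_right_mono) auto
    then show "\<eta> \<le> \<kappa>" using 2 kM(1) by simp
  qed
  obtain \<epsilon> where \<epsilon>: "\<epsilon> > 0" "\<And>G. C1_map G \<Longrightarrow> C1_close \<epsilon> F G \<Longrightarrow> C1_close \<eta> (F ^^ N) (G ^^ N)"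
    using C1_close_funpow[OF D(2) \<eta>(1), of N] by blast
  show ?thesis
  proof (rule that[of N \<epsilon>])
    show "N > 0" by (simp add: N_def)
    show "\<epsilon> > 0" by (rule \<epsilon>(1))
    fix G L g
    assume G: "C1_map G" and close0: "C1_close \<epsilon> F G" and L: "L > 0"
      and lip: "\<And>x y. norm (torus_deriv G (proj x) - torus_deriv G (proj y)) \<le> L * norm (x - y)"
      and g: "torus_lift (G ^^ N) g"
    have close: "C1_close \<eta> (F ^^ N) (G ^^ N)" by (rule \<epsilon>(2)[OF G close0])
    define A where "A p = torus_deriv (G ^^ N) p" for p
    define E where "E p = torus_deriv (F ^^ N) p" for p
    have AE: "norm (A p v - E p v) \<le> \<eta> * norm v" for p v
    proof -
      have "norm (A p v - E p v) = norm ((E p - A p) v)"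
        by (simp add: blinfun.diff_left norm_minus_commute)
      also have "\<dots> \<le> norm (E p - A p) * norm v" by (rule norm_blinfun)
      also have "\<dots> \<le> \<eta> * norm v"
        using close unfolding C1_close_def A_def E_def by (intro mult_right_mono) (auto intro: less_imp_le)
      finally show ?thesis .
    qed
    have A_bound: "norm (A p) \<le> \<Lambda> + 1" for p
    proof -
      have "norm (A p) \<le> norm (E p) + norm (E p - A p)"
        using norm_triangle_ineq4[of "E p" "E p - A p"] by simp
      moreover have "norm (E p - A p) < 1"
        using close \<eta>(2) unfolding C1_close_def A_def E_def by (meson less_le_trans)
      ultimately show ?thesis using \<Lambda>(2)[of p] by (simp add: E_def)
    qed
    have PA: "norm (P ((G ^^ N) p) (A p v) - E p (P p v)) \<le> \<kappa> * norm v" for p v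
    proof -
      let ?q = "(F ^^ N) p" and ?q' = "(G ^^ N) p"
      have "dist ?q' ?q < d"
        using close \<eta>(4) unfolding C1_close_def by (metis dist_commute less_le_trans)
      then have PP: "norm (P ?q' - P ?q) \<le> \<mu>" using d(2) by (simp add: dist_norm less_imp_le)
      have "norm ((P ?q' - P ?q) (A p v)) \<le> norm (P ?q' - P ?q) * norm (A p v)"
        by (rule norm_blinfun)
      also have "\<dots> \<le> \<mu> * ((\<Lambda> + 1) * norm v)"
        using PP \<mu>(1) order_trans[OF norm_blinfun mult_right_mono[OF A_bound norm_ge_zero]]
        by (intro mult_mono) auto
      also have "\<dots> = \<kappa> / 2 * norm v" using \<mu>(2) by (metis mult.assoc)
      finally have 1: "norm ((P ?q' - P ?q) (A p v)) \<le> \<kappa> / 2 * norm v" .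
      have "norm (P ?q (A p v - E p v)) \<le> M * norm (A p v - E p v)" by (rule M(2))
      also have "\<dots> \<le> M * (\<eta> * norm v)" using M(1) AE by (intro mult_left_mono) auto
      also have "\<dots> \<le> \<kappa> / 2 * norm v"
        using mult_right_mono[OF \<eta>(3), of "norm v"] by simp
      finally have 2: "norm (P ?q (A p v - E p v)) \<le> \<kappa> / 2 * norm v" .
      have "P ?q' (A p v) - E p (P p v) = (P ?q' - P ?q) (A p v) + P ?q (A p v - E p v)"
        using equiv[of N p v] by (simp add: E_def blinfun.diff_left blinfun.diff_right)
      then show ?thesis
        using 1 2 norm_triangle_ineq[of "(P ?q' - P ?q) (A p v)" "P ?q (A p v - E p v)"] by simp
    qed
    define C where "C x = {v. norm (P (proj x) v) \<le> norm (v - P (proj x) v)}" for x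
    have cone_half: "norm v \<le> 2 * norm (v - P (proj x) v)" if "v \<in> C x" for v x
    proof -
      have "norm v \<le> norm (P (proj x) v) + norm (v - P (proj x) v)"
        using norm_triangle_ineq[of "P (proj x) v" "v - P (proj x) v"] by simp
      then show ?thesis using that by (simp add: C_def)
    qed
    have proj_g: "proj (g x) = (G ^^ N) (proj x)" for x
      by (rule torus_lift_proj[OF g])
    have main: "norm (P (proj (g x)) (A (proj x) v)) \<le> norm v"
      "3 * M * norm v \<le> norm (A (proj x) v - P (proj (g x)) (A (proj x) v))" if v: "v \<in> C x" for x v
    proof -
      let ?p = "proj x" and ?p' = "proj (g x)"
      let ?u = "v - P ?p v"
      have PA': "norm (P ?p' (A ?p v) - E ?p (P ?p v)) \<le> \<kappa> * norm v"
        using PA[of ?p v] by (simp add: proj_g)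
      have kv: "\<kappa> * norm v \<le> 1/8 * norm v" using kM(3) by (intro mult_right_mono) auto
      have st: "norm (E ?p (P ?p v)) \<le> \<kappa> * norm v" using stable by (simp add: E_def)
      show "norm (P ?p' (A ?p v)) \<le> norm v"
        using norm_triangle_sub[of "P ?p' (A ?p v)" "E ?p (P ?p v)"] PA' st kv norm_ge_zero[of v]
        by linarith
      have "E ?p ?u = (A ?p v - P ?p' (A ?p v)) + (P ?p' (A ?p v) - E ?p (P ?p v)) - (A ?p v - E ?p v)"
        by (simp add: blinfun.diff_right)
      then have "norm (E ?p ?u) \<le> norm (A ?p v - P ?p' (A ?p v)) + norm (P ?p' (A ?p v) - E ?p (P ?p v)) + norm (A ?p v - E ?p v)"
        using norm_triangle_ineq4[of "(A ?p v - P ?p' (A ?p v)) + (P ?p' (A ?p v) - E ?p (P ?p v))" "A ?p v - E ?p v"]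
          norm_triangle_ineq[of "A ?p v - P ?p' (A ?p v)" "P ?p' (A ?p v) - E ?p (P ?p v)"] by simp
      also have "\<dots> \<le> norm (A ?p v - P ?p' (A ?p v)) + 1/8 * norm v + 1/8 * norm v"
        using PA' kv AE[of ?p v] mult_right_mono[OF \<eta>(5) norm_ge_zero[of v]] by linarith
      finally have low: "norm (E ?p ?u) \<le> norm (A ?p v - P ?p' (A ?p v)) + 1/4 * norm v" by simp
      have "norm v \<le> 2 * norm ?u" by (rule cone_half[OF v])
      also have "\<dots> \<le> 2 * (\<kappa> * norm (E ?p ?u))"
        using unstable by (simp add: E_def)
      finally have "4 * M * norm v \<le> 4 * M * (2 * (\<kappa> * norm (E ?p ?u)))"
        using M(1) by (intro mult_left_mono) auto
      also have "\<dots> = 8 * (\<kappa> * M) * norm (E ?p ?u)" by simp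
      also have "\<dots> = norm (E ?p ?u)" using kM(2) by simp
      finally have "4 * M * norm v \<le> norm (E ?p ?u)" .
      moreover have "1 * norm v \<le> M * norm v" using M(1) by (intro mult_right_mono) auto
      ultimately show "3 * M * norm v \<le> norm (A ?p v - P ?p' (A ?p v))"
        using low norm_ge_zero[of v] by linarith
    qed
    obtain L' where L': "L' > 0" "\<And>x y. norm (A (proj x) - A (proj y)) \<le> L' * norm (x - y)"
      using torus_deriv_funpow_lipschitz[OF G lip L, of N] unfolding A_def by blast
    have "cone_expanding g (\<lambda>x. A (proj x)) C L' (\<Lambda> + 1)"
    proof
      show "(g has_derivative blinfun_apply (A (proj x))) (at x)" for x
        unfolding A_def by (rule torus_lift_has_derivative[OF C1_map_funpow[OF G] g])
      show "norm (A (proj x)) \<le> \<Lambda> + 1" for x by (rule A_bound)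
      fix v x assume v: "v \<in> C x"
      have m: "1 * norm v \<le> M * norm v" using M(1) by (intro mult_right_mono) auto
      show "A (proj x) v \<in> C (g x)"
        using main(1)[OF v] main(2)[OF v, unfolded mult.assoc] m norm_ge_zero[of v]
        unfolding C_def mem_Collect_eq by linarith
      have "3 * M * norm v \<le> M * norm (A (proj x) v)"
        using main(2)[OF v] M(3)[of "A (proj x) v" "proj (g x)"] by linarith
      then have "M * (3 * norm v) \<le> M * norm (A (proj x) v)" by (simp add: mult_ac)
      then have "3 * norm v \<le> norm (A (proj x) v)" using M(1) by simp
      then show "2 * norm v \<le> norm (A (proj x) v)" using norm_ge_zero[of v] by linarith
    next
      fix x
      let ?p = "proj x"
      obtain s0 where s0: "s0 \<noteq> 0" "P ?p s0 = s0" using nontrivial(1) by blast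
      define e where "e = (1 / norm s0) *\<^sub>R s0"
      have e: "norm e = 1" "P ?p e = e" using s0 by (auto simp: e_def blinfun.scaleR_right)
      have "norm (A ?p e) \<le> norm (E ?p (P ?p e)) + norm (A ?p e - E ?p e)"
        using norm_triangle_ineq[of "E ?p e" "A ?p e - E ?p e"] e(2) by simp
      also have "\<dots> \<le> 2 * \<kappa>"
        using stable[of ?p e] AE[of ?p e] \<eta>(5) e(1) by (simp add: E_def)
      finally have Ae: "norm (A ?p e) \<le> 2 * \<kappa>" .
      \<comment> \<open>A stable unit vector, enlarged until its area with a cone vector v dominates
        the norm of v; its image still has norm at most 4 M \<kappa> = 1/2.\<close>
      define s where "s = (2 * M) *\<^sub>R e"
      have "norm (A ?p s) = 2 * M * norm (A ?p e)"
        using M(1) by (simp add: s_def blinfun.scaleR_right)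
      also have "\<dots> \<le> 2 * M * (2 * \<kappa>)" using M(1) Ae by (intro mult_left_mono) auto
      also have "\<dots> \<le> 1" using kM(2) by (simp add: mult_ac)
      finally have 1: "norm (A ?p s) \<le> 1" .
      have "norm v \<le> \<bar>area v s\<bar>" if v: "v \<in> C x" for v
      proof -
        \<comment> \<open>e turned by a right angle. In this orthonormal frame only the f-component
          of v, which is the area up to sign, contributes to the unstable part.\<close>
        define f :: "real^2" where "f = (\<chi> i. if i = 1 then - e $ 2 else e $ 1)"
        have f: "f $ 1 = - e $ 2" "f $ 2 = e $ 1" by (simp_all add: f_def)
        have ee: "e $ 1 * e $ 1 + e $ 2 * e $ 2 = 1"
          using norm_power2_real2[of e] e(1) by (simp add: power2_eq_square)
        have "(norm f)\<^sup>2 = 1\<^sup>2"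
          unfolding norm_power2_real2 using ee by (simp add: f power2_eq_square add.commute)
        then have "norm f = 1" by (rule power2_eq_imp_eq) auto
        have "v $ i = (v \<bullet> e) * e $ i - area v e * f $ i" for i
        proof -
          have "v $ 1 = v $ 1 * (e $ 1 * e $ 1 + e $ 2 * e $ 2)" "v $ 2 = v $ 2 * (e $ 1 * e $ 1 + e $ 2 * e $ 2)"
            by (simp_all add: ee)
          then show ?thesis
            using exhaust_2[of i] by (auto simp: inner_real2 area_def f algebra_simps)
        qed
        then have decomp: "v = (v \<bullet> e) *\<^sub>R e - area v e *\<^sub>R f"
          by (simp add: vec_eq_iff)
        have "v - P ?p v = - area v e *\<^sub>R (f - P ?p f)"
          by (subst (1 2) decomp) (simp add: blinfun.diff_right blinfun.scaleR_right e(2) algebra_simps)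
        then have "norm (v - P ?p v) = \<bar>area v e\<bar> * norm (f - P ?p f)" by simp
        also have "\<dots> \<le> \<bar>area v e\<bar> * (M * 1)"
          using M(3)[of f ?p] \<open>norm f = 1\<close> by (intro mult_left_mono) auto
        finally have "norm v \<le> 2 * (\<bar>area v e\<bar> * M)"
          using cone_half[OF v] by simp
        moreover have "area v s = 2 * M * area v e" by (simp add: s_def area_def algebra_simps)
        ultimately show ?thesis using M(1) by (simp add: abs_mult mult_ac)
      qed
      with 1 show "\<exists>s. norm (A ?p s) \<le> 1 \<and> (\<forall>v\<in>C x. norm v \<le> \<bar>area v s\<bar>)" by blast
    qed (use L' in auto)
    moreover have "\<exists>v r. v \<noteq> 0 \<and> r > 0 \<and> (\<forall>y\<in>ball z r. v \<in> C y)" for z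
    proof -
      obtain u where u: "u \<noteq> 0" "P (proj z) u = 0" using nontrivial(2) by blast
      obtain r where r: "r > 0" "\<And>p q. dist p q < r \<Longrightarrow> dist (P p) (P q) < 1/2"
        using torus_continuous_uniform[OF T.cont(3), of "1/2"] by auto
      have "u \<in> C y" if "y \<in> ball z r" for y
      proof -
        have "dist (proj y) (proj z) < r"
          using dist_proj_le[of y z] that by (simp add: dist_commute)
        then have "norm (P (proj y) - P (proj z)) \<le> 1/2" using r(2) by (simp add: dist_norm less_imp_le)
        then have "norm ((P (proj y) - P (proj z)) u) \<le> 1/2 * norm u"
          using norm_blinfun[of "P (proj y) - P (proj z)" u] by (meson mult_right_mono norm_ge_zero order_trans)
        then have "norm (P (proj y) u) \<le> 1/2 * norm u" by (simp add: blinfun.diff_left u(2))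
        then show ?thesis
          using norm_triangle_ineq[of "P (proj y) u" "u - P (proj y) u"] by (simp add: C_def)
      qed
      with u(1) r(1) show ?thesis by blast
    qed
    ultimately show "\<exists>C L' \<Lambda>. cone_expanding g (\<lambda>x. torus_deriv (G ^^ N) (proj x)) C L' \<Lambda> \<and>
        (\<forall>z. \<exists>v r. v \<noteq> 0 \<and> r > 0 \<and> (\<forall>y\<in>ball z r. v \<in> C y))"
      unfolding A_def by blast
  qed
qed

text \<open>Infinitely many excursions away from K would accumulate, by compactness, at a limit
  point outside K.\<close>

lemma omega_limit_eventually_near:
  assumes "omega_limit F p \<subseteq> K" "e > 0" "K \<noteq> {}"
  obtains k where "\<And>n. n \<ge> k \<Longrightarrow> infdist ((F ^^ n) p) K \<le> e"
proof (rule ccontr)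
  assume "\<not> thesis"
  with that have "\<exists>n\<ge>k. infdist ((F ^^ n) p) K > e" for k
    by (meson not_le)
  then have "\<exists>\<^sub>F n in sequentially. infdist ((F ^^ n) p) K > e"
    unfolding frequently_sequentially by blast
  then have "infinite {n. infdist ((F ^^ n) p) K > e}"
    by (simp add: frequently_cofinite flip: cofinite_eq_sequentially)
  then obtain r :: "nat \<Rightarrow> nat" where r: "strict_mono r" "\<And>n. infdist ((F ^^ r n) p) K > e"
    using infinite_enumerate by blast
  obtain l s where l: "strict_mono s" "((\<lambda>n. (F ^^ r n) p) \<circ> s) \<longlonglongrightarrow> l"
    using compact_torus unfolding compact_def by (metis UNIV_I)
  have "l \<in> omega_limit F p"
    unfolding omega_limit_def using r(1) l
    by (intro CollectI exI[of _ "r \<circ> s"]) (auto simp: o_def intro: strict_mono_o[unfolded o_def])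
  then have "infdist l K = 0" using assms(1) by (auto intro: infdist_zero)
  moreover have "(\<lambda>n. infdist ((F ^^ r (s n)) p) K) \<longlonglongrightarrow> infdist l K"
    using l(2) by (intro tendsto_infdist) (simp add: o_def)
  then have "e \<le> infdist l K"
    by (rule tendsto_lowerbound) (auto simp: r(2) less_imp_le)
  ultimately show False using assms(2) by simp
qed

text \<open>A point attracted to K is eventually trapped near K, so its lift lies in a preimage of
  the null set of trapped points under an iterate of the lift. Countably many differentiable
  preimages of a null set are null.\<close>

theorem totally_disconnected_basin_negligible:
  assumes "anosov F"
  obtains \<epsilon> where "\<epsilon> > 0"
    "\<And>G L (K :: torus set). C1_diffeo G \<Longrightarrow> C1_close \<epsilon> F G \<Longrightarrow> L > 0 \<Longrightarrow>
      (\<And>x y. norm (torus_deriv G (proj x) - torus_deriv G (proj y)) \<le> L * norm (x - y)) \<Longrightarrow>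
      compact K \<Longrightarrow> K \<noteq> {} \<Longrightarrow> (\<And>C. C \<subseteq> K \<Longrightarrow> connected C \<Longrightarrow> \<exists>x. C \<subseteq> {x}) \<Longrightarrow>
      negligible {x. omega_limit G (proj x) \<subseteq> K}"
proof -
  obtain N \<epsilon> where N: "N > 0" and eps: "\<epsilon> > 0" and expands:
    "\<And>G L g. C1_map G \<Longrightarrow> C1_close \<epsilon> F G \<Longrightarrow> L > 0 \<Longrightarrow>
      (\<And>x y. norm (torus_deriv G (proj x) - torus_deriv G (proj y)) \<le> L * norm (x - y)) \<Longrightarrow>
      torus_lift (G ^^ N) g \<Longrightarrow>
      \<exists>C L' \<Lambda>. cone_expanding g (\<lambda>x. torus_deriv (G ^^ N) (proj x)) C L' \<Lambda> \<and>
        (\<forall>z. \<exists>v r. v \<noteq> 0 \<and> r > 0 \<and> (\<forall>y\<in>ball z r. v \<in> C y))"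
    by (rule anosov_perturbation_expands_cone[OF assms]) blast
  show ?thesis
  proof (rule that[OF eps])
    fix G L and K :: "torus set"
    assume dG: "C1_diffeo G" and close: "C1_close \<epsilon> F G" and L: "L > 0"
      and lip: "\<And>x y. norm (torus_deriv G (proj x) - torus_deriv G (proj y)) \<le> L * norm (x - y)"
      and K: "compact K" "K \<noteq> {}" and td: "\<And>C. C \<subseteq> K \<Longrightarrow> connected C \<Longrightarrow> \<exists>x. C \<subseteq> {x}"
    note D = C1_diffeoD[OF dG]
    obtain g where g: "torus_lift G g"
      using torus_lift_exists[OF C1_map_continuous[OF D(2)]] .
    obtain g' where g': "torus_lift (inv G) g'" "\<And>x. g' (g x) = x" "\<And>x. g (g' x) = x"
      using torus_lift_inverse[OF D(1) g C1_map_continuous[OF D(3)]] by blast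
    note lift = torus_lift_funpow[OF g]
    obtain C L' \<Lambda> where ce: "cone_expanding (g ^^ N) (\<lambda>x. torus_deriv (G ^^ N) (proj x)) C L' \<Lambda>"
      and local: "\<And>z. \<exists>v r. v \<noteq> 0 \<and> r > 0 \<and> (\<forall>y\<in>ball z r. v \<in> C y)"
      using expands[OF D(2) close L lip lift] by blast
    interpret cone_expanding "g ^^ N" "\<lambda>x. torus_deriv (G ^^ N) (proj x)" C L' \<Lambda> by (rule ce)
    obtain \<delta> where \<delta>: "small_length \<delta>" by (rule small_length_exists)
    \<comment> \<open>The cap 1/2 lets smallness on the torus be lifted to the plane.\<close>
    define d where "d = min (\<delta> / 4) (1/2)"
    have d: "d > 0" "d \<le> \<delta> / 4" "d \<le> 1/2" using \<delta> by (auto simp: d_def small_length_def)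
    obtain \<rho> where \<rho>: "\<rho> > 0" "\<And>S x y. connected S \<Longrightarrow> (\<And>z. z \<in> S \<Longrightarrow> \<exists>w\<in>K. dist z w < \<rho>) \<Longrightarrow> x \<in> S \<Longrightarrow> y \<in> S \<Longrightarrow> dist x y < d"
      using totally_disconnected_neighbourhood[OF K(1) td d(1)] by blast
    \<comment> \<open>Half of \<rho> is spent on W; the other half is left for points close to
      W.\<close>
    define W where "W = {x. infdist (proj x) K \<le> \<rho> / 2}"
    define \<Omega> where "\<Omega> = {x. \<forall>n. ((g ^^ N) ^^ n) x \<in> W}"
    have W_near: "\<exists>k\<in>K. dist (proj w) k \<le> \<rho> / 2" if "w \<in> W" for w
      using compact_infdist_attained[OF K, of "proj w"] that by (force simp: W_def)
    have "negligible \<Omega>"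
      unfolding \<Omega>_def
    proof (rule trapped_negligible[OF \<delta>, of "\<rho> / 2"])
      show "closed W"
        unfolding W_def
        by (intro closed_Collect_le continuous_intros continuous_on_compose2[OF continuous_on_infdist[OF continuous_on_id] continuous_on_proj]) auto
      show "dist x y < \<delta> / 4" if S: "connected S" "\<And>z. z \<in> S \<Longrightarrow> \<exists>w\<in>W. dist z w < \<rho> / 2" "x \<in> S" "y \<in> S" for S x y
      proof -
        have near: "\<exists>k\<in>K. dist q k < \<rho>" if q: "q \<in> proj ` S" for q
        proof -
          obtain z where z: "z \<in> S" "q = proj z" using q by blast
          obtain w where w: "w \<in> W" "dist z w < \<rho> / 2" using S(2)[OF z(1)] by blast
          obtain k where k: "k \<in> K" "dist (proj w) k \<le> \<rho> / 2" using W_near[OF w(1)] by blast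
          have "dist q k < \<rho>"
            using dist_triangle[of "proj z" k "proj w"] dist_proj_le[of z w] w(2) k(2) z(2) by simp
          then show ?thesis using k(1) by blast
        qed
        have con: "connected (proj ` S)"
          by (intro connected_continuous_image continuous_on_proj S(1))
        have "dist (proj a) (proj b) < d" if "a \<in> S" "b \<in> S" for a b
          using \<rho>(2)[OF con near] that by blast
        then have "dist x y < d"
          by (rule connected_lift_small[OF S(1) d(3) _ S(3,4)])
        then show ?thesis using d(2) by simp
      qed
    qed (use \<rho>(1) local in auto)
    \<comment> \<open>Differentiability of the inverse iterates is what preserves null sets.\<close>
    moreover have "(g' ^^ k) differentiable_on \<Omega>" for k
      using torus_lift_has_derivative[OF C1_map_funpow[OF D(3)] torus_lift_funpow[OF g'(1)], of k]
      unfolding differentiable_on_def differentiable_def by (meson has_derivative_at_withinI)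
    ultimately have "negligible ((g' ^^ k) ` \<Omega>)" for k
      by (intro negligible_differentiable_image_negligible) auto
    then have "negligible (\<Union>k. (g' ^^ k) ` \<Omega>)" by blast
    moreover have "{x. omega_limit G (proj x) \<subseteq> K} \<subseteq> (\<Union>k. (g' ^^ k) ` \<Omega>)"
    proof
      fix x assume "x \<in> {x. omega_limit G (proj x) \<subseteq> K}"
      then obtain k where k: "\<And>n. n \<ge> k \<Longrightarrow> infdist ((G ^^ n) (proj x)) K \<le> \<rho> / 2"
        using omega_limit_eventually_near[of G "proj x" K "\<rho> / 2"] \<rho>(1) K(2) by auto
      have "((g ^^ N) ^^ n) ((g ^^ k) x) \<in> W" for n
      proof -
        have "((g ^^ N) ^^ n) ((g ^^ k) x) = (g ^^ (N * n + k)) x"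
          by (simp add: funpow_mult funpow_add)
        then have "proj (((g ^^ N) ^^ n) ((g ^^ k) x)) = (G ^^ (N * n + k)) (proj x)"
          using torus_lift_proj[OF lift] by simp
        then show ?thesis using k[of "N * n + k"] by (simp add: W_def)
      qed
      then have "(g ^^ k) x \<in> \<Omega>" by (simp add: \<Omega>_def)
      moreover have "(g' ^^ k) ((g ^^ k) x) = x"
        by (induction k arbitrary: x) (simp_all add: funpow_swap1 g'(2))
      ultimately show "x \<in> (\<Union>k. (g' ^^ k) ` \<Omega>)" by (metis UN_I UNIV_I image_eqI)
    qed
    ultimately show "negligible {x. omega_limit G (proj x) \<subseteq> K}"
      by (rule negligible_subset)
  qed
qed

section \<open>The corollary\<close>

lemma negligible_not_AE_torus:
  assumes "negligible {x. P (proj x)}"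
  shows "\<not> (AE p in torus_lebesgue. P p)"
proof
  define Q where "Q = {x::real^2. \<forall>i. 0 \<le> x $ i \<and> x $ i < 1}"
  assume "AE p in torus_lebesgue. P p"
  then have "AE x in restrict_space lborel Q. P (proj x)"
    unfolding torus_lebesgue_def Q_def[symmetric]
    by (rule AE_distrD[rotated]) (simp add: measurable_restrict_space1)
  moreover have "Q = (\<Inter>i. {x. 0 \<le> x $ i} \<inter> {x. x $ i < 1})"
    by (auto simp: Q_def)
  then have "Q \<in> sets borel"
    by (auto intro!: sets.countable_INT' sets.Int borel_closed borel_open closed_Collect_le open_Collect_less
          continuous_intros)
  ultimately have "AE x in lborel. x \<in> Q \<longrightarrow> P (proj x)"
    by (simp add: AE_restrict_space_iff)
  then have "AE x in lebesgue. x \<in> Q \<longrightarrow> P (proj x)"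
    by (rule AE_completion)
  moreover have "AE x in lebesgue. x \<notin> {x. P (proj x)}"
    using assms by (intro AE_not_in) (simp add: negligible_iff_null_sets)
  ultimately have "AE x in lebesgue. x \<notin> Q"
    by eventually_elim auto
  then have "negligible Q"
    by (simp add: AE_iff_null_sets negligible_iff_null_sets completion.AE_iff_null_sets)
  moreover have "box 0 1 \<subseteq> Q"
    by (auto simp: Q_def mem_box_cart less_imp_le)
  ultimately have "negligible (box 0 (1::real^2))"
    by (rule negligible_subset)
  then show False
    using open_not_negligible[of "box 0 (1::real^2)"] by (auto simp: interval_ne_empty_cart)
qed

lemma milnor_attractor_attracts: "attracts_ae F (milnor_attractor F)"
  using theI'[OF milnor_attractor_exists] unfolding milnor_attractor_def is_milnor_attractor_def by blast

text \<open>Any attracting set contains the limit set of some point with limit set K, because a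
  probability space is not null.\<close>

lemma milnor_attractor_eqI:
  assumes "closed K" "AE x in torus_lebesgue. omega_limit F x = K"
  shows "milnor_attractor F = K"
proof -
  interpret prob_space torus_lebesgue by (rule prob_space_torus_lebesgue)
  have "B = K" if B: "attracts_ae F B" "B \<subseteq> K" for B
  proof -
    have "AE x in torus_lebesgue. K \<subseteq> B"
      using assms(2) B(1)[unfolded attracts_ae_def, THEN conjunct2] by eventually_elim auto
    then have "K \<subseteq> B" by (simp add: AE_const)
    then show ?thesis using B(2) by blast
  qed
  moreover have "attracts_ae F K"
    using assms unfolding attracts_ae_def by (auto elim: eventually_mono)
  ultimately have "is_milnor_attractor F K"
    by (simp add: is_milnor_attractor_def)
  then show ?thesis
    unfolding milnor_attractor_def using milnor_attractor_exists by (rule the1_equality[rotated])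
qed

text \<open>F is itself a C^1 diffeomorphism conjugate to G, so invariance at G applies to it
  through the inverse homeomorphism.\<close>

lemma invariant_conjugates:
  assumes "milnor_topologically_invariant G" and F: "C1_diffeo F"
    and H: "homeomorphism UNIV UNIV H H'" "\<And>p. H (F p) = G (H p)"
  shows "H ` milnor_attractor F = milnor_attractor G"
proof -
  have inv: "H' (H p) = p" "H (H' p) = p" for p
    using H(1) by (auto simp: homeomorphism_def)
  have "F = H' \<circ> G \<circ> H" using H(2) inv by (auto simp: fun_eq_iff simp flip: H(2))
  moreover have "homeomorphism UNIV UNIV H' H" using H(1) by (rule homeomorphism_symD)
  ultimately have "milnor_attractor F = H' ` milnor_attractor G"
    using assms(1) F unfolding milnor_topologically_invariant_def by blast
  then show ?thesis by (simp add: image_image inv)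
qed

theorem corollary3:
  fixes F :: "torus \<Rightarrow> torus" and \<nu> :: "torus measure" and K :: "torus set"
  assumes "anosov F"
    and "physical_measure F \<nu>"
    and "AE x in torus_lebesgue. x \<in> basin F \<nu>"
    and "horseshoe F K"
    and "AE x in \<nu>. x \<in> K"
    and "K \<in> null_sets torus_lebesgue"
    and "AE x in torus_lebesgue. omega_limit F x = K"
  shows "\<exists>\<epsilon>>0. \<forall>G. C1_diffeo G \<and> C1_close \<epsilon> F G \<longrightarrow> \<not> milnor_topologically_invariant G"
proof -
  have F: "C1_diffeo F" using assms(1) by (simp add: anosov_def)
  have K: "compact K" "K \<noteq> {}" and td: "\<And>C. C \<subseteq> K \<Longrightarrow> connected C \<Longrightarrow> \<exists>x. C \<subseteq> {x}"
    using assms(4) unfolding horseshoe_def cantor_set_def by auto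
  obtain \<epsilon>\<^sub>1 where e1: "\<epsilon>\<^sub>1 > 0" and stab: "\<And>G. C1_diffeo G \<Longrightarrow> C1_close \<epsilon>\<^sub>1 F G \<Longrightarrow>
      \<exists>H H'. homeomorphism UNIV UNIV H H' \<and> (\<forall>p. H (F p) = G (H p))"
    by (rule structural_stability[OF assms(1)]) blast
  obtain \<epsilon>\<^sub>2 where e2: "\<epsilon>\<^sub>2 > 0" and thin:
    "\<And>G L (K :: torus set). C1_diffeo G \<Longrightarrow> C1_close \<epsilon>\<^sub>2 F G \<Longrightarrow> L > 0 \<Longrightarrow>
      (\<And>x y. norm (torus_deriv G (proj x) - torus_deriv G (proj y)) \<le> L * norm (x - y)) \<Longrightarrow>
      compact K \<Longrightarrow> K \<noteq> {} \<Longrightarrow> (\<And>C. C \<subseteq> K \<Longrightarrow> connected C \<Longrightarrow> \<exists>x. C \<subseteq> {x}) \<Longrightarrow>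
      negligible {x. omega_limit G (proj x) \<subseteq> K}"
    by (rule totally_disconnected_basin_negligible[OF assms(1)]) blast
  \<comment> \<open>Close enough to F both for the conjugacy and for thinness of totally
    disconnected sets.\<close>
  obtain G\<^sub>2 L where G2: "C1_diffeo G\<^sub>2" "C1_close (min \<epsilon>\<^sub>1 \<epsilon>\<^sub>2) F G\<^sub>2" "L > 0"
    "\<And>x y. norm (torus_deriv G\<^sub>2 (proj x) - torus_deriv G\<^sub>2 (proj y)) \<le> L * norm (x - y)"
    using C1_diffeo_lipschitz_approximation[OF F, of "min \<epsilon>\<^sub>1 \<epsilon>\<^sub>2"] e1 e2 by auto
  obtain H\<^sub>2 H\<^sub>2' where H2: "homeomorphism UNIV UNIV H\<^sub>2 H\<^sub>2'" "\<And>p. H\<^sub>2 (F p) = G\<^sub>2 (H\<^sub>2 p)"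
    using stab[OF G2(1) C1_close_mono[OF G2(2)]] by auto
  have AF: "milnor_attractor F = K"
    by (rule milnor_attractor_eqI[OF compact_imp_closed[OF K(1)] assms(7)])
  have thin2: "\<not> (AE p in torus_lebesgue. omega_limit G\<^sub>2 p \<subseteq> H\<^sub>2 ` K)"
  proof (rule negligible_not_AE_torus[OF thin[OF G2(1) C1_close_mono[OF G2(2)] G2(3,4)]])
    show "compact (H\<^sub>2 ` K)"
      using H2(1) by (intro compact_continuous_image K(1)) (auto simp: homeomorphism_def intro: continuous_on_subset)
    fix C assume C: "C \<subseteq> H\<^sub>2 ` K" "connected C"
    have inv: "H\<^sub>2' (H\<^sub>2 p) = p" "H\<^sub>2 (H\<^sub>2' p) = p" for p
      using H2(1) by (auto simp: homeomorphism_def)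
    have "connected (H\<^sub>2' ` C)"
      using H2(1) by (intro connected_continuous_image C(2)) (auto simp: homeomorphism_def intro: continuous_on_subset)
    moreover have "H\<^sub>2' ` C \<subseteq> K" using C(1) inv by force
    ultimately obtain x where "H\<^sub>2' ` C \<subseteq> {x}" using td by blast
    then have "C \<subseteq> {H\<^sub>2 x}" using inv by (metis image_subset_iff singletonD singletonI subsetI)
    then show "\<exists>x. C \<subseteq> {x}" by blast
  qed (use K(2) in auto)
  show ?thesis
  proof (intro exI[of _ \<epsilon>\<^sub>1] conjI allI impI notI)
    fix G assume G: "C1_diffeo G \<and> C1_close \<epsilon>\<^sub>1 F G" and inv: "milnor_topologically_invariant G"
    obtain H H' where H: "homeomorphism UNIV UNIV H H'" "\<And>p. H (F p) = G (H p)"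
      using stab G by blast
    have "H' (H p) = p" for p using H(1) by (auto simp: homeomorphism_def)
    moreover have "homeomorphism UNIV UNIV (H \<circ> H\<^sub>2') (H\<^sub>2 \<circ> H')"
      by (rule homeomorphism_compose[OF homeomorphism_symD[OF H2(1)] H(1)])
    moreover have "(H \<circ> H\<^sub>2') (G\<^sub>2 p) = G ((H \<circ> H\<^sub>2') p)" for p
    proof -
      have "H\<^sub>2' (G\<^sub>2 p) = F (H\<^sub>2' p)"
        using H2(1) H2(2)[of "H\<^sub>2' p"] by (metis UNIV_I homeomorphism_apply1 homeomorphism_apply2)
      then show ?thesis by (simp add: H(2))
    qed
    \<comment> \<open>Invariance at G is used twice, for \<open>G\<^sub>2\<close> here and for F
      next; the two results describe the same set.\<close>
    ultimately have "(H \<circ> H\<^sub>2') ` milnor_attractor G\<^sub>2 = milnor_attractor G"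
      using invariant_conjugates[OF inv G2(1)] by blast
    also have "\<dots> = H ` K"
      using invariant_conjugates[OF inv F H] AF by simp
    finally have "H' ` (H \<circ> H\<^sub>2') ` milnor_attractor G\<^sub>2 = H' ` H ` K" by simp
    then have "H\<^sub>2' ` milnor_attractor G\<^sub>2 = K"
      using \<open>\<And>p. H' (H p) = p\<close> by (simp add: image_image)
    then have "milnor_attractor G\<^sub>2 = H\<^sub>2 ` K"
      using H2(1) by (auto simp: homeomorphism_def image_image)
    \<comment> \<open>The attractor of \<open>G\<^sub>2\<close> attracts almost every point, yet it
      is a homeomorphic image of the Cantor set K.\<close>
    then show False
      using thin2 milnor_attractor_attracts[of G\<^sub>2] unfolding attracts_ae_def by simp
  qed (rule e1)
qed

end
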